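(* Let $K$ be a real closed field and let $f\in K[X_1,\ldots,X_n]$ be positive semi-definite, i.e. $f(a)\geq0$ for all $a\in K^n$, where $\leq$ is the unique field order on $K$. Then $f$ is a sum of squares in the rational function field $K(X_1,\ldots,X_n)$.
   Context: A field $K$ is real if $-1$ is not a sum of squares in $K$; it is real closed if it is real and has no nontrivial algebraic extension that is real. A real closed field has exactly one field order. *)

theory Defs
  imports
    "HOL-Library.Poly_Mapping"
    "HOL-Library.FuncSet"
    "HOL-Algebra.Algebraic_Closure_Type"
begin

definition sum_of_squares :: "('a, 'b) ring_scheme \<Rightarrow> 'a \<Rightarrow> bool" where
  "sum_of_squares R x \<longleftrightarrow>
     (\<exists>(m :: nat) y. y \<in> {..<m} \<rightarrow> carrier R \<and> x = (\<Oplus>\<^bsub>R\<^esub>i\<in>{..<m}. y i \<otimes>\<^bsub>R\<^esub> y i))"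

definition real_field :: "('a, 'b) ring_scheme \<Rightarrow> bool" where
  "real_field R \<longleftrightarrow> field R \<and> \<not> sum_of_squares R (\<ominus>\<^bsub>R\<^esub> \<one>\<^bsub>R\<^esub>)"

definition algebraic_extension ::
    "('a, 'c) ring_scheme \<Rightarrow> ('b, 'd) ring_scheme \<Rightarrow> ('a \<Rightarrow> 'b) \<Rightarrow> bool" where
  "algebraic_extension K L h \<longleftrightarrow>
     field K \<and> field L \<and> h \<in> ring_hom K L \<and>
     (\<forall>x\<in>carrier L. ring.algebraic L (h ` carrier K) x)"

text \<open>
  HOL cannot quantify over the type that carries the extension \<open>L\<close>, so \<open>L\<close> ranges over all
  fields whose carrier is a set of lists over the type of \<open>K\<close>. This loses nothing:
  an algebraic extension of \<open>K\<close> has at most as many elements as there are polynomials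
  over \<open>K\<close>, hence is isomorphic over \<open>K\<close> to one of these.
\<close>

definition real_closed_field :: "('a, 'b) ring_scheme \<Rightarrow> bool" where
  "real_closed_field K \<longleftrightarrow>
     real_field K \<and>
     (\<forall>(L :: 'a list ring) h.
        algebraic_extension K L h \<and> real_field L \<longrightarrow> h ` carrier K = carrier L)"

definition field_order :: "('a::field \<Rightarrow> 'a \<Rightarrow> bool) \<Rightarrow> bool" where
  "field_order leq \<longleftrightarrow>
     class.linorder leq (\<lambda>x y. leq x y \<and> \<not> leq y x) \<and>
     (\<forall>x y z. leq x y \<longrightarrow> leq (x + z) (y + z)) \<and>
     (\<forall>x y. leq 0 x \<and> leq 0 y \<longrightarrow> leq 0 (x * y))"

text \<open>Only meaningful for fields with exactly one field order, such as real closed fields.\<close>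

definition the_field_order :: "'a::field \<Rightarrow> 'a \<Rightarrow> bool" where
  "the_field_order = (THE leq. field_order leq)"

text \<open>
  A monomial is an exponent vector \<open>nat \<Rightarrow>\<^sub>0 nat\<close>. The ring \<open>K[X\<^sub>1,\<dots>,X\<^sub>n]\<close> is the
  subring of the polynomials in countably many variables in which only the
  variables with indices \<open>0,\<dots>,n-1\<close> occur.
\<close>

type_synonym 'a mpoly = "(nat \<Rightarrow>\<^sub>0 nat) \<Rightarrow>\<^sub>0 'a"

definition mpolys :: "nat \<Rightarrow> 'a::zero mpoly set" where
  "mpolys n = {p. \<forall>m\<in>Poly_Mapping.keys p. Poly_Mapping.keys m \<subseteq> {..<n}}"

definition mpoly_eval :: "(nat \<Rightarrow> 'a::comm_semiring_1) \<Rightarrow> 'a mpoly \<Rightarrow> 'a" where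
  "mpoly_eval a p =
     (\<Sum>m\<in>Poly_Mapping.keys p.
        Poly_Mapping.lookup p m *
        (\<Prod>i\<in>Poly_Mapping.keys m. a i ^ Poly_Mapping.lookup m i))"

definition rational_function_field :: "nat \<Rightarrow> 'a::field mpoly fract ring" where
  "rational_function_field n =
     ring_of_type_algebra
       \<lparr>carrier := {Fraction_Field.Fract p q | p q. p \<in> mpolys n \<and> q \<in> mpolys n \<and> q \<noteq> 0}\<rparr>"

definition positive_semidefinite :: "nat \<Rightarrow> 'a::field mpoly \<Rightarrow> bool" where
  "positive_semidefinite n f \<longleftrightarrow>
     (\<forall>a \<in> {..<n} \<rightarrow>\<^sub>E UNIV. the_field_order 0 (mpoly_eval a f))"

end

theory Submission
  imports Defs "HOL-Library.Function_Algebras"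
begin

text \<open>
  If \<open>f\<close> is not a sum of squares in \<open>F = K(X\<^sub>1,\<dots>,X\<^sub>n)\<close>, then \<open>F\<close> has an ordering in which \<open>f\<close> is
  negative. A maximal ordered field \<open>R\<close> extending \<open>F\<close> inside an algebraic closure of \<open>F\<close> satisfies
  the intermediate value theorem for polynomials, and so does \<open>K\<close>. For two such fields the
  Cohen--Hoermander method shows that the signs of finitely many polynomials in \<open>n\<close> variables over
  \<open>K\<close> at a point of \<open>R\<^sup>n\<close> are also attained at a point of \<open>K\<^sup>n\<close>. Applied to \<open>f\<close> and the point
  \<open>(X\<^sub>1,\<dots>,X\<^sub>n)\<close>, this yields a point of \<open>K\<^sup>n\<close> at which \<open>f\<close> is negative. No formulas are needed for
  the elimination of a variable: it suffices to find, for finitely many polynomials in one variable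
  over a ring \<open>S\<close>, finitely many elements of \<open>S\<close> whose signs under a homomorphism from \<open>S\<close> to an
  ordered field determine the arrangement of the roots and signs of the images of the polynomials.
\<close>

section \<open>Polynomials over subrings\<close>

text \<open>Several fields must be compared whose types are not at hand in advance, so each field is
  a subset of one ambient field, and polynomials over it are ambient polynomials with coefficients
  in the subset. In the end the ambient field is an algebraic closure containing copies of both
  \<open>K\<close> and \<open>R\<close>, and a single cone orders both. It induces the given order
  on \<open>K\<close> because nonnegative elements of \<open>K\<close> are squares. The obstacle on
  the side of \<open>K\<close> is that being real closed only excludes certain extensions and offers
  no roots. Roots are therefore taken from the algebraic closure: if a polynomial changes sign,
  adjoining a suitable root is compatible with the order, hence adds nothing. In the elimination,
  \<open>S\<close> is the ring of polynomial functions in \<open>k\<close> variables and the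
  homomorphisms are evaluations at a point of \<open>R^k\<close> and a point of \<open>K^k\<close>;
  so the point of \<open>K^n\<close> is built one coordinate at a time. The finitely many elements
  of \<open>S\<close> must be chosen before the points, and leading coefficients may vanish at some
  points. Hence the pseudo-remainders and truncations in place of division with remainder.\<close>

definition subring_set :: "'b::comm_ring_1 set \<Rightarrow> bool" where
  "subring_set S \<longleftrightarrow> 0 \<in> S \<and> 1 \<in> S \<and> (\<forall>x\<in>S. \<forall>y\<in>S. x + y \<in> S \<and> x * y \<in> S) \<and> (\<forall>x\<in>S. - x \<in> S)"

lemma subring_setD:
  assumes "subring_set S"
  shows "0 \<in> S" "1 \<in> S" "x \<in> S \<Longrightarrow> y \<in> S \<Longrightarrow> x + y \<in> S" "x \<in> S \<Longrightarrow> y \<in> S \<Longrightarrow> x * y \<in> S"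
    "x \<in> S \<Longrightarrow> - x \<in> S" "x \<in> S \<Longrightarrow> y \<in> S \<Longrightarrow> x - y \<in> S"
  using assms unfolding subring_set_def by (auto simp: diff_conv_add_uminus simp del: add_uminus_conv_diff)

lemma subring_set_sum: "subring_set S \<Longrightarrow> (\<And>i. i \<in> A \<Longrightarrow> f i \<in> S) \<Longrightarrow> sum f A \<in> S"
  by (induction A rule: infinite_finite_induct) (auto intro: subring_setD)

lemma subring_set_power: "subring_set S \<Longrightarrow> x \<in> S \<Longrightarrow> x ^ n \<in> S"
  by (induction n) (auto intro: subring_setD)

lemma subring_set_of_nat: "subring_set S \<Longrightarrow> of_nat n \<in> S"
  by (induction n) (auto intro: subring_setD)

definition polys_over :: "'b::comm_ring_1 set \<Rightarrow> 'b poly set" where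
  "polys_over S = {p. \<forall>i. coeff p i \<in> S}"

lemma polys_overD: "p \<in> polys_over S \<Longrightarrow> coeff p i \<in> S"
  by (simp add: polys_over_def)

context
  fixes S :: "'b::comm_ring_1 set"
  assumes S: "subring_set S"
begin

lemma polys_over_0: "0 \<in> polys_over S"
  using subring_setD[OF S] by (simp add: polys_over_def)

lemma polys_over_1: "1 \<in> polys_over S"
  using subring_setD[OF S] by (simp add: polys_over_def)

lemma polys_over_pCons_iff: "pCons a p \<in> polys_over S \<longleftrightarrow> a \<in> S \<and> p \<in> polys_over S"
  by (auto simp: polys_over_def coeff_pCons split: nat.splits)

lemma polys_over_add: "p \<in> polys_over S \<Longrightarrow> q \<in> polys_over S \<Longrightarrow> p + q \<in> polys_over S"
  using subring_setD[OF S] by (simp add: polys_over_def)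

lemma polys_over_diff: "p \<in> polys_over S \<Longrightarrow> q \<in> polys_over S \<Longrightarrow> p - q \<in> polys_over S"
  using subring_setD[OF S] by (simp add: polys_over_def)

lemma polys_over_uminus: "p \<in> polys_over S \<Longrightarrow> - p \<in> polys_over S"
  using subring_setD[OF S] by (simp add: polys_over_def)

lemma polys_over_mult: "p \<in> polys_over S \<Longrightarrow> q \<in> polys_over S \<Longrightarrow> p * q \<in> polys_over S"
  using subring_setD[OF S] by (auto simp: polys_over_def coeff_mult intro!: subring_set_sum[OF S])

lemma polys_over_smult: "c \<in> S \<Longrightarrow> p \<in> polys_over S \<Longrightarrow> smult c p \<in> polys_over S"
  using subring_setD[OF S] by (simp add: polys_over_def)

lemma polys_over_monom: "c \<in> S \<Longrightarrow> monom c n \<in> polys_over S"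
  using subring_setD[OF S] by (auto simp: polys_over_def)

lemma polys_over_power: "p \<in> polys_over S \<Longrightarrow> p ^ n \<in> polys_over S"
  by (induction n) (auto intro: polys_over_mult polys_over_1)

lemma polys_over_linear: "a \<in> S \<Longrightarrow> b \<in> S \<Longrightarrow> [:a, b:] \<in> polys_over S"
  by (simp add: polys_over_pCons_iff polys_over_0)

lemma polys_over_const: "a \<in> S \<Longrightarrow> [:a:] \<in> polys_over S"
  by (simp add: polys_over_pCons_iff polys_over_0)

lemma poly_in_subring: "p \<in> polys_over S \<Longrightarrow> x \<in> S \<Longrightarrow> poly p x \<in> S"
  by (induction p) (auto simp: polys_over_pCons_iff intro: subring_setD[OF S])

lemma pcompose_polys_over: "p \<in> polys_over S \<Longrightarrow> q \<in> polys_over S \<Longrightarrow> pcompose p q \<in> polys_over S"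
  by (induction p) (auto simp: polys_over_pCons_iff pcompose_pCons
      intro: polys_over_add polys_over_mult polys_over_0 polys_over_const)

end

lemma pderiv_polys_over:
  fixes S :: "'b::{comm_ring_1, semiring_no_zero_divisors} set"
  assumes "subring_set S" "p \<in> polys_over S"
  shows "pderiv p \<in> polys_over S"
proof -
  have "of_nat (Suc i) * coeff p (Suc i) \<in> S" for i
    by (rule subring_setD(4)[OF assms(1) subring_set_of_nat[OF assms(1)] polys_overD[OF assms(2)]])
  thus ?thesis
    by (simp only: polys_over_def coeff_pderiv mem_Collect_eq) simp
qed

definition subfield_set :: "'b::field set \<Rightarrow> bool" where
  "subfield_set S \<longleftrightarrow> subring_set S \<and> (\<forall>x\<in>S. inverse x \<in> S)"

lemma subfield_setD:
  assumes "subfield_set S"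
  shows "subring_set S" "x \<in> S \<Longrightarrow> inverse x \<in> S" "x \<in> S \<Longrightarrow> y \<in> S \<Longrightarrow> x / y \<in> S"
  using assms subring_setD(4)[of S x "inverse y"]
  unfolding subfield_set_def by (auto simp: divide_inverse)

lemma polys_over_division:
  fixes S :: "'b::field set"
  assumes S: "subfield_set S" and g: "g \<in> polys_over S" "g \<noteq> 0" and p: "p \<in> polys_over S"
  shows "\<exists>q\<in>polys_over S. \<exists>r\<in>polys_over S. p = g * q + r \<and> (r = 0 \<or> degree r < degree g)"
  using p
proof (induction "degree p" arbitrary: p rule: less_induct)
  case less
  note R = subfield_setD(1)[OF S]
  show ?case
  proof (cases "p = 0 \<or> degree p < degree g")
    case True
    then show ?thesis using polys_over_0[OF R] less.prems by force
  next
    case False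
    define m where "m = monom (lead_coeff p / lead_coeff g) (degree p - degree g)"
    define p1 where "p1 = p - g * m"
    have "lead_coeff p / lead_coeff g \<in> S"
      using less.prems g S by (intro subfield_setD polys_overD)
    then have m: "m \<in> polys_over S" unfolding m_def by (rule polys_over_monom[OF R])
    then have p1: "p1 \<in> polys_over S"
      unfolding p1_def using less.prems g R by (intro polys_over_diff polys_over_mult)
    have cz: "lead_coeff p / lead_coeff g \<noteq> 0" using False g by auto
    then have m0: "m \<noteq> 0" "degree m = degree p - degree g"
      unfolding m_def using Polynomial.degree_monom_eq[OF cz] by (simp_all only: Polynomial.monom_eq_0_iff) simp
    have dm: "degree (g * m) = degree p" using False g m0 by (simp add: degree_mult_eq)
    have lc: "coeff (g * m) (degree p) = lead_coeff p"
    proof -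
      have "coeff (g * m) (degree p) = lead_coeff (g * m)" using dm by simp
      also have "\<dots> = lead_coeff g * lead_coeff m" by (rule lead_coeff_mult)
      also have "lead_coeff m = lead_coeff p / lead_coeff g" using m0(2) by (simp add: m_def)
      also have "lead_coeff g * \<dots> = lead_coeff p" using g by simp
      finally show ?thesis .
    qed
    show ?thesis
    proof (cases "p1 = 0")
      case True
      then have "p = g * m + 0" by (simp add: p1_def)
      then show ?thesis using m polys_over_0[OF R] by blast
    next
      case F: False
      have "degree p1 \<le> degree p" unfolding p1_def using dm by (simp add: degree_diff_le)
      moreover have "coeff p1 (degree p) = 0" using lc by (simp add: p1_def)
      ultimately have "degree p1 < degree p" using F
        by (metis le_neq_implies_less leading_coeff_0_iff)
      from less.hyps[OF this p1] obtain q r where qr: "q \<in> polys_over S" "r \<in> polys_over S"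
        "p1 = g * q + r" "r = 0 \<or> degree r < degree g" by blast
      have "p = g * (m + q) + r" using qr(3) by (simp add: p1_def algebra_simps)
      then show ?thesis using qr m polys_over_add[OF R] by blast
    qed
  qed
qed

text \<open>Dividing \<open>g * k\<close> by \<open>g\<close> over \<open>S\<close> leaves a
  remainder that is a multiple of \<open>g\<close> of smaller degree, hence zero; so
  \<open>k\<close> is the quotient found over \<open>S\<close>.\<close>

lemma polys_over_quotient:
  fixes S :: "'b::field set"
  assumes S: "subfield_set S" and g: "g \<in> polys_over S" "g \<noteq> 0" and p: "g * k \<in> polys_over S"
  shows "k \<in> polys_over S"
proof -
  obtain q r where qr: "q \<in> polys_over S" "g * k = g * q + r" "r = 0 \<or> degree r < degree g"
    using polys_over_division[OF S g p] by blast
  have *: "r = g * (k - q)" using qr(2) by (simp add: algebra_simps)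
  have "k = q"
  proof (rule ccontr)
    assume "k \<noteq> q"
    then have "r \<noteq> 0" "degree r \<ge> degree g" using g * by (auto simp: degree_mult_eq)
    then show False using qr(3) by simp
  qed
  then show ?thesis using qr by simp
qed

section \<open>Orderings of subfields\<close>

text \<open>An ordered subfield is encoded by its set \<open>C\<close> of nonnegative elements; the subfield itself is
  recovered as \<open>signed C = C \<union> - C\<close>.\<close>

definition preorder_cone :: "'b::field set \<Rightarrow> 'b set \<Rightarrow> bool" where
  "preorder_cone L T \<longleftrightarrow> T \<subseteq> L \<and> (\<forall>x\<in>L. x * x \<in> T) \<and>
     (\<forall>x\<in>T. \<forall>y\<in>T. x + y \<in> T \<and> x * y \<in> T) \<and> - 1 \<notin> T"

definition signed :: "'b::field set \<Rightarrow> 'b set" where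
  "signed C = {x. x \<in> C \<or> - x \<in> C}"

locale ordered_cone =
  fixes C :: "'b::field set"
  assumes C_add: "x \<in> C \<Longrightarrow> y \<in> C \<Longrightarrow> x + y \<in> C"
    and C_mult: "x \<in> C \<Longrightarrow> y \<in> C \<Longrightarrow> x * y \<in> C"
    and C_1: "1 \<in> C"
    and C_antisym: "x \<in> C \<Longrightarrow> - x \<in> C \<Longrightarrow> x = 0"
    and subfield_signed: "subfield_set (signed C)"

text \<open>The preordering generated by \<open>T\<close> and \<open>- a\<close> is
  \<open>T - a * T\<close>, since \<open>a * a\<close> is in \<open>T\<close>. It could contain
  \<open>- 1\<close> only if \<open>a\<close> were a quotient of elements of \<open>T\<close>, and
  such quotients lie in \<open>T\<close>.\<close>

lemma preorder_cone_insert: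
  assumes L: "subfield_set L" and T: "preorder_cone L T" and a: "a \<in> L" "a \<notin> T"
  shows "\<exists>T'. preorder_cone L T' \<and> T \<subseteq> T' \<and> - a \<in> T'"
proof -
  note R = subring_setD[OF subfield_setD(1)[OF L]]
  have TL: "T \<subseteq> L" and sq: "\<And>x. x \<in> L \<Longrightarrow> x * x \<in> T" and ad: "\<And>x y. x \<in> T \<Longrightarrow> y \<in> T \<Longrightarrow> x + y \<in> T"
    and mu: "\<And>x y. x \<in> T \<Longrightarrow> y \<in> T \<Longrightarrow> x * y \<in> T" and m1: "- 1 \<notin> T"
    using T by (auto simp: preorder_cone_def)
  have T0: "0 \<in> T" and T1: "1 \<in> T" using sq[OF R(1)] sq[OF R(2)] by auto
  define T' where "T' = {s - a * t | s t. s \<in> T \<and> t \<in> T}"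
  have sub: "T \<subseteq> T'" unfolding T'_def using T0 by force
  have "- a \<in> T'" unfolding T'_def using T0 T1 by force
  moreover have "preorder_cone L T'"
    unfolding preorder_cone_def
  proof (intro conjI ballI)
    show "T' \<subseteq> L" unfolding T'_def using TL a(1) R(4,6) by (auto simp: subset_iff)
    show "x * x \<in> T'" if "x \<in> L" for x using sq that sub by auto
  next
    fix x y assume "x \<in> T'" "y \<in> T'"
    then obtain s t s' t' where st: "x = s - a * t" "y = s' - a * t'" "s \<in> T" "t \<in> T" "s' \<in> T" "t' \<in> T"
      unfolding T'_def by blast
    have "x + y = (s + s') - a * (t + t')" unfolding st(1,2) by (simp add: algebra_simps)
    then show "x + y \<in> T'" unfolding T'_def using st ad by blast
    have "x * y = (s * s' + (a * a) * (t * t')) - a * (s * t' + t * s')"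
      unfolding st(1,2) by (simp add: algebra_simps)
    moreover have "s * s' + (a * a) * (t * t') \<in> T" "s * t' + t * s' \<in> T"
      using st ad mu sq a by auto
    ultimately show "x * y \<in> T'" unfolding T'_def by blast
  next
    show "- 1 \<notin> T'"
    proof
      assume "- 1 \<in> T'"
      then obtain s t where st: "- 1 = s - a * t" "s \<in> T" "t \<in> T" unfolding T'_def by blast
      have at: "a * t = 1 + s" using st(1) by (simp add: algebra_simps)
      have "1 + s \<noteq> 0" using m1 st(2) by (metis add_eq_0_iff)
      then have t0: "t \<noteq> 0" using at by auto
      \<comment> \<open>A quotient is a product times the square of an inverse, which keeps it
        inside \<open>T\<close>.\<close>
      have "a = (a * t) * t * (inverse t * inverse t)"
        using t0 by (simp add: field_simps)
      then have "a = (1 + s) * t * (inverse t * inverse t)" by (simp only: at)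
      moreover have "inverse t \<in> L" using st TL subfield_setD(2)[OF L] by auto
      ultimately have "a \<in> T" using sq mu ad T1 st by metis
      then show False using a by simp
    qed
  qed
  ultimately show ?thesis using sub by blast
qed

text \<open>A maximal preordering, given by Zorn's lemma, is total: if it lacked both
  \<open>a\<close> and \<open>- a\<close>, then \<open>- a\<close> could be added.\<close>

lemma preorder_cone_extends_to_ordering:
  assumes L: "subfield_set L" and T: "preorder_cone L T"
  obtains C where "ordered_cone C" "T \<subseteq> C" "signed C = L"
proof -
  define \<A> where "\<A> = {T'. preorder_cone L T' \<and> T \<subseteq> T'}"
  have "\<exists>M\<in>\<A>. \<forall>D\<in>\<A>. M \<subseteq> D \<longrightarrow> D = M"
  proof (rule subset_Zorn_nonempty)
    show "\<A> \<noteq> {}" using T by (auto simp: \<A>_def)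
    fix Ch assume Ch: "Ch \<noteq> {}" "subset.chain \<A> Ch"
    then have p: "\<And>D. D \<in> Ch \<Longrightarrow> preorder_cone L D \<and> T \<subseteq> D" by (auto simp: subset.chain_def \<A>_def)
    have lin: "\<And>D Y. D \<in> Ch \<Longrightarrow> Y \<in> Ch \<Longrightarrow> D \<subseteq> Y \<or> Y \<subseteq> D" using Ch(2)
      by (auto simp: subset.chain_def)
    have two: "\<exists>D\<in>Ch. x \<in> D \<and> y \<in> D" if "x \<in> \<Union>Ch" "y \<in> \<Union>Ch" for x y
      using that lin by blast
    have "preorder_cone L (\<Union>Ch)"
      unfolding preorder_cone_def
    proof (intro conjI ballI)
      show "\<Union>Ch \<subseteq> L" using p unfolding preorder_cone_def by blast
      show "x * x \<in> \<Union>Ch" if "x \<in> L" for x using p that Ch(1) by (auto simp: preorder_cone_def)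
      show "x + y \<in> \<Union>Ch" "x * y \<in> \<Union>Ch" if "x \<in> \<Union>Ch" "y \<in> \<Union>Ch" for x y
        using two[OF that] p unfolding preorder_cone_def by blast+
      show "- 1 \<notin> \<Union>Ch" using p by (auto simp: preorder_cone_def)
    qed
    then show "\<Union>Ch \<in> \<A>" using p Ch(1) by (auto simp: \<A>_def)
  qed
  then obtain M where M: "M \<in> \<A>" and max: "\<And>D. D \<in> \<A> \<Longrightarrow> M \<subseteq> D \<Longrightarrow> D = M" by blast
  have pM: "preorder_cone L M" "T \<subseteq> M" using M by (auto simp: \<A>_def)
  have lin: "a \<in> M \<or> - a \<in> M" if aL: "a \<in> L" for a
  proof (rule ccontr)
    assume *: "\<not> ?thesis"
    then obtain T' where "preorder_cone L T'" "M \<subseteq> T'" "- a \<in> T'"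
      using preorder_cone_insert[OF L pM(1) aL] by blast
    moreover from this have "T' = M" using max pM by (auto simp: \<A>_def)
    ultimately show False using * by simp
  qed
  note R = subring_setD[OF subfield_setD(1)[OF L]]
  have sL: "signed M = L" using lin pM(1) R(5) unfolding signed_def preorder_cone_def
    by (auto) (metis R(5) minus_minus subsetD)
  have "ordered_cone M"
  proof
    show "x + y \<in> M" "x * y \<in> M" if "x \<in> M" "y \<in> M" for x y
      using pM that by (auto simp: preorder_cone_def)
    show "1 \<in> M" using pM(1) R(2) unfolding preorder_cone_def by (metis mult_1)
    show "subfield_set (signed M)" using sL L by simp
    show "x = 0" if "x \<in> M" "- x \<in> M" for x
    proof (rule ccontr)
      assume "x \<noteq> 0"
      \<comment> \<open>Two opposite nonzero elements would multiply, up to a square, to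
        \<open>- 1\<close>.\<close>
      then have "- 1 = (- x) * x * (inverse x * inverse x)" by (simp add: field_simps)
      moreover have "inverse x \<in> L" using that(1) pM subfield_setD(2)[OF L] by (auto simp: preorder_cone_def)
      ultimately have "- 1 \<in> M" using pM(1) that unfolding preorder_cone_def by metis
      then show False using pM by (simp add: preorder_cone_def)
    qed
  qed
  then show ?thesis using that sL pM by blast
qed

text \<open>The subfield \<open>signed D\<close> is not fixed but grows with \<open>D\<close>; so
  \<open>M\<close> is an ordered subfield whose order extends to no larger subfield of the ambient
  field.\<close>

lemma ordered_cone_maximal:
  assumes "ordered_cone C"
  obtains M where "ordered_cone M" "C \<subseteq> M" "\<forall>D. ordered_cone D \<longrightarrow> M \<subseteq> D \<longrightarrow> D = M"
proof -
  define \<A> where "\<A> = {D. ordered_cone D \<and> C \<subseteq> D}"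
  have "\<exists>M\<in>\<A>. \<forall>D\<in>\<A>. M \<subseteq> D \<longrightarrow> D = M"
  proof (rule subset_Zorn_nonempty)
    show "\<A> \<noteq> {}" using assms by (auto simp: \<A>_def)
    fix Ch assume Ch: "Ch \<noteq> {}" "subset.chain \<A> Ch"
    then have p: "\<And>D. D \<in> Ch \<Longrightarrow> ordered_cone D" "\<And>D. D \<in> Ch \<Longrightarrow> C \<subseteq> D"
      by (auto simp: subset.chain_def \<A>_def)
    have lin: "\<And>D Y. D \<in> Ch \<Longrightarrow> Y \<in> Ch \<Longrightarrow> D \<subseteq> Y \<or> Y \<subseteq> D" using Ch(2)
      by (auto simp: subset.chain_def)
    have two: "\<exists>D\<in>Ch. x \<in> D \<and> y \<in> D" if "x \<in> \<Union>Ch" "y \<in> \<Union>Ch" for x y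
      using that lin by blast
    have sg: "signed (\<Union>Ch) = (\<Union>D\<in>Ch. signed D)" by (auto simp: signed_def)
    have two': "\<exists>D\<in>Ch. x \<in> signed D \<and> y \<in> signed D" if "x \<in> signed (\<Union>Ch)" "y \<in> signed (\<Union>Ch)" for x y
    proof -
      obtain D Y where "D \<in> Ch" "Y \<in> Ch" "x \<in> signed D" "y \<in> signed Y" using \<open>x \<in> _\<close> \<open>y \<in> _\<close> sg by auto
      then show ?thesis using lin[of D Y] by (auto simp: signed_def)
    qed
    have sub: "subfield_set (signed D)" if "D \<in> Ch" for D
      using p(1)[OF that] by (simp add: ordered_cone_def)
    have "ordered_cone (\<Union>Ch)"
    proof
      show "x + y \<in> \<Union>Ch" "x * y \<in> \<Union>Ch" if "x \<in> \<Union>Ch" "y \<in> \<Union>Ch" for x y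
        using two[OF that] p ordered_cone.C_add ordered_cone.C_mult by (metis UnionI)+
      show "1 \<in> \<Union>Ch" using Ch(1) p(1) ordered_cone.C_1 by blast
      show "x = 0" if "x \<in> \<Union>Ch" "- x \<in> \<Union>Ch" for x
        using two[OF that] p ordered_cone.C_antisym by metis
      show "subfield_set (signed (\<Union>Ch))"
        unfolding subfield_set_def subring_set_def
      proof (intro conjI ballI)
        obtain D where D: "D \<in> Ch" using Ch(1) by blast
        show "0 \<in> signed (\<Union>Ch)" "1 \<in> signed (\<Union>Ch)"
          using subring_setD(1,2)[OF subfield_setD(1)[OF sub[OF D]]] D sg by auto
        show "x + y \<in> signed (\<Union>Ch)" "x * y \<in> signed (\<Union>Ch)"
          if "x \<in> signed (\<Union>Ch)" "y \<in> signed (\<Union>Ch)" for x y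
          using two'[OF that] subring_setD(3,4)[OF subfield_setD(1)[OF sub]] sg by blast+
        show "- x \<in> signed (\<Union>Ch)" "inverse x \<in> signed (\<Union>Ch)" if "x \<in> signed (\<Union>Ch)" for x
          using that sub unfolding sg subfield_set_def subring_set_def by auto
      qed
    qed
    then show "\<Union>Ch \<in> \<A>" using p Ch(1) by (auto simp: \<A>_def)
  qed
  then obtain M where M: "M \<in> \<A>" and max: "\<And>D. D \<in> \<A> \<Longrightarrow> M \<subseteq> D \<Longrightarrow> D = M" by blast
  show ?thesis
  proof (rule that[of M])
    show "ordered_cone M" "C \<subseteq> M" using M by (auto simp: \<A>_def)
    show "\<forall>D. ordered_cone D \<longrightarrow> M \<subseteq> D \<longrightarrow> D = M"
      using max M by (auto simp: \<A>_def)
  qed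
qed

section \<open>The intermediate value theorem for polynomials\<close>

text \<open>\<open>C\<close> supplies the order, \<open>S\<close> the coefficients, end points and
  root, so that one cone can serve several subfields. The condition \<open>p(a) * p(b) <= 0\<close>
  covers a change of sign in either direction and a root at an end point.\<close>

definition poly_ivt :: "'b::field set \<Rightarrow> 'b set \<Rightarrow> bool" where
  "poly_ivt C S \<longleftrightarrow> (\<forall>p\<in>polys_over S. \<forall>a\<in>S. \<forall>b\<in>S. b - a \<in> C \<longrightarrow> - (poly p a * poly p b) \<in> C \<longrightarrow>
     (\<exists>c\<in>S. c - a \<in> C \<and> b - c \<in> C \<and> poly p c = 0))"

section \<open>Simple algebraic extensions\<close>

lemma minimal_polynomial:
  fixes S :: "'b::field set"
  assumes S: "subfield_set S" and p: "p \<in> polys_over S" "p \<noteq> 0" "poly p x = 0"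
  obtains m where "m \<in> polys_over S" "m \<noteq> 0" "poly m x = 0"
    "\<And>q. q \<in> polys_over S \<Longrightarrow> poly q x = 0 \<Longrightarrow> \<exists>k\<in>polys_over S. q = m * k"
    "\<And>q. q \<in> polys_over S \<Longrightarrow> poly q x = 0 \<Longrightarrow> degree q < degree m \<Longrightarrow> q = 0"
proof -
  define P where "P d \<longleftrightarrow> (\<exists>m\<in>polys_over S. m \<noteq> 0 \<and> poly m x = 0 \<and> degree m = d)" for d
  have "P (degree p)" using p by (auto simp: P_def)
  then have PL: "P (Least P)" by (rule LeastI)
  then obtain m where m: "m \<in> polys_over S" "m \<noteq> 0" "poly m x = 0" "degree m = Least P"
    unfolding P_def by blast
  have small: "q = 0" if "q \<in> polys_over S" "poly q x = 0" "degree q < degree m" for q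
  proof (rule ccontr)
    assume "q \<noteq> 0"
    then have "P (degree q)" using that by (auto simp: P_def)
    then show False using not_less_Least[of "degree q" P] that(3) m(4) by simp
  qed
  show ?thesis
  proof (rule that[OF m(1-3) _ small])
    fix q assume q: "q \<in> polys_over S" "poly q x = 0"
    obtain k r where kr: "k \<in> polys_over S" "r \<in> polys_over S" "q = m * k + r" "r = 0 \<or> degree r < degree m"
      using polys_over_division[OF S m(1,2) q(1)] by blast
    have "poly r x = 0" using kr(3) q(2) m(3) by simp
    then have "r = 0" using small[OF kr(2)] kr(4) by blast
    then show "\<exists>k\<in>polys_over S. q = m * k" using kr by auto
  qed auto
qed

definition adjoin :: "'b::field set \<Rightarrow> 'b \<Rightarrow> 'b set" where
  "adjoin S x = {poly q x | q. q \<in> polys_over S}"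

lemma subset_adjoin: "subring_set S \<Longrightarrow> S \<subseteq> adjoin S x"
  unfolding adjoin_def by (auto intro!: exI[of _ "[:_:]"] polys_over_const)

lemma mem_adjoin: "subring_set S \<Longrightarrow> x \<in> adjoin S x"
  unfolding adjoin_def
  by (auto intro!: exI[of _ "[:0, 1:]"] polys_over_linear subring_setD)

text \<open>Inverses come from the Euclidean algorithm: dividing the minimal polynomial
  \<open>m\<close> by \<open>q\<close> leaves \<open>r\<close> with
  \<open>r(x) = - q(x) * a(x)\<close>, so an inverse of \<open>r(x)\<close> yields one of
  \<open>q(x)\<close>.\<close>

lemma subfield_adjoin:
  fixes S :: "'b::field set"
  assumes S: "subfield_set S" and p: "p \<in> polys_over S" "p \<noteq> 0" "poly p x = 0"
  shows "subfield_set (adjoin S x)"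
proof -
  note R = subfield_setD(1)[OF S]
  obtain m where m: "m \<in> polys_over S" "m \<noteq> 0" "poly m x = 0"
    and small: "\<And>q. q \<in> polys_over S \<Longrightarrow> poly q x = 0 \<Longrightarrow> degree q < degree m \<Longrightarrow> q = 0"
    using minimal_polynomial[OF S p] by metis
  have inv: "\<exists>k\<in>polys_over S. poly q x * poly k x = 1"
    if "q \<in> polys_over S" "poly q x \<noteq> 0" "degree q < degree m" for q
    using that
  proof (induction "degree q" arbitrary: q rule: less_induct)
    case less
    have q0: "q \<noteq> 0" using less.prems by auto
    obtain a r where ar: "a \<in> polys_over S" "r \<in> polys_over S" "m = q * a + r" "r = 0 \<or> degree r < degree q"
      using polys_over_division[OF S less.prems(1) q0 m(1)] by blast
    have rx: "poly r x = - (poly q x * poly a x)"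
      using ar(3) m(3) by (metis add_eq_0_iff poly_add poly_mult)
    show ?case
    proof (cases "degree q = 0")
      case True
      then obtain c where c: "q = [:c:]" by (rule degree_eq_zeroE)
      then have "c \<in> S" "c \<noteq> 0" using less.prems(1) q0 by (auto simp: polys_over_pCons_iff[OF R])
      then have "[:inverse c:] \<in> polys_over S" "poly q x * poly [:inverse c:] x = 1"
        using c S by (auto intro!: polys_over_const[OF R] subfield_setD)
      then show ?thesis by blast
    next
      case False
      have "r \<noteq> 0"
      proof
        \<comment> \<open>Then the cofactor \<open>a\<close> would annihilate \<open>x\<close>
          although its degree is smaller than that of \<open>m\<close>.\<close>
        assume "r = 0"
        then have "m = q * a" using ar(3) by simp
        moreover from this have "poly a x = 0" using rx \<open>r = 0\<close> less.prems(2) by simp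
        ultimately show False using small[OF ar(1)] m(2) False by (auto simp: degree_mult_eq)
      qed
      then have dr: "degree r < degree q" using ar(4) by simp
      then have "poly r x \<noteq> 0" using small[OF ar(2)] \<open>r \<noteq> 0\<close> less.prems(3) by auto
      then obtain k where k: "k \<in> polys_over S" "poly r x * poly k x = 1"
        using less.hyps[OF dr ar(2)] dr less.prems(3) by auto
      then have "poly q x * poly (- (a * k)) x = 1" using rx by (simp add: mult.assoc)
      moreover have "- (a * k) \<in> polys_over S"
        using polys_over_uminus[OF R polys_over_mult[OF R ar(1) k(1)]] .
      ultimately show ?thesis by blast
    qed
  qed
  have inv': "inverse y \<in> adjoin S x" if y: "y \<in> adjoin S x" for y
  proof (cases "y = 0")
    case True
    then show ?thesis using that by simp
  next
    case False
    obtain q where q: "q \<in> polys_over S" "y = poly q x" using y unfolding adjoin_def by blast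
    obtain a r where ar: "r \<in> polys_over S" "q = m * a + r" "r = 0 \<or> degree r < degree m"
      using polys_over_division[OF S m(1,2) q(1)] by blast
    have "poly r x = y" using ar q m by simp
    then obtain k where k: "k \<in> polys_over S" "y * poly k x = 1"
      using inv[OF ar(1)] ar(3) False by auto
    then have "inverse y = poly k x" using inverse_unique by blast
    then show ?thesis using k unfolding adjoin_def by blast
  qed
  show ?thesis
    unfolding subfield_set_def subring_set_def
  proof (intro conjI ballI)
    show "0 \<in> adjoin S x" "1 \<in> adjoin S x" using subset_adjoin[OF R] subring_setD(1,2)[OF R] by auto
    show "y + z \<in> adjoin S x" "y * z \<in> adjoin S x" if "y \<in> adjoin S x" "z \<in> adjoin S x" for y z
      using that polys_over_add[OF R] polys_over_mult[OF R] unfolding adjoin_def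
      by (auto simp flip: poly_add poly_mult)
    show "- y \<in> adjoin S x" if "y \<in> adjoin S x" for y
      using that polys_over_uminus[OF R] unfolding adjoin_def by (auto simp flip: poly_minus)
  qed (rule inv')
qed

section \<open>Positive cones and weighted sums of squares of polynomials\<close>

context ordered_cone
begin

lemma C_subset: "C \<subseteq> signed C"
  by (auto simp: signed_def)

lemma subring_signed: "subring_set (signed C)"
  using subfield_signed by (rule subfield_setD)

lemma C_0: "0 \<in> C"
  using subring_setD(1)[OF subring_signed] by (auto simp: signed_def)

lemma C_square: "x \<in> signed C \<Longrightarrow> x * x \<in> C"
  using C_mult by (force simp: signed_def)

lemma C_inverse: assumes "x \<in> C" shows "inverse x \<in> C"
proof (cases "x = 0")
  case False
  have "inverse x = x * (inverse x * inverse x)" using False by simp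
  moreover have "inverse x \<in> signed C" using assms C_subset subfield_setD(2)[OF subfield_signed] by blast
  ultimately show ?thesis using C_mult[OF assms C_square] by metis
qed (use C_0 in auto)

lemma C_cancel: assumes "x \<in> C" "x \<noteq> 0" "x * y \<in> C" shows "y \<in> C"
proof -
  have "y = inverse x * (x * y)" using assms(2) by simp
  then show ?thesis using C_mult[OF C_inverse[OF assms(1)] assms(3)] by metis
qed

lemma one_plus_C_neq_0: "x \<in> C \<Longrightarrow> 1 + x \<noteq> 0"
  using C_antisym[OF C_1] by (metis add_eq_0_iff one_neq_zero)

text \<open>With all polynomials over the ordered field as \<open>D\<close>, the values at
  \<open>x\<close> form the preordering that \<open>C\<close> generates in the extension by
  \<open>x\<close>. The parameter \<open>D\<close> serves to bound degrees.\<close>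

inductive_set weighted_squares :: "'b poly set \<Rightarrow> 'b poly set" for D where
  zero: "0 \<in> weighted_squares D"
| step: "c \<in> C \<Longrightarrow> q \<in> D \<Longrightarrow> g \<in> weighted_squares D \<Longrightarrow> smult c (q * q) + g \<in> weighted_squares D"

lemma weighted_squares_polys_over:
  "g \<in> weighted_squares D \<Longrightarrow> D \<subseteq> polys_over (signed C) \<Longrightarrow> g \<in> polys_over (signed C)"
  by (induction rule: weighted_squares.induct)
    (use C_subset in \<open>auto intro!: polys_over_0 polys_over_add polys_over_smult polys_over_mult subring_signed\<close>)

lemma weighted_squares_eval:
  "g \<in> weighted_squares D \<Longrightarrow> D \<subseteq> polys_over (signed C) \<Longrightarrow> x \<in> signed C \<Longrightarrow> poly g x \<in> C"
  by (induction rule: weighted_squares.induct)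
    (auto intro!: C_0 C_add C_mult C_square poly_in_subring[OF subring_signed])

lemma weighted_squares_add:
  "g \<in> weighted_squares D \<Longrightarrow> h \<in> weighted_squares D \<Longrightarrow> g + h \<in> weighted_squares D"
  by (induction rule: weighted_squares.induct) (auto simp: add.assoc intro: weighted_squares.intros)

lemma weighted_squares_single: "c \<in> C \<Longrightarrow> q \<in> D \<Longrightarrow> smult c (q * q) \<in> weighted_squares D"
  using weighted_squares.step[OF _ _ weighted_squares.zero] by simp

lemma weighted_squares_mult:
  assumes "g \<in> weighted_squares (polys_over (signed C))" "h \<in> weighted_squares (polys_over (signed C))"
  shows "g * h \<in> weighted_squares (polys_over (signed C))"
proof -
  have *: "smult c (q * q) * h \<in> weighted_squares (polys_over (signed C))"
    if "c \<in> C" "q \<in> polys_over (signed C)" for c q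
    using assms(2)
  proof (induction rule: weighted_squares.induct)
    case zero
    then show ?case using weighted_squares.zero by simp
  next
    case (step c' q' g)
    have "smult c (q * q) * (smult c' (q' * q') + g)
        = smult (c * c') ((q * q') * (q * q')) + smult c (q * q) * g"
      by (simp add: algebra_simps)
    moreover have "smult (c * c') ((q * q') * (q * q')) \<in> weighted_squares (polys_over (signed C))"
      using step that by (intro weighted_squares_single C_mult polys_over_mult[OF subring_signed])
    ultimately show ?case using step.IH weighted_squares_add by simp
  qed
  show ?thesis
    using assms(1)
    by (induction rule: weighted_squares.induct)
      (auto simp: distrib_right intro: weighted_squares.zero weighted_squares_add *[simplified])
qed

text \<open>If \<open>1 + g = m * h\<close> and \<open>d\<close> is the degree of \<open>m\<close>,
  this bound makes the degree of \<open>h\<close> smaller than \<open>d\<close>, so that an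
  induction on the degree applies to \<open>h\<close>.\<close>

lemma weighted_squares_degree:
  "g \<in> weighted_squares {q \<in> polys_over (signed C). degree q < d} \<Longrightarrow> degree g \<le> 2 * (d - 1)"
proof (induction rule: weighted_squares.induct)
  case (step c q g)
  have "degree (smult c (q * q)) \<le> degree q + degree q"
    by (meson degree_mult_le degree_smult_le order_trans)
  also have "\<dots> \<le> 2 * (d - 1)" using step.hyps by auto
  finally show ?case using step.IH by (intro degree_add_le)
qed auto

text \<open>Each \<open>q\<close> is replaced by its remainder modulo \<open>p\<close>; as
  \<open>p\<close> vanishes at \<open>x\<close>, values at \<open>x\<close> do not change.\<close>

lemma weighted_squares_reduce:
  assumes p: "p \<in> polys_over (signed C)" "poly p x = 0" "degree p > 0"
    and "g \<in> weighted_squares (polys_over (signed C))"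
  shows "\<exists>h\<in>weighted_squares {q \<in> polys_over (signed C). degree q < degree p}. poly h x = poly g x"
  using assms(4)
proof (induction rule: weighted_squares.induct)
  case zero
  then show ?case using weighted_squares.zero by blast
next
  case (step c q g)
  then obtain h where h: "h \<in> weighted_squares {q \<in> polys_over (signed C). degree q < degree p}"
    "poly h x = poly g x" by blast
  have "p \<noteq> 0" using p by auto
  then obtain a r where ar: "r \<in> polys_over (signed C)" "q = p * a + r" "r = 0 \<or> degree r < degree p"
    using polys_over_division[OF subfield_signed p(1) _ step.hyps(2)] by blast
  have "poly r x = poly q x" using ar p by simp
  moreover have "degree r < degree p" using ar p by auto
  ultimately show ?case
    using weighted_squares.step[OF step.hyps(1) _ h(1), of r] ar(1) h(2) by (intro bexI) auto
qed

end

text \<open>Let \<open>p\<close> be the minimal polynomial of \<open>x\<close> and let \<open>p\<close> change sign. If the adjunction of \<open>x\<close> had no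
  compatible ordering, we would have \<open>1 + g = p * h\<close> with \<open>g\<close> a weighted sum of squares of
  polynomials of degree less than \<open>degree p\<close>; then \<open>h\<close> has smaller degree than \<open>p\<close> and also changes
  sign, but \<open>1 + g\<close> vanishes at any root of \<open>h\<close>.\<close>

theorem poly_ivt_if_no_ordered_extension:
  fixes C :: "'b::alg_closed_field set"
  assumes "ordered_cone C"
    and ext: "\<And>p x D. p \<in> polys_over (signed C) \<Longrightarrow> p \<noteq> 0 \<Longrightarrow> poly p x = 0 \<Longrightarrow> ordered_cone D \<Longrightarrow>
      C \<subseteq> D \<Longrightarrow> signed D = adjoin (signed C) x \<Longrightarrow> x \<in> signed C"
  shows "poly_ivt C (signed C)"
proof -
  interpret ordered_cone C by fact
  let ?R = "signed C"
  note R = subring_setD[OF subring_signed]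
  have "\<exists>c\<in>?R. c - a \<in> C \<and> b - c \<in> C \<and> poly p c = 0"
    if "p \<in> polys_over ?R" "a \<in> ?R" "b \<in> ?R" "b - a \<in> C" "- (poly p a * poly p b) \<in> C" for p a b
    using that(1,5)
  proof (induction "degree p" arbitrary: p rule: less_induct)
    case less
    note IH = less.hyps and p = less.prems(1) and pab = less.prems(2)
    have ev: "poly q y \<in> ?R" if "q \<in> polys_over ?R" "y \<in> ?R" for q y
      using poly_in_subring[OF subring_signed] that by blast
    show ?case
    proof (cases "poly p a = 0 \<or> poly p b = 0")
      case True
      then show ?thesis using that(2,3,4) C_0 bexI[of _ a] bexI[of _ b] by auto
    next
      case pnz: False
      \<comment> \<open>One factor must change sign along with \<open>p\<close>. If it is
        \<open>k\<close>, the induction hypothesis gives the root, so an argument is asked for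
        \<open>g\<close> alone.\<close>
      have factor: ?thesis
        if g: "g \<in> polys_over ?R" "k \<in> polys_over ?R" "p = g * k" "degree k < degree p"
          and gr: "- (poly g a * poly g b) \<in> C \<Longrightarrow> \<exists>c\<in>?R. c - a \<in> C \<and> b - c \<in> C \<and> poly g c = 0" for g k
      proof (cases "- (poly g a * poly g b) \<in> C")
        case True
        then show ?thesis using gr g(3) by auto
      next
        case False
        have "poly g a * poly g b \<in> ?R" using ev g(1) that(2,3) \<open>a \<in> ?R\<close> \<open>b \<in> ?R\<close> R(4) by blast
        then have "poly g a * poly g b \<in> C" using False by (auto simp: signed_def)
        moreover have "poly g a * poly g b \<noteq> 0" using pnz g(3) by auto
        moreover have "(poly g a * poly g b) * - (poly k a * poly k b) \<in> C"
          using pab by (simp add: g(3) algebra_simps)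
        ultimately have "- (poly k a * poly k b) \<in> C" by (rule C_cancel)
        then show ?thesis using IH[OF g(4,2)] g(3) by auto
      qed
      have dp: "degree p > 0"
      proof (rule ccontr)
        assume "\<not> degree p > 0"
        then obtain c where "p = [:c:]" by (auto elim: degree_eq_zeroE)
        moreover from this have "c \<in> ?R" using p by (simp add: polys_over_pCons_iff[OF subring_signed])
        ultimately have "c * c = 0" using pab C_antisym[OF C_square[of c]] by simp
        then show False using pnz \<open>p = [:c:]\<close> by simp
      qed
      then have p0: "p \<noteq> 0" by auto
      obtain x where x: "poly p x = 0"
        using alg_closed_imp_poly_has_root[OF dp] by blast
      \<comment> \<open>A root in the field need not lie between \<open>a\<close> and
        \<open>b\<close>. If it does not, the linear factor keeps its sign and \<open>factor\<close>
        passes to the cofactor.\<close>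
      have in_R: ?thesis if xR: "x \<in> ?R"
      proof -
        obtain k where k: "p = [:- x, 1:] * k" using x by (metis dvdE poly_eq_0_iff_dvd)
        have l: "[:- x, 1:] \<in> polys_over ?R" using xR R by (intro polys_over_linear subring_signed)
        have kR: "k \<in> polys_over ?R"
          by (rule polys_over_quotient[OF subfield_signed l]) (use p in \<open>simp_all only: k\<close>, simp)
        have "k \<noteq> 0" using k p0 by auto
        then have "degree p = Suc (degree k)" unfolding k by (subst degree_mult_eq) simp_all
        moreover have "\<exists>c\<in>?R. c - a \<in> C \<and> b - c \<in> C \<and> poly [:- x, 1:] c = 0"
          if *: "- (poly [:- x, 1:] a * poly [:- x, 1:] b) \<in> C"
        proof -
          have xab: "(x - a) * (b - x) \<in> C" using * by (simp add: algebra_simps)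
          have nz: "x - a \<noteq> 0" "b - x \<noteq> 0" using pnz x by auto
          have dis: "x - a \<in> C \<or> - (x - a) \<in> C"
            using R(6)[OF xR \<open>a \<in> ?R\<close>] by (simp add: signed_def)
          have "x - a \<in> C \<and> b - x \<in> C"
          proof (cases "x - a \<in> C")
            case True
            then show ?thesis using C_cancel[OF True nz(1) xab] by simp
          next
            case False
            then have 1: "- (x - a) \<in> C" using dis by simp
            have "- (x - a) * - (b - x) \<in> C" using xab by (simp only: minus_mult_minus)
            then have 2: "- (b - x) \<in> C" using C_cancel[OF 1, of "- (b - x)"] nz by simp
            \<comment> \<open>Two negative differences would mean \<open>b <= x <= a\<close>, which
              together with \<open>a <= b\<close> collapses the interval to a point.\<close>
            have "- (b - a) \<in> C" using C_add[OF 1 2] by (simp add: algebra_simps)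
            then have "b - a = 0" using C_antisym[OF \<open>b - a \<in> C\<close>] by simp
            then have "x - a = - (b - x)" by (simp add: algebra_simps)
            then have "x - a \<in> C" using 2 by simp
            then show ?thesis using False by simp
          qed
          then show ?thesis using xR by (intro bexI[of _ x]) auto
        qed
        ultimately show ?thesis using factor[OF l kR k] by simp
      qed
      obtain m where m: "m \<in> polys_over ?R" "m \<noteq> 0" "poly m x = 0"
        and div: "\<And>q. q \<in> polys_over ?R \<Longrightarrow> poly q x = 0 \<Longrightarrow> \<exists>k\<in>polys_over ?R. q = m * k"
        using minimal_polynomial[OF subfield_signed p p0 x] by metis
      obtain k where k: "k \<in> polys_over ?R" "p = m * k" using div[OF p x] by blast
      have dm: "degree m > 0"
        using m by (metis degree_eq_zeroE gr0I mult_zero_right pCons_0_0 poly_const_conv)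
      have k0: "k \<noteq> 0" using k p0 by auto
      have dk: "degree p = degree m + degree k" using k(2) m(2) k0 by (simp add: degree_mult_eq)
      show ?thesis
      proof (cases "degree k = 0")
        case False
        then show ?thesis using factor[OF m(1) k(1,2)] IH[OF _ m(1)] dk dm by simp
      next
        \<comment> \<open>Now \<open>p\<close> is a constant multiple of the minimal polynomial of
          \<open>x\<close>, and the extension by \<open>x\<close> has to be ordered.\<close>
        case True
        then have dpm: "degree m = degree p" using dk by simp
        let ?D = "{q \<in> polys_over ?R. degree q < degree m}"
        define T where "T = {poly g x | g. g \<in> weighted_squares (polys_over ?R)}"
        have L: "subfield_set (adjoin ?R x)" by (rule subfield_adjoin[OF subfield_signed p p0 x])
        have "preorder_cone (adjoin ?R x) T"
          unfolding preorder_cone_def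
        proof (intro conjI ballI)
          show "T \<subseteq> adjoin ?R x" unfolding T_def adjoin_def using weighted_squares_polys_over by blast
        next
          fix y assume "y \<in> adjoin ?R x"
          then obtain q where q: "q \<in> polys_over ?R" "y = poly q x" unfolding adjoin_def by blast
          then show "y * y \<in> T" unfolding T_def using weighted_squares_single[OF C_1 q(1)]
            by (intro CollectI exI[of _ "smult 1 (q * q)"]) auto
        next
          fix y z assume "y \<in> T" "z \<in> T"
          then obtain g h where gh: "g \<in> weighted_squares (polys_over ?R)" "h \<in> weighted_squares (polys_over ?R)"
            "y = poly g x" "z = poly h x" unfolding T_def by blast
          show "y + z \<in> T" unfolding T_def using gh weighted_squares_add by (intro CollectI exI[of _ "g + h"]) auto
          show "y * z \<in> T" unfolding T_def using gh weighted_squares_mult by (intro CollectI exI[of _ "g * h"]) auto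
        next
          show "- 1 \<notin> T"
          proof
            assume "- 1 \<in> T"
            then obtain g0 where g0: "g0 \<in> weighted_squares (polys_over ?R)" "poly g0 x = - 1"
              unfolding T_def by force
            obtain g where g: "g \<in> weighted_squares ?D" "poly g x = - 1"
              using weighted_squares_reduce[OF m(1,3) dm g0(1)] g0(2) by auto
            have gR: "g \<in> polys_over ?R" by (rule weighted_squares_polys_over[OF g(1)]) auto
            have "1 + g \<in> polys_over ?R" "poly (1 + g) x = 0"
              using gR polys_over_1[OF subring_signed] g(2) by (auto intro: polys_over_add[OF subring_signed])
            then obtain h where h: "h \<in> polys_over ?R" "1 + g = m * h" using div by blast
            have pos: "poly g c \<in> C" if "c \<in> ?R" for c by (rule weighted_squares_eval[OF g(1) _ that]) auto
            have pos': "poly m c * poly h c \<in> C" "poly m c * poly h c \<noteq> 0" if "c \<in> ?R" for c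
            proof -
              have "poly m c * poly h c = 1 + poly g c" by (metis h(2) poly_1 poly_add poly_mult)
              then show "poly m c * poly h c \<in> C" "poly m c * poly h c \<noteq> 0"
                using C_add[OF C_1 pos[OF that]] one_plus_C_neq_0[OF pos[OF that]] by auto
            qed
            have "h \<noteq> 0" using pos'(2)[OF \<open>a \<in> ?R\<close>] by auto
            have "degree m + degree h = degree (1 + g)"
              using h(2) m(2) \<open>h \<noteq> 0\<close> by (simp add: degree_mult_eq)
            also have "\<dots> \<le> 2 * (degree m - 1)"
              using weighted_squares_degree[OF g(1)] by (intro degree_add_le) auto
            finally have dh: "degree h < degree p" using dm dpm by linarith
            obtain c where "k = [:c:]" "c \<noteq> 0" using True k0 by (metis degree_eq_zeroE pCons_0_0)
            then have pm: "poly p y = c * poly m y" for y using k(2) by simp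
            \<comment> \<open>As \<open>m * h\<close> is positive on the whole field and
              \<open>p\<close> is a constant times \<open>m\<close>, the product
              \<open>p(a) * p(b) * h(a) * h(b)\<close> is nonnegative: \<open>h\<close> changes sign
              together with \<open>p\<close>.\<close>
            have "(poly m a * poly h a) * (poly m b * poly h b) \<in> C" "c * c \<in> C"
              using pos' that(2,3) C_mult k(1) C_square \<open>k = [:c:]\<close>
              by (auto simp: polys_over_pCons_iff[OF subring_signed])
            then have "(c * c) * ((poly m a * poly h a) * (poly m b * poly h b)) \<in> C" using C_mult by blast
            then have "- (poly p a * poly p b) * - (poly h a * poly h b) \<in> C"
              unfolding pm by (simp add: algebra_simps)
            moreover have "- (poly p a * poly p b) \<noteq> 0" using pnz by simp
            ultimately have "- (poly h a * poly h b) \<in> C" using C_cancel[OF pab] by blast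
            then obtain c where "c \<in> ?R" "poly h c = 0" using IH[OF dh h(1)] by blast
            then show False using pos'(2) by auto
          qed
        qed
        then obtain E where E: "ordered_cone E" "T \<subseteq> E" "signed E = adjoin ?R x"
          using preorder_cone_extends_to_ordering[OF L] by metis
        have "C \<subseteq> T"
        proof
          fix c assume "c \<in> C"
          then have "smult c (1 * 1) \<in> weighted_squares (polys_over ?R)"
            using weighted_squares_single polys_over_1[OF subring_signed] by blast
          then show "c \<in> T" unfolding T_def by (intro CollectI exI[of _ "smult c (1 * 1)"]) auto
        qed
        then have "x \<in> ?R" using ext[OF p p0 x E(1) _ E(3)] E(2) by blast
        then show ?thesis by (rule in_R)
      qed
    qed
  qed
  then show ?thesis unfolding poly_ivt_def by blast
qed

text \<open>The only ordered extension of a maximal cone is the cone itself, so an adjoined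
  \<open>x\<close> was there before.\<close>

corollary poly_ivt_maximal_cone:
  fixes C :: "'b::alg_closed_field set"
  assumes C: "ordered_cone C" and max: "\<forall>D. ordered_cone D \<longrightarrow> C \<subseteq> D \<longrightarrow> D = C"
  shows "poly_ivt C (signed C)"
proof (rule poly_ivt_if_no_ordered_extension[OF C])
  fix p x D
  assume "ordered_cone D" "C \<subseteq> D" "signed D = adjoin (signed C) x"
  moreover from this have "D = C" using max by blast
  ultimately show "x \<in> signed C"
    using mem_adjoin[OF subfield_setD(1)[OF ordered_cone.subfield_signed[OF C]]] by metis
qed

section \<open>The sign function of an ordered subfield\<close>

context ordered_cone
begin

text \<open>Total on the ambient field: a nonzero element outside \<open>signed C\<close> also gets
  \<open>- 1\<close>. This is why the rules for negation and products ask for membership in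
  \<open>signed C\<close>.\<close>

definition sg :: "'b \<Rightarrow> int" where
  "sg x = (if x = 0 then 0 else if x \<in> C then 1 else - 1)"

lemma sg_0 [simp]: "sg 0 = 0" and sg_eq_0_iff [simp]: "sg x = 0 \<longleftrightarrow> x = 0"
  by (auto simp: sg_def)

lemma sg_1 [simp]: "sg 1 = 1"
  using C_1 by (simp add: sg_def)

lemma sg_cases: "sg x = - 1 \<or> sg x = 0 \<or> sg x = 1"
  by (simp add: sg_def)

lemma sg_mult_self: "x \<noteq> 0 \<Longrightarrow> sg x * sg x = 1"
  by (simp add: sg_def)

lemma sg_eq_1_iff: "sg x = 1 \<longleftrightarrow> x \<in> C \<and> x \<noteq> 0"
  by (simp add: sg_def)

lemma sg_uminus: "x \<in> signed C \<Longrightarrow> sg (- x) = - sg x"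
  using C_antisym by (auto simp: sg_def signed_def)

lemma sg_eq_m1_iff: "x \<in> signed C \<Longrightarrow> sg x = - 1 \<longleftrightarrow> - x \<in> C \<and> x \<noteq> 0"
  using C_antisym by (auto simp: sg_def signed_def)

lemma sg_minus_commute: "x \<in> signed C \<Longrightarrow> y \<in> signed C \<Longrightarrow> sg (x - y) = - sg (y - x)"
  using sg_uminus[of "y - x"] subring_setD(6)[OF subring_signed] by simp

lemma sg_mult: assumes "x \<in> signed C" "y \<in> signed C" shows "sg (x * y) = sg x * sg y"
proof -
  have *: "sg (x * y) = sg x * sg y" if "x \<in> C" "y \<in> C" for x y
    using that C_mult by (auto simp: sg_def)
  have m: "x * y \<in> signed C" "- x * y \<in> signed C"
    using assms subring_setD(4,5)[OF subring_signed] by auto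
  have c: "x \<in> C \<or> - x \<in> C" "y \<in> C \<or> - y \<in> C" using assms by (auto simp: signed_def)
  consider "x \<in> C" "y \<in> C" | "- x \<in> C" "y \<in> C" | "x \<in> C" "- y \<in> C" | "- x \<in> C" "- y \<in> C"
    using c by blast
  then show ?thesis
  proof cases
    case 2
    then show ?thesis using *[of "- x" y] sg_uminus[OF m(1)] sg_uminus[OF assms(1)] by simp
  next
    case 3
    then show ?thesis using *[of x "- y"] sg_uminus[OF m(1)] sg_uminus[OF assms(2)] by simp
  next
    case 4
    then show ?thesis using *[of "- x" "- y"] sg_uminus[OF assms(1)] sg_uminus[OF assms(2)] by simp
  qed (rule *)
qed

lemma sg_add:
  assumes "x \<in> signed C" "y \<in> signed C" "sg x = s" "sg y = s \<or> y = 0"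
  shows "sg (x + y) = s"
proof -
  have *: "x + y \<in> C \<and> x + y \<noteq> 0" if "x \<in> C" "y \<in> C" "x \<noteq> 0" for x y
  proof -
    have "x + y \<noteq> 0"
    proof
      assume "x + y = 0"
      then have "- x = y" by (simp add: minus_unique)
      then show False using C_antisym that by simp
    qed
    then show ?thesis using that C_add by blast
  qed
  consider "y = 0" | "s = 0" "sg y = 0" | "s = 1" "sg y = 1" | "s = - 1" "sg y = - 1"
    using assms(3,4) sg_cases[of x] by auto
  then show ?thesis
  proof cases
    case 3
    then show ?thesis using *[of x y] assms(3) sg_eq_1_iff by simp
  next
    case 4
    have "- x + - y \<in> C \<and> - x + - y \<noteq> 0"
      using *[of "- x" "- y"] 4 assms sg_eq_m1_iff by simp
    moreover have "x + y \<in> signed C" using assms subring_setD(3)[OF subring_signed] by blast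
    moreover have "- (x + y) = - x + - y" by simp
    ultimately have "sg (x + y) = - 1" using sg_eq_m1_iff[of "x + y"] by (metis neg_equal_0_iff_equal)
    then show ?thesis using 4 by simp
  qed (use assms in auto)
qed

lemma sg_add':
  assumes "x \<in> signed C" "y \<in> signed C" "sg x = s \<or> x = 0" "sg y = s"
  shows "sg (x + y) = s"
  using sg_add[OF assms(2,1,4,3)] by (simp add: add.commute)

text \<open>Comparisons are written as signs of differences so that one argument, with
  \<open>s = 1\<close> or \<open>s = - 1\<close>, treats both directions of the line. One of the two
  comparisons may be an equality.\<close>

lemma sg_trans:
  assumes "x \<in> signed C" "y \<in> signed C" "z \<in> signed C" "sg (y - x) = s" "sg (z - y) = s \<or> z = y"
  shows "sg (z - x) = s"
  using sg_add[of "y - x" "z - y" s] assms subring_setD(6)[OF subring_signed] by simp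

lemma sg_trans':
  assumes "x \<in> signed C" "y \<in> signed C" "z \<in> signed C" "sg (y - x) = s \<or> y = x" "sg (z - y) = s"
  shows "sg (z - x) = s"
  using sg_add'[of "y - x" "z - y" s] assms subring_setD(6)[OF subring_signed] by simp

lemma sg_of_nat_Suc: "sg (of_nat (Suc n)) = 1"
proof (induction n)
  case (Suc n)
  have "of_nat (Suc n) \<in> signed C" by (rule subring_set_of_nat[OF subring_signed])
  then have "sg (1 + of_nat (Suc n)) = 1"
    using Suc sg_add[of 1 "of_nat (Suc n)" 1] subring_setD(2)[OF subring_signed] by simp
  then show ?case by simp
qed simp

lemma two_neq_0: "(2::'b) \<noteq> 0"
  using sg_of_nat_Suc[of 1] by (metis Suc_1 of_nat_numeral sg_0 zero_neq_one)

lemma of_nat_Suc_neq_0: "of_nat (Suc n) \<noteq> (0 :: 'b)"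
  using sg_of_nat_Suc[of n] by (metis sg_0 zero_neq_one)

lemma sg_midpoint:
  assumes "x \<in> signed C" "y \<in> signed C"
  shows "sg ((x + y) / 2 - x) = sg (y - x)" "sg (y - (x + y) / 2) = sg (y - x)"
proof -
  have t: "2 \<in> C" using C_add[OF C_1 C_1] by simp
  then have i: "inverse 2 \<in> C" by (rule C_inverse)
  have "inverse 2 \<noteq> (0 :: 'b)" using two_neq_0 by simp
  then have "sg (inverse 2) = 1" using i unfolding sg_eq_1_iff by blast
  then have *: "sg (inverse 2 * (y - x)) = sg (y - x)"
    using sg_mult[of "inverse 2" "y - x"] i C_subset assms subring_setD(6)[OF subring_signed] by (simp only: subset_iff mult_1)
  have "(x + y) / 2 - x = inverse 2 * (y - x)" "y - (x + y) / 2 = inverse 2 * (y - x)"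
    using two_neq_0 by (simp_all add: field_simps)
  then show "sg ((x + y) / 2 - x) = sg (y - x)" "sg (y - (x + y) / 2) = sg (y - x)"
    using * by (simp_all only:)
qed

text \<open>A maximum for \<open>s = 1\<close>, a minimum for \<open>s = - 1\<close>.\<close>

lemma finite_extreme:
  assumes "finite F" "F \<noteq> {}" "F \<subseteq> signed C" "s = 1 \<or> s = - 1"
  shows "\<exists>m\<in>F. \<forall>x\<in>F. x = m \<or> sg (m - x) = s"
  using assms(1-3)
proof (induction rule: finite_ne_induct)
  case (insert f F)
  then obtain m where m: "m \<in> F" "\<And>x. x \<in> F \<Longrightarrow> x = m \<or> sg (m - x) = s" by auto
  have R: "f \<in> signed C" "m \<in> signed C" "\<And>x. x \<in> F \<Longrightarrow> x \<in> signed C" using insert.prems m by auto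
  show ?case
  proof (cases "f = m \<or> sg (m - f) = s")
    case True
    then show ?thesis using m by auto
  next
    case False
    then have "sg (f - m) = s"
      using sg_cases[of "m - f"] assms(4) sg_minus_commute[OF R(1,2)] by auto
    then have "x = f \<or> sg (f - x) = s" if "x \<in> insert f F" for x
      using that m(2)[of x] sg_trans'[of x m f s] R by auto
    then show ?thesis by blast
  qed
qed auto

text \<open>Real closedness for the order induced by \<open>C\<close>, in the form in which it is
  used. \<open>S\<close> may be much smaller than \<open>signed C\<close>, like the copy of
  \<open>K\<close> inside \<open>R\<close>.\<close>

definition real_closed_sub :: "'b set \<Rightarrow> bool" where
  "real_closed_sub S \<longleftrightarrow> subfield_set S \<and> S \<subseteq> signed C \<and> poly_ivt C S"

context
  fixes S
  assumes S: "real_closed_sub S"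
begin

lemma real_closed_subD: "subfield_set S" "subring_set S" "x \<in> S \<Longrightarrow> x \<in> signed C"
  using S subfield_setD(1) by (auto simp: real_closed_sub_def)

lemmas Sring = subring_setD[OF real_closed_subD(2)]

lemma poly_in_S: "p \<in> polys_over S \<Longrightarrow> x \<in> S \<Longrightarrow> poly p x \<in> S"
  by (rule poly_in_subring[OF real_closed_subD(2)])

lemma midpoint_in_S: "x \<in> S \<Longrightarrow> y \<in> S \<Longrightarrow> (x + y) / 2 \<in> S"
proof -
  assume *: "x \<in> S" "y \<in> S"
  have "1 + 1 \<in> S" by (intro Sring)
  then show ?thesis using subfield_setD(3)[OF real_closed_subD(1), of "x + y" "1 + 1"] * Sring(3) by simp
qed

lemma sgS:
  "x \<in> S \<Longrightarrow> sg (- x) = - sg x"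
  "x \<in> S \<Longrightarrow> y \<in> S \<Longrightarrow> sg (x - y) = - sg (y - x)"
  "x \<in> S \<Longrightarrow> y \<in> S \<Longrightarrow> sg (x * y) = sg x * sg y"
  by (rule sg_uminus sg_minus_commute sg_mult; erule real_closed_subD(3))+

lemma sg_transS:
  assumes "x \<in> S" "y \<in> S" "z \<in> S"
  shows "sg (y - x) = s \<Longrightarrow> sg (z - y) = s \<or> z = y \<Longrightarrow> sg (z - x) = s"
    "sg (y - x) = s \<or> y = x \<Longrightarrow> sg (z - y) = s \<Longrightarrow> sg (z - x) = s"
  using sg_trans[of x y z s] sg_trans'[of x y z s] assms real_closed_subD(3) by auto

section \<open>Calculus of polynomials from the intermediate value theorem\<close>

lemma ivt_ordered:
  assumes p: "p \<in> polys_over S" and ab: "a \<in> S" "b \<in> S" "sg (b - a) = 1"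
    and "sg (poly p a) * sg (poly p b) = - 1"
  shows "\<exists>c\<in>S. poly p c = 0 \<and> sg (c - a) = 1 \<and> sg (b - c) = 1"
proof -
  have "sg (poly p a * poly p b) = - 1" using assms sgS(3) poly_in_S by simp
  then have "- (poly p a * poly p b) \<in> C"
    using sg_eq_m1_iff real_closed_subD(3)[OF Sring(4)[OF poly_in_S poly_in_S]] p ab by blast
  moreover have "b - a \<in> C" using ab by (simp add: sg_eq_1_iff)
  moreover have "poly_ivt C S" using S by (simp add: real_closed_sub_def)
  ultimately obtain c where c: "c \<in> S" "c - a \<in> C" "b - c \<in> C" "poly p c = 0"
    using p ab unfolding poly_ivt_def by blast
  have "c \<noteq> a" "c \<noteq> b" using c assms(5) by auto
  then show ?thesis using c by (auto simp: sg_eq_1_iff)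
qed

text \<open>The two equations place \<open>c\<close> strictly between \<open>a\<close> and
  \<open>b\<close>, whichever of them is larger.\<close>

lemma ivt:
  assumes p: "p \<in> polys_over S" and ab: "a \<in> S" "b \<in> S"
    and pab: "sg (poly p a) * sg (poly p b) = - 1"
  shows "\<exists>c\<in>S. poly p c = 0 \<and> sg (c - a) = sg (b - a) \<and> sg (b - c) = sg (b - a)"
proof -
  have "a \<noteq> b" using pab sg_cases[of "poly p b"] by auto
  then consider "sg (b - a) = 1" | "sg (a - b) = 1"
    using sg_cases[of "b - a"] sgS(2)[OF ab] by auto
  then show ?thesis
  proof cases
    case 1
    then show ?thesis using ivt_ordered[OF p ab _ pab] by simp
  next
    case 2
    then obtain c where c: "c \<in> S" "poly p c = 0" "sg (c - b) = 1" "sg (a - c) = 1"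
      using ivt_ordered[OF p ab(2,1)] pab by (auto simp: mult.commute)
    then show ?thesis using 2 sgS(2)[OF c(1) ab(1)] sgS(2)[OF ab(2) c(1)] sgS(2)[OF ab(2,1)]
      by (intro bexI[of _ c]) auto
  qed
qed

lemma sg_constant:
  assumes p: "p \<in> polys_over S" and ab: "a \<in> S" "b \<in> S" "poly p a \<noteq> 0" "poly p b \<noteq> 0"
    and nr: "\<And>c. c \<in> S \<Longrightarrow> poly p c = 0 \<Longrightarrow> sg (c - a) = sg (b - a) \<Longrightarrow> sg (b - c) = sg (b - a) \<Longrightarrow> False"
  shows "sg (poly p a) = sg (poly p b)"
proof (rule ccontr)
  assume "\<not> ?thesis"
  then have "sg (poly p a) * sg (poly p b) = - 1"
    using ab sg_cases[of "poly p a"] sg_cases[of "poly p b"] by auto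
  then show False using ivt[OF p ab(1,2)] nr by blast
qed

text \<open>The half-open interval from \<open>w\<close> to \<open>y\<close> is to contain no
  element of \<open>F\<close> that lies in \<open>S\<close>. An offending \<open>f\<close> is passed
  by moving \<open>w\<close> to the midpoint of \<open>f\<close> and \<open>y\<close>, which shrinks
  the interval and so readmits none of the others.\<close>

lemma approach_avoiding:
  assumes F: "finite F" and xy: "x \<in> S" "y \<in> S" "sg (y - x) = s" "s \<noteq> 0"
  shows "\<exists>w\<in>S. sg (w - x) = s \<and> sg (y - w) = s \<and>
    (\<forall>f\<in>F. f \<in> S \<longrightarrow> f = w \<or> sg (f - w) = s \<longrightarrow> sg (y - f) \<noteq> s)"
  using F
proof (induction rule: finite_induct)
  case empty
  then show ?case using sg_midpoint[of x y] midpoint_in_S xy real_closed_subD(3)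
    by (intro bexI[of _ "(x + y) / 2"]) auto
next
  case (insert f F)
  then obtain w where w: "w \<in> S" "sg (w - x) = s" "sg (y - w) = s"
    and wF: "\<And>f. f \<in> F \<Longrightarrow> f \<in> S \<Longrightarrow> f = w \<or> sg (f - w) = s \<Longrightarrow> sg (y - f) \<noteq> s" by blast
  show ?case
  proof (cases "f \<in> S \<and> (f = w \<or> sg (f - w) = s) \<and> sg (y - f) = s")
    case False
    then show ?thesis using w wF by blast
  next
    case True
    define w' where "w' = (f + y) / 2"
    have w': "w' \<in> S" "sg (w' - f) = s" "sg (y - w') = s"
      using sg_midpoint[of f y] midpoint_in_S xy real_closed_subD(3) True by (auto simp: w'_def)
    have w'w: "sg (w' - w) = s" using sg_transS(2)[of w f w' s] w w' True by blast
    then have "sg (w' - x) = s" using sg_transS(1)[of x w w' s] xy w w' by blast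
    moreover have "sg (y - g) \<noteq> s" if g: "g \<in> insert f F" "g \<in> S" "g = w' \<or> sg (g - w') = s" for g
    proof (cases "g = f")
      case True
      have "sg (f - w') = - s" using w' sgS(2)[of f w'] True g by simp
      then have False using g True xy(4) w' by auto
      then show ?thesis by simp
    next
      case False
      have "sg (g - w) = s" using sg_transS(1)[of w w' g s] w w' g w'w by blast
      then show ?thesis using wF[of g] g False by blast
    qed
    ultimately show ?thesis using w' by blast
  qed
qed

text \<open>Takes the place of continuity at \<open>y\<close>: \<open>w\<close> is chosen beyond all
  roots of \<open>v\<close> on the way to \<open>y\<close>.\<close>

lemma approach_keeping_sign:
  assumes v: "v \<in> polys_over S" and xy: "x \<in> S" "y \<in> S" "sg (y - x) = s" "s \<noteq> 0"
    and vy: "poly v y \<noteq> 0"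
  shows "\<exists>w\<in>S. sg (w - x) = s \<and> sg (y - w) = s \<and> sg (poly v w) = sg (poly v y)"
proof -
  have "v \<noteq> 0" using vy by auto
  then have fin: "finite {z. poly v z = 0}" by (rule poly_roots_finite)
  obtain w where w: "w \<in> S" "sg (w - x) = s" "sg (y - w) = s"
    and wF: "\<And>f. poly v f = 0 \<Longrightarrow> f \<in> S \<Longrightarrow> f = w \<or> sg (f - w) = s \<Longrightarrow> sg (y - f) \<noteq> s"
    using approach_avoiding[OF fin xy] by blast
  have "sg (poly v w) = sg (poly v y)"
  proof (rule sg_constant[OF v w(1) xy(2) _ vy])
    show "poly v w \<noteq> 0" using wF[of w] w by blast
    show False if "c \<in> S" "poly v c = 0" "sg (c - w) = sg (y - w)" "sg (y - c) = sg (y - w)" for c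
      using wF[of c] that w by auto
  qed
  then show ?thesis using w by blast
qed

text \<open>Write \<open>p = (X-a)^(i+1) * (X-b)^(j+1) * q\<close>. No root of \<open>q\<close> lies
  in the closed interval, so \<open>q\<close> keeps its sign there, and the cofactor
  \<open>g\<close> of \<open>(X-a)^i * (X-b)^j\<close> in the derivative has opposite signs at
  \<open>a\<close> and \<open>b\<close>.\<close>

lemma rolle_consecutive:
  assumes p: "p \<in> polys_over S" "p \<noteq> 0" and ab: "a \<in> S" "b \<in> S" "a \<noteq> b" "poly p a = 0" "poly p b = 0"
    and nr: "\<And>c. c \<in> S \<Longrightarrow> poly p c = 0 \<Longrightarrow> sg (c - a) = sg (b - a) \<Longrightarrow> sg (b - c) = sg (b - a) \<Longrightarrow> False"
  shows "\<exists>c\<in>S. poly (pderiv p) c = 0 \<and> sg (c - a) = sg (b - a) \<and> sg (b - c) = sg (b - a)"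
proof -
  note sr = real_closed_subD(2)
  obtain q1 where q1: "p = [:- a, 1:] ^ order a p * q1" "\<not> [:- a, 1:] dvd q1"
    using order_decomp[OF p(2)] by blast
  have q1b: "poly q1 b = 0" "q1 \<noteq> 0"
    using p(2) ab(3,5) by (subst (asm) (1 2) q1(1), auto)+
  obtain q where q: "q1 = [:- b, 1:] ^ order b q1 * q" "\<not> [:- b, 1:] dvd q"
    using order_decomp[OF q1b(2)] by blast
  have "order a p \<noteq> 0" "order b q1 \<noteq> 0" using ab q1b p order_root by auto
  then obtain i j where ij: "order a p = Suc i" "order b q1 = Suc j" by (meson not0_implies_Suc)
  have la: "[:- a, 1:] \<in> polys_over S" and lb: "[:- b, 1:] \<in> polys_over S"
    using ab Sring by (auto intro!: polys_over_linear[OF sr])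
  have q1S: "q1 \<in> polys_over S"
    using polys_over_quotient[OF real_closed_subD(1) polys_over_power[OF sr la] _, of "order a p" q1] p(1) q1(1)
    by (metis pCons_eq_0_iff power_not_zero zero_neq_one)
  have qS: "q \<in> polys_over S"
    using polys_over_quotient[OF real_closed_subD(1) polys_over_power[OF sr lb] _, of "order b q1" q] q1S q(1)
    by (metis pCons_eq_0_iff power_not_zero zero_neq_one)
  have qb: "poly q b \<noteq> 0" using q(2) poly_eq_0_iff_dvd by blast
  have "poly q1 a \<noteq> 0" using q1(2) poly_eq_0_iff_dvd by blast
  then have qa: "poly q a \<noteq> 0" by (subst (asm) q(1)) auto
  have pq: "p = [:- a, 1:] ^ Suc i * ([:- b, 1:] ^ Suc j * q)" using q1(1) q(1) ij by simp
  have sq: "sg (poly q a) = sg (poly q b)"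
  proof (rule sg_constant[OF qS ab(1,2) qa qb])
    fix c assume c: "c \<in> S" "poly q c = 0" "sg (c - a) = sg (b - a)" "sg (b - c) = sg (b - a)"
    have "poly p c = 0" using c(2) by (subst pq) simp
    then show False using nr c by blast
  qed
  define g where "g = [:of_nat (Suc i):] * ([:- b, 1:] * q) + [:of_nat (Suc j):] * ([:- a, 1:] * q)
    + [:- a, 1:] * [:- b, 1:] * pderiv q"
  have gS: "g \<in> polys_over S" unfolding g_def
    using la lb qS subring_set_of_nat[OF sr] pderiv_polys_over[OF sr qS]
    by (intro polys_over_add[OF sr] polys_over_mult[OF sr] polys_over_const[OF sr])
  have dl: "pderiv ([:- x, 1:] ^ Suc n) = [:- x, 1:] ^ n * [:of_nat (Suc n):]" for x :: 'b and n
    by (subst pderiv_power_Suc) (simp add: pderiv_pCons)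
  have id: "A * A' * (B * B' * q' + q * (B' * J)) + B * B' * q * (A' * I)
    = A' * (B' * (I * (B * q) + J * (A * q) + A * B * q'))" for A A' B B' I J q q' :: "'b poly"
    by (simp add: algebra_simps)
  have pd: "pderiv p = [:- a, 1:] ^ i * ([:- b, 1:] ^ j * g)"
    unfolding pq pderiv_mult dl unfolding g_def power_Suc by (rule id)
  have bS: "b - a \<in> S" "a - b \<in> S" using Sring(6) ab by auto
  \<comment> \<open>At an end point all summands but one vanish; what is left is a positive integer
    times a value of \<open>q\<close> times \<open>a - b\<close> or \<open>b - a\<close>.\<close>
  have ga: "poly g a = of_nat (Suc i) * ((a - b) * poly q a)" by (simp add: g_def algebra_simps del: of_nat_Suc)
  have gb: "poly g b = of_nat (Suc j) * ((b - a) * poly q b)" by (simp add: g_def algebra_simps del: of_nat_Suc)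
  have "sg (poly g a) = sg (a - b) * sg (poly q a)" unfolding ga
    by (subst sgS(3)) (use bS subring_set_of_nat[OF sr] poly_in_S[OF qS ab(1)] Sring(4) sgS(3) in
      \<open>auto simp only: sg_of_nat_Suc\<close>)
  moreover have "sg (poly g b) = sg (b - a) * sg (poly q b)" unfolding gb
    by (subst sgS(3)) (use bS subring_set_of_nat[OF sr] poly_in_S[OF qS ab(2)] Sring(4) sgS(3) in
      \<open>auto simp only: sg_of_nat_Suc\<close>)
  ultimately have "sg (poly g a) * sg (poly g b) = - 1"
    using sq sgS(2)[OF ab(1,2)] ab(3) qa sg_cases[of "b - a"] sg_cases[of "poly q b"] qb by auto
  then obtain c where c: "c \<in> S" "poly g c = 0" "sg (c - a) = sg (b - a)" "sg (b - c) = sg (b - a)"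
    using ivt[OF gS ab(1,2)] by blast
  then show ?thesis by (intro bexI[of _ c]) (auto simp: pd)
qed

lemma rolle:
  assumes p: "p \<in> polys_over S" "p \<noteq> 0" and ab: "a \<in> S" "b \<in> S" "a \<noteq> b" "poly p a = 0" "poly p b = 0"
  shows "\<exists>c\<in>S. poly (pderiv p) c = 0 \<and> sg (c - a) = sg (b - a) \<and> sg (b - c) = sg (b - a)"
proof -
  define s where "s = sg (b - a)"
  have s: "s = 1 \<or> s = - 1" using ab(3) sg_cases[of "b - a"] by (auto simp: s_def)
  define F where "F = {r \<in> S. poly p r = 0 \<and> sg (r - a) = s \<and> (r = b \<or> sg (b - r) = s)}"
  have "finite F" unfolding F_def by (rule finite_subset[OF _ poly_roots_finite[OF p(2)]]) auto
  moreover have "b \<in> F" using ab by (auto simp: F_def s_def)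
  moreover have "F \<subseteq> signed C" using real_closed_subD(3) by (auto simp: F_def)
  \<comment> \<open>The root of \<open>p\<close> nearest to \<open>a\<close> on the side of
    \<open>b\<close>, so that \<open>a\<close> and \<open>m\<close> are consecutive roots.\<close>
  ultimately obtain m where m: "m \<in> F" "\<And>x. x \<in> F \<Longrightarrow> x = m \<or> sg (m - x) = - s"
    using finite_extreme[of F "- s"] s by auto
  have mS: "m \<in> S" "poly p m = 0" "sg (m - a) = s" "m = b \<or> sg (b - m) = s" using m(1) by (auto simp: F_def)
  have "\<exists>c\<in>S. poly (pderiv p) c = 0 \<and> sg (c - a) = sg (m - a) \<and> sg (m - c) = sg (m - a)"
  proof (rule rolle_consecutive[OF p ab(1) mS(1) _ ab(4) mS(2)])
    show "a \<noteq> m" using mS(3) s by auto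
    fix c assume c: "c \<in> S" "poly p c = 0" "sg (c - a) = sg (m - a)" "sg (m - c) = sg (m - a)"
    then have "sg (b - c) = s" using sg_transS(1)[of c m b s] mS ab by auto
    then have "c \<in> F" using c mS by (auto simp: F_def)
    then show False using m(2)[of c] c mS s by auto
  qed
  then obtain c where c: "c \<in> S" "poly (pderiv p) c = 0" "sg (c - a) = s" "sg (m - c) = s" using mS by auto
  moreover from this have "sg (b - c) = s" using sg_transS(1)[of c m b s] mS ab by auto
  ultimately show ?thesis by (auto simp: s_def)
qed

text \<open>The mean value theorem reduced to signs. The derivative has no root strictly between
  \<open>a\<close> and \<open>b\<close>, so its sign at any point \<open>c\<close> of the closed
  interval where it does not vanish is its sign throughout the interior.\<close>

lemma sg_increment:
  assumes u: "u \<in> polys_over S" and ab: "a \<in> S" "b \<in> S" "a \<noteq> b"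
    and nr: "\<And>r. r \<in> S \<Longrightarrow> sg (r - a) = sg (b - a) \<Longrightarrow> sg (b - r) = sg (b - a) \<Longrightarrow> poly (pderiv u) r \<noteq> 0"
    and c: "c \<in> S" "poly (pderiv u) c \<noteq> 0" "c = a \<or> sg (c - a) = sg (b - a)" "c = b \<or> sg (b - c) = sg (b - a)"
  shows "sg (poly u b - poly u a) = sg (b - a) * sg (poly (pderiv u) c)"
proof -
  note sr = real_closed_subD(2)
  define s where "s = sg (b - a)"
  have s: "s = 1 \<or> s = - 1" using ab(3) sg_cases[of "b - a"] by (auto simp: s_def)
  define k where "k = (poly u b - poly u a) / (b - a)"
  have ba: "b - a \<in> S" "b - a \<noteq> 0" using ab Sring(6) by auto
  have uS: "poly u b - poly u a \<in> S" using u ab poly_in_S Sring(6) by auto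
  have kS: "k \<in> S" unfolding k_def using uS ba subfield_setD(3)[OF real_closed_subD(1)] by blast
  have kba: "k * (b - a) = poly u b - poly u a" using ba by (simp add: k_def)
  \<comment> \<open>Subtracting the secant line, of slope \<open>k\<close>, creates the two zeros
    for Rolle's theorem. If \<open>w = 0\<close>, the derivative of \<open>u\<close> is the constant
    \<open>k\<close>.\<close>
  define w where "w = u - [:poly u a:] - smult k [:- a, 1:]"
  have wS: "w \<in> polys_over S" unfolding w_def using u kS ab Sring poly_in_S
    by (intro polys_over_diff[OF sr] polys_over_const[OF sr] polys_over_smult[OF sr] polys_over_linear[OF sr]) auto
  have w0: "poly w a = 0" "poly w b = 0" using kba by (auto simp: w_def algebra_simps)
  have dw: "pderiv w = pderiv u - [:k:]"
    by (simp add: w_def pderiv_diff pderiv_smult pderiv_pCons)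
  have "\<exists>c0\<in>S. poly (pderiv u) c0 = k \<and> sg (poly (pderiv u) c0) = sg (poly (pderiv u) c)"
  proof (cases "w = 0")
    case True
    then have "pderiv u = [:k:]" using dw by simp
    then show ?thesis using ab by auto
  next
    case False
    obtain c0 where c0: "c0 \<in> S" "poly (pderiv w) c0 = 0" "sg (c0 - a) = s" "sg (b - c0) = s"
      using rolle[OF wS False ab w0] by (auto simp: s_def)
    have "sg (poly (pderiv u) c0) = sg (poly (pderiv u) c)"
    proof (rule sg_constant[OF pderiv_polys_over[OF sr u] c0(1) c(1) _ c(2)])
      show "poly (pderiv u) c0 \<noteq> 0" using nr c0 by (auto simp: s_def)
      fix r assume r: "r \<in> S" "poly (pderiv u) r = 0" "sg (r - c0) = sg (c - c0)" "sg (c - r) = sg (c - c0)"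
      have "c \<noteq> c0" using r c by auto
      then consider "sg (c - c0) = s" | "sg (c - c0) = - s" using s sg_cases[of "c - c0"] by auto
      then have "sg (r - a) = s \<and> sg (b - r) = s"
      proof cases
        case 1
        then show ?thesis
          using sg_transS(1)[of a c0 r s] sg_transS(1)[of r c b s] r c c0 ab by (auto simp: s_def)
      next
        case 2
        have "sg (c0 - r) = s" "sg (r - c) = s" using 2 r sgS(2)[OF c0(1) r(1)] sgS(2)[OF r(1) c(1)] by auto
        then show ?thesis
          using sg_transS(2)[of a c r s] sg_transS(1)[of r c0 b s] r c c0 ab by (auto simp: s_def)
      qed
      then show False using nr r by (auto simp: s_def)
    qed
    then show ?thesis using c0 dw by auto
  qed
  then have "sg k = sg (poly (pderiv u) c)" by auto
  moreover have "sg (poly u b - poly u a) = sg k * sg (b - a)"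
    using sgS(3)[OF kS ba(1)] kba by simp
  ultimately show ?thesis by simp
qed

text \<open>A bound \<open>d > 0\<close> rather than mere positivity is carried through the
  induction on the coefficients, because the growth of \<open>t * d\<close> has to absorb a negative
  constant term.\<close>

lemma eventually_ge_positive:
  assumes "u \<in> polys_over S" "u \<noteq> 0" "lead_coeff u \<in> C"
  shows "\<exists>M\<in>S \<inter> C. \<exists>d\<in>S \<inter> C. d \<noteq> 0 \<and> (\<forall>t\<in>S. t - M \<in> C \<longrightarrow> poly u t - d \<in> C)"
  using assms
proof (induction u)
  case (pCons a q)
  note sr = real_closed_subD(2)
  have aS: "a \<in> S" and qS: "q \<in> polys_over S" using pCons.prems polys_over_pCons_iff[OF sr] by auto
  show ?case
  proof (cases "q = 0")
    case True
    then show ?thesis using pCons.prems aS Sring(1) C_0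
      by (intro bexI[of _ 0] bexI[of _ a]) auto
  next
    case False
    then obtain M d where M: "M \<in> S" "M \<in> C" and d: "d \<in> S" "d \<in> C" "d \<noteq> 0"
      and Md: "\<And>t. t \<in> S \<Longrightarrow> t - M \<in> C \<Longrightarrow> poly q t - d \<in> C"
      using pCons.IH qS pCons.prems by auto
    \<comment> \<open>The least \<open>e >= 0\<close> with \<open>e * d + a >= 0\<close>.\<close>
    define e where "e = (if a \<in> C then 0 else - a / d)"
    have ad: "- a / d \<in> S" using aS d Sring subfield_setD(3)[OF real_closed_subD(1)] by auto
    have "a \<in> C \<or> - a \<in> C" using real_closed_subD(3)[OF aS] by (simp add: signed_def)
    then have e: "e \<in> S" "e \<in> C"
      using ad C_mult[OF _ C_inverse[OF d(2)], of "- a"] C_0 Sring(1)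
      by (auto simp: e_def divide_inverse)
    have "e * d + a = (if a \<in> C then a else 0)" using d(3) by (simp add: e_def)
    then have e3: "e * d + a \<in> C" using C_0 by simp
    \<comment> \<open>The summand \<open>M\<close> makes the bound for \<open>q\<close> applicable,
      \<open>e\<close> absorbs the constant term \<open>a\<close>, and \<open>1\<close> leaves one
      \<open>d\<close> over.\<close>
    define N where "N = M + 1 + e"
    have N: "N \<in> S" "N \<in> C" using M e Sring C_add C_1 by (auto simp: N_def)
    have "poly (pCons a q) t - d \<in> C" if t: "t \<in> S" "t - N \<in> C" for t
    proof -
      have tC: "t \<in> C" using C_add[OF t(2) N(2)] by simp
      have "t - M \<in> C" using C_add[OF t(2) C_add[OF C_1 e(2)]] by (simp add: N_def algebra_simps)
      then have 1: "t * (poly q t - d) \<in> C" using C_mult[OF tC Md[OF t(1)]] by simp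
      have "(t - N + M) * d \<in> C" using C_mult[OF C_add[OF t(2) M(2)] d(2)] .
      then have "t * (poly q t - d) + ((t - N + M) * d + (e * d + a)) \<in> C"
        using C_add 1 e3 by blast
      moreover have "t * (poly q t - d) + ((t - N + M) * d + (e * d + a)) = poly (pCons a q) t - d"
        by (simp add: N_def algebra_simps)
      ultimately show ?thesis by simp
    qed
    then show ?thesis using N d by blast
  qed
qed auto

lemma sg_at_infinity_right:
  assumes u: "u \<in> polys_over S" "u \<noteq> 0" and t: "t \<in> S"
  shows "\<exists>a\<in>S. sg (a - t) = 1 \<and> sg (poly u a) = sg (lead_coeff u)"
proof -
  note sr = real_closed_subD(2)
  have *: "\<exists>a\<in>S. sg (a - t) = 1 \<and> sg (poly v a) = 1"
    if v: "v \<in> polys_over S" "v \<noteq> 0" "lead_coeff v \<in> C" for v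
  proof -
    obtain M d where M: "M \<in> S" "M \<in> C" and d: "d \<in> S" "d \<in> C" "d \<noteq> 0"
      and Md: "\<And>t. t \<in> S \<Longrightarrow> t - M \<in> C \<Longrightarrow> poly v t - d \<in> C"
      using eventually_ge_positive[OF v] by auto
    define e where "e = (if t \<in> C then t else 0)"
    have "t \<in> C \<or> - t \<in> C" using real_closed_subD(3)[OF t] by (simp add: signed_def)
    then have e: "e \<in> S" "e \<in> C" "e - t \<in> C" using t C_0 Sring by (auto simp: e_def)
    \<comment> \<open>Beyond both \<open>M\<close> and \<open>t\<close>, since \<open>M\<close> is
      nonnegative and \<open>e\<close> is the maximum of \<open>t\<close> and
      \<open>0\<close>.\<close>
    define a where "a = M + 1 + e"
    have aS: "a \<in> S" using M e Sring by (auto simp: a_def)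
    have "a - M \<in> C" using C_add[OF C_1 e(2)] by (simp add: a_def)
    then have pd: "poly v a - d \<in> C" using Md aS by blast
    have "sg (d + (poly v a - d)) = 1"
      by (rule sg_add) (use pd d C_subset in \<open>auto simp: sg_eq_1_iff\<close>)
    moreover have "sg (1 + (M + (e - t))) = 1"
      using C_add[OF M(2) e(3)] C_subset C_1 by (intro sg_add) (auto simp: sg_eq_1_iff)
    moreover have "1 + (M + (e - t)) = a - t" by (simp add: a_def)
    ultimately show ?thesis using aS by auto
  qed
  have "lead_coeff u \<in> S" using u polys_overD by blast
  then consider "lead_coeff u \<in> C" | "- lead_coeff u \<in> C" "lead_coeff u \<notin> C"
    using real_closed_subD(3) by (auto simp: signed_def)
  then show ?thesis
  proof cases
    case 1
    then show ?thesis using *[OF u] u by (auto simp: sg_eq_1_iff sg_def)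
  next
    case 2
    then obtain a where a: "a \<in> S" "sg (a - t) = 1" "sg (poly (- u) a) = 1"
      using *[of "- u"] u polys_over_uminus[OF sr] by auto
    moreover have "sg (poly (- u) a) = - sg (poly u a)" using sgS(1) poly_in_S u(1) a(1) by simp
    moreover have "sg (lead_coeff u) = - 1" using 2 u by (simp add: sg_def)
    ultimately show ?thesis by auto
  qed
qed

text \<open>The left end is reduced to the right end by substituting \<open>- X\<close>, whence the
  factor \<open>s ^ degree u\<close>.\<close>

lemma sg_at_infinity:
  assumes u: "u \<in> polys_over S" "u \<noteq> 0" and t: "t \<in> S" and s: "s = 1 \<or> s = - 1"
  shows "\<exists>a\<in>S. sg (a - t) = s \<and> sg (poly u a) = sg (lead_coeff u) * s ^ degree u"
proof (cases "s = 1")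
  case True
  then show ?thesis using sg_at_infinity_right[OF u t] by simp
next
  case False
  then have s: "s = - 1" using s by simp
  note sr = real_closed_subD(2)
  define v where "v = pcompose u [:0, - 1:]"
  have "[:0, - 1:] \<in> polys_over S" using Sring by (intro polys_over_linear[OF sr]) auto
  then have v: "v \<in> polys_over S" unfolding v_def by (rule pcompose_polys_over[OF sr u(1)])
  have lv: "lead_coeff v = lead_coeff u * (- 1) ^ degree u"
    unfolding v_def by (subst lead_coeff_comp) auto
  then have "v \<noteq> 0" using u by auto
  then obtain a where a: "a \<in> S" "sg (a - (- t)) = 1" "sg (poly v a) = sg (lead_coeff v)"
    using sg_at_infinity_right[OF v, of "- t"] t Sring by auto
  have "sg ((- 1) ^ n) = (- 1) ^ n" for n
  proof (induction n)
    case (Suc n)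
    have "(- 1) ^ n \<in> S" using Sring(2,5) subring_set_power[OF sr] by blast
    then show ?case using Suc sgS(1) by simp
  qed simp
  then have "sg (lead_coeff v) = sg (lead_coeff u) * (- 1) ^ degree u"
    unfolding lv by (subst sgS(3)) (use u polys_overD subring_set_power[OF sr] Sring(2,5) in auto)
  moreover have "sg (- a - t) = - 1"
    using sgS(1)[of "a + t"] a t Sring(3) by simp
  moreover have "poly v a = poly u (- a)" by (simp add: v_def poly_pcompose)
  ultimately show ?thesis using a s Sring(5) by (intro bexI[of _ "- a"]) auto
qed

end

end

section \<open>Sign diagrams over two real closed fields\<close>

text \<open>A zero polynomial would turn every point into a cell boundary, so it contributes nothing
  here.\<close>

definition zeros :: "'b::field poly set \<Rightarrow> 'b set" where
  "zeros U = {t. \<exists>u\<in>U. u \<noteq> 0 \<and> poly u t = 0}"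

lemma finite_zeros: "finite U \<Longrightarrow> finite (zeros U)"
proof -
  assume "finite U"
  then have "finite (\<Union>u\<in>U - {0}. {t. poly u t = 0})" by (auto intro: poly_roots_finite)
  moreover have "zeros U = (\<Union>u\<in>U - {0}. {t. poly u t = 0})" by (auto simp: zeros_def)
  ultimately show ?thesis by simp
qed

lemma zeros_mono: "U \<subseteq> U' \<Longrightarrow> zeros U \<subseteq> zeros U'"
  by (auto simp: zeros_def)

context ordered_cone
begin

text \<open>Equal degrees and signs of leading coefficients make \<open>u\<close> and
  \<open>v\<close> agree in sign near both ends of their lines.\<close>

definition similar :: "'b set \<Rightarrow> 'b set \<Rightarrow> ('b poly \<times> 'b poly) set \<Rightarrow> bool" where
  "similar S1 S2 W \<longleftrightarrow> (\<forall>(u, v)\<in>W. u \<in> polys_over S1 \<and> v \<in> polys_over S2 \<and>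
     degree u = degree v \<and> sg (lead_coeff u) = sg (lead_coeff v))"

text \<open>\<open>T t s\<close> should be read as: \<open>t\<close> and \<open>s\<close> lie in corresponding cells of the decompositions of
  the two lines into the roots of the given polynomials and the intervals between them.\<close>

definition matching :: "'b set \<Rightarrow> 'b set \<Rightarrow> ('b poly \<times> 'b poly) set \<Rightarrow> ('b \<Rightarrow> 'b \<Rightarrow> bool) \<Rightarrow> bool" where
  "matching S1 S2 W T \<longleftrightarrow>
     (\<forall>t\<in>S1. \<exists>s\<in>S2. T t s) \<and> (\<forall>s\<in>S2. \<exists>t\<in>S1. T t s) \<and>
     (\<forall>t s. T t s \<longrightarrow> t \<in> S1 \<and> s \<in> S2 \<and> (\<forall>(u, v)\<in>W. sg (poly u t) = sg (poly v s))) \<and>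
     (\<forall>t s t' s'. T t s \<longrightarrow> T t' s' \<longrightarrow> t \<in> zeros (fst ` W) \<longrightarrow> sg (t' - t) = sg (s' - s))"

text \<open>Depends on \<open>T\<close> only through the matched roots and is coarser than a
  matching \<open>T\<close>. When a polynomial is added, points are matched anew: by this relation
  and by the sign of the new polynomial.\<close>

definition same_cell :: "'b set \<Rightarrow> 'b set \<Rightarrow> ('b poly \<times> 'b poly) set \<Rightarrow> ('b \<Rightarrow> 'b \<Rightarrow> bool) \<Rightarrow> 'b \<Rightarrow> 'b \<Rightarrow> bool" where
  "same_cell S1 S2 W T t s \<longleftrightarrow> t \<in> S1 \<and> s \<in> S2 \<and>
     (\<forall>t0 s0. T t0 s0 \<longrightarrow> t0 \<in> zeros (fst ` W) \<longrightarrow> sg (t - t0) = sg (s - s0))"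

lemma matching_mono:
  assumes "matching S1 S2 W T" "V \<subseteq> W"
  shows "matching S1 S2 V T"
  using assms zeros_mono[OF image_mono[OF assms(2), of fst]] unfolding matching_def by blast

lemma similar_mono: "similar S1 S2 W \<Longrightarrow> V \<subseteq> W \<Longrightarrow> similar S1 S2 V"
  unfolding similar_def by blast

lemma similar_converse: "similar S1 S2 W \<Longrightarrow> similar S2 S1 (W\<inverse>)"
  unfolding similar_def by fastforce

lemma similarD:
  assumes "similar S1 S2 W" "(u, v) \<in> W"
  shows "u \<in> polys_over S1" "v \<in> polys_over S2" "degree u = degree v"
    "sg (lead_coeff u) = sg (lead_coeff v)" "u = 0 \<longleftrightarrow> v = 0"
proof -
  show "u \<in> polys_over S1" "v \<in> polys_over S2" "degree u = degree v"
    and sl: "sg (lead_coeff u) = sg (lead_coeff v)"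
    using assms unfolding similar_def by auto
  show "u = 0 \<longleftrightarrow> v = 0"
    using sl by (metis leading_coeff_0_iff sg_eq_0_iff)
qed

lemma matchingD:
  assumes "matching S1 S2 W T"
  shows "t \<in> S1 \<Longrightarrow> \<exists>s\<in>S2. T t s" "s \<in> S2 \<Longrightarrow> \<exists>t\<in>S1. T t s"
    "T t s \<Longrightarrow> t \<in> S1" "T t s \<Longrightarrow> s \<in> S2"
    "T t s \<Longrightarrow> (u, v) \<in> W \<Longrightarrow> sg (poly u t) = sg (poly v s)"
    "T t s \<Longrightarrow> T t' s' \<Longrightarrow> t \<in> zeros (fst ` W) \<Longrightarrow> sg (t' - t) = sg (s' - s)"
  using assms unfolding matching_def by blast+

lemma matching_zeros:
  assumes "similar S1 S2 W" "matching S1 S2 W T" "T t s"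
  shows "t \<in> zeros (fst ` W) \<longleftrightarrow> s \<in> zeros (snd ` W)"
proof -
  have "(u \<noteq> 0 \<and> poly u t = 0) = (v \<noteq> 0 \<and> poly v s = 0)" if "(u, v) \<in> W" for u v
    using similarD(5)[OF assms(1) that] matchingD(5)[OF assms(2,3) that] by (metis sg_eq_0_iff)
  then have "(\<exists>w\<in>W. fst w \<noteq> 0 \<and> poly (fst w) t = 0) = (\<exists>w\<in>W. snd w \<noteq> 0 \<and> poly (snd w) s = 0)"
    by (metis prod.collapse)
  then show ?thesis by (simp add: zeros_def)
qed

text \<open>Exchanging the two lines reduces right-totality of a new matching to
  left-totality.\<close>

lemma matching_converse:
  assumes "similar S1 S2 W" "matching S1 S2 W T"
  shows "matching S2 S1 (W\<inverse>) (\<lambda>s t. T t s)"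
proof -
  have W: "fst ` (W\<inverse>) = snd ` W" by force
  show ?thesis
    unfolding matching_def W
  proof (intro conjI allI impI ballI)
    show "\<exists>t\<in>S1. T t s" if "s \<in> S2" for s using matchingD(2)[OF assms(2) that] .
    show "\<exists>s\<in>S2. T t s" if "t \<in> S1" for t using matchingD(1)[OF assms(2) that] .
    show "s \<in> S2" "t \<in> S1" if "T t s" for s t using matchingD(3,4)[OF assms(2) that] by auto
    show "case w of (v, u) \<Rightarrow> sg (poly v s) = sg (poly u t)" if "T t s" "w \<in> W\<inverse>" for s t w
      using matchingD(5)[OF assms(2) that(1)] that(2) by fastforce
    show "sg (s' - s) = sg (t' - t)" if "T t s" "T t' s'" "s \<in> zeros (snd ` W)" for s t s' t'
      using matchingD(6)[OF assms(2) that(1,2)] matching_zeros[OF assms that(1)] that(3) by simp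
  qed
qed

lemma same_cell_converse:
  assumes "similar S1 S2 W" "matching S1 S2 W T"
  shows "same_cell S2 S1 (W\<inverse>) (\<lambda>s t. T t s) s t \<longleftrightarrow> same_cell S1 S2 W T t s"
proof -
  have "fst ` (W\<inverse>) = snd ` W" by force
  then show ?thesis
    using matching_zeros[OF assms] unfolding same_cell_def by metis
qed

section \<open>Points in corresponding cells\<close>

context
  fixes S1 S2 W T
  assumes rc: "real_closed_sub S1" "real_closed_sub S2"
    and sim: "similar S1 S2 W" and mat: "matching S1 S2 W T" and finW: "finite W"
begin

lemma partner_of_zero:
  assumes "(u, v) \<in> W" "v \<noteq> 0" "c \<in> S2" "poly v c = 0"
  obtains r where "T r c" "r \<in> zeros (fst ` W)" "r \<in> S1"
proof -
  obtain r where r: "r \<in> S1" "T r c" using matchingD(2)[OF mat assms(3)] by blast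
  have "c \<in> zeros (snd ` W)" using assms by (force simp: zeros_def)
  then show ?thesis using that r matching_zeros[OF sim mat r(2)] by blast
qed

text \<open>A root is a cell of its own: comparison with its own pair \<open>T t s0\<close> gives
  \<open>sg (s - s0) = 0\<close>.\<close>

lemma same_cell_zero:
  assumes "same_cell S1 S2 W T t s" "t \<in> zeros (fst ` W)"
  shows "T t s"
proof -
  obtain s0 where s0: "s0 \<in> S2" "T t s0" using assms matchingD(1)[OF mat] unfolding same_cell_def by blast
  then have "sg (t - t) = sg (s - s0)" using assms unfolding same_cell_def by blast
  then show ?thesis using s0 by simp
qed

lemma matching_same_cell: "T t s \<Longrightarrow> same_cell S1 S2 W T t s"
  using matchingD(3,4,6)[OF mat] unfolding same_cell_def by blast

text \<open>Let \<open>s0\<close> be a partner of \<open>t\<close>, so that the signs agree at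
  \<open>t\<close> and \<open>s0\<close>. Each root of \<open>v\<close> is matched with a root
  \<open>r\<close>, and \<open>s\<close> and \<open>s0\<close> both lie on the side of it on which
  \<open>t\<close> lies of \<open>r\<close>. So no root of \<open>v\<close> separates
  \<open>s\<close> from \<open>s0\<close>.\<close>

lemma same_cell_sg:
  assumes cell: "same_cell S1 S2 W T t s" and w: "(u, v) \<in> W"
  shows "sg (poly u t) = sg (poly v s)"
proof (cases "t \<in> zeros (fst ` W) \<or> u = 0")
  case True
  then show ?thesis
    using same_cell_zero[OF cell] matchingD(5)[OF mat _ w] similarD(5)[OF sim w] by auto
next
  case False
  have tS: "t \<in> S1" and sS: "s \<in> S2" using cell by (auto simp: same_cell_def)
  obtain s0 where s0: "s0 \<in> S2" "T t s0" using matchingD(1)[OF mat tS] by blast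
  have v0: "v \<noteq> 0" using similarD(5)[OF sim w] False by simp
  have ut: "sg (poly u t) = sg (poly v s0)" using matchingD(5)[OF mat s0(2) w] .
  have "u \<in> fst ` W" using w by force
  then have "poly u t \<noteq> 0" using False by (auto simp: zeros_def)
  then have vs0: "poly v s0 \<noteq> 0" using ut by (metis sg_eq_0_iff)
  have pos: "sg (s - c) = sg (s0 - c) \<and> s \<noteq> c" if c: "c \<in> S2" "poly v c = 0" for c
  proof -
    obtain r where r: "T r c" "r \<in> zeros (fst ` W)" using partner_of_zero[OF w v0 c] by blast
    then have "sg (t - r) = sg (s - c)" "sg (t - r) = sg (s0 - c)"
      using cell matching_same_cell[OF s0(2)] unfolding same_cell_def by blast+
    moreover have "t \<noteq> r" using r False by auto
    ultimately show ?thesis by (metis sg_0 sg_eq_0_iff right_minus_eq)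
  qed
  have "sg (poly v s0) = sg (poly v s)"
  proof (rule sg_constant[OF rc(2) similarD(2)[OF sim w] s0(1) sS vs0])
    show "poly v s \<noteq> 0" using pos[OF sS] by auto
    fix c assume c: "c \<in> S2" "poly v c = 0" "sg (c - s0) = sg (s - s0)" "sg (s - c) = sg (s - s0)"
    have "sg (s0 - c) = - sg (c - s0)" using sgS(2)[OF rc(2) s0(1) c(1)] .
    then have "sg (s - c) = 0" using pos[OF c(1,2)] c(3,4) by simp
    then show False using pos[OF c(1,2)] by simp
  qed
  then show ?thesis using ut by simp
qed

section \<open>Adding a polynomial whose derivative is already matched\<close>

context
  fixes u v
  assumes simuv: "similar S1 S2 {(u, v)}" and du: "(pderiv u, pderiv v) \<in> W" and deg: "degree u > 0"
    and agree: "\<And>t s. T t s \<Longrightarrow> t \<in> zeros (fst ` W) \<Longrightarrow> sg (poly u t) = sg (poly v s)"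
begin

lemma uv: "u \<in> polys_over S1" "v \<in> polys_over S2" "u \<noteq> 0" "v \<noteq> 0" "degree u = degree v"
    "sg (lead_coeff u) = sg (lead_coeff v)"
  using similarD[OF simuv] deg by auto

lemma pderiv_neq_0: "pderiv u \<noteq> 0" "pderiv v \<noteq> 0"
proof -
  obtain n where n: "degree u = Suc n" using deg by (metis Suc_pred)
  have "coeff (pderiv u) n = of_nat (Suc n) * lead_coeff u" by (simp add: coeff_pderiv n)
  also have "\<dots> \<noteq> 0" using of_nat_Suc_neq_0 uv(3) by (simp del: of_nat_Suc)
  finally show "pderiv u \<noteq> 0" by auto
  then show "pderiv v \<noteq> 0" using similarD(5)[OF sim du] by simp
qed

lemma pderiv_zero: "poly (pderiv u) r = 0 \<Longrightarrow> r \<in> zeros (fst ` W)"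
  using du pderiv_neq_0 by (force simp: zeros_def)

text \<open>\<open>a\<close> and \<open>a'\<close> stand for the ends, in direction
  \<open>d\<close>, of the cells of \<open>t\<close> and \<open>s\<close>. They are the nearest root
  and its partner, where \<open>agree\<close> compares the signs, or, if no root lies in that
  direction, points far out, where degree and leading coefficient decide.\<close>

lemma probe:
  assumes t: "t \<notin> zeros (fst ` W)" and ts: "T t s" and d: "d = 1 \<or> d = - 1"
  shows "\<exists>a\<in>S1. \<exists>a'\<in>S2. sg (a - t) = d \<and> sg (a' - s) = d \<and> sg (poly u a) = sg (poly v a') \<and>
     (\<forall>r\<in>S1. r \<in> zeros (fst ` W) \<longrightarrow> sg (r - t) = d \<longrightarrow> sg (a - r) \<noteq> d) \<and>
     (\<forall>r r'. T r r' \<longrightarrow> r \<in> zeros (fst ` W) \<longrightarrow> sg (r' - s) = d \<longrightarrow> sg (a' - r') \<noteq> d)"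
proof -
  have tS: "t \<in> S1" and sS: "s \<in> S2" using matchingD(3,4)[OF mat ts] by auto
  have flip: "sg (r - t) = sg (r' - s)" if "T r r'" "r \<in> zeros (fst ` W)" for r r'
  proof -
    have "sg (t - r) = sg (s - r')" using matchingD(6)[OF mat that(1) ts that(2)] .
    then show ?thesis
      using sgS(2)[OF rc(1) matchingD(3)[OF mat that(1)] tS]
        sgS(2)[OF rc(2) matchingD(4)[OF mat that(1)] sS] by simp
  qed
  define F where "F = {r \<in> S1. r \<in> zeros (fst ` W) \<and> sg (r - t) = d}"
  have fin: "finite F" unfolding F_def
    by (rule finite_subset[OF _ finite_zeros[OF finite_imageI[OF finW]]]) auto
  show ?thesis
  proof (cases "F = {}")
    case True
    obtain a where a: "a \<in> S1" "sg (a - t) = d" "sg (poly u a) = sg (lead_coeff u) * d ^ degree u"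
      using sg_at_infinity[OF rc(1) uv(1,3) tS d] by blast
    obtain a' where a': "a' \<in> S2" "sg (a' - s) = d" "sg (poly v a') = sg (lead_coeff v) * d ^ degree v"
      using sg_at_infinity[OF rc(2) uv(2,4) sS d] by blast
    have "sg (poly u a) = sg (poly v a')" using a a' uv by simp
    moreover have "sg (r' - s) \<noteq> d" if "T r r'" "r \<in> zeros (fst ` W)" for r r'
      using True flip[OF that] that matchingD(3)[OF mat that(1)] unfolding F_def by auto
    moreover have "sg (r - t) \<noteq> d" if "r \<in> S1" "r \<in> zeros (fst ` W)" for r
      using True that unfolding F_def by auto
    ultimately show ?thesis using a a' by blast
  next
    case False
    have "F \<subseteq> signed C" using real_closed_subD(3)[OF rc(1)] by (auto simp: F_def)
    then obtain a where a: "a \<in> F" "\<And>x. x \<in> F \<Longrightarrow> x = a \<or> sg (a - x) = - d"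
      using finite_extreme[OF fin False, of "- d"] d by auto
    have aS: "a \<in> S1" "a \<in> zeros (fst ` W)" "sg (a - t) = d" using a(1) by (auto simp: F_def)
    obtain a' where a': "a' \<in> S2" "T a a'" using matchingD(1)[OF mat aS(1)] by blast
    have "sg (a - r) \<noteq> d" if "r \<in> S1" "r \<in> zeros (fst ` W)" "sg (r - t) = d" for r
    proof -
      have "r \<in> F" using that by (simp add: F_def)
      then show ?thesis using a(2)[of r] d by auto
    qed
    moreover from this have "sg (a' - r') \<noteq> d" if "T r r'" "r \<in> zeros (fst ` W)" "sg (r' - s) = d" for r r'
      using flip[OF that(1,2)] matchingD(3)[OF mat that(1)] that matchingD(6)[OF mat that(1) a'(2) that(2)] by auto
    moreover have "sg (a' - s) = d" using flip[OF a'(2) aS(2)] aS(3) by simp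
    ultimately show ?thesis using a' aS agree[OF a'(2) aS(2)] by blast
  qed
qed

text \<open>Moving from \<open>s\<close> towards \<open>a'\<close> without reaching it crosses no
  matched root.\<close>

lemma same_cell_between:
  assumes t: "t \<notin> zeros (fst ` W)" and ts: "T t s" and d: "d = 1 \<or> d = - 1" and a': "a' \<in> S2"
    and nz: "\<And>r r'. T r r' \<Longrightarrow> r \<in> zeros (fst ` W) \<Longrightarrow> sg (r' - s) = d \<Longrightarrow> sg (a' - r') \<noteq> d"
    and s': "s' \<in> S2" "sg (s' - s) = d" "sg (a' - s') = d"
  shows "same_cell S1 S2 W T t s'"
  unfolding same_cell_def
proof (intro conjI allI impI)
  show tS: "t \<in> S1" and "s' \<in> S2" using matchingD(3)[OF mat ts] s' by auto
  have sS: "s \<in> S2" using matchingD(4)[OF mat ts] .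
  fix r r' assume r: "T r r'" "r \<in> zeros (fst ` W)"
  have rS: "r \<in> S1" "r' \<in> S2" using matchingD(3,4)[OF mat r(1)] by auto
  have eq: "sg (t - r) = sg (s - r')" using matchingD(6)[OF mat r(1) ts r(2)] .
  have "t \<noteq> r" using t r by auto
  then have "sg (s - r') \<noteq> 0" using eq by (metis right_minus_eq sg_eq_0_iff)
  then consider "sg (s - r') = d" | "sg (s - r') = - d" using d sg_cases[of "s - r'"] by auto
  then show "sg (t - r) = sg (s' - r')"
  proof cases
    case 1
    then show ?thesis using sg_transS(1)[OF rc(2) rS(2) sS s'(1) 1] s' eq by simp
  next
    case 2
    then have "sg (r' - s) = d" using sgS(2)[OF rc(2) rS(2) sS] by simp
    then have "sg (a' - r') \<noteq> d" using nz[OF r] by simp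
    then have "sg (r' - a') = d \<or> r' = a'"
      using d sg_cases[of "a' - r'"] sgS(2)[OF rc(2) rS(2) a'] by auto
    then have "sg (r' - s') = d" using sg_transS(1)[OF rc(2) s'(1) a' rS(2) s'(3)] by blast
    then show ?thesis using eq 2 sgS(2)[OF rc(2) s'(1) rS(2)] by simp
  qed
qed

text \<open>The derivative has no root in the cell of a non-root \<open>t\<close>, so
  \<open>u\<close> is monotone there and its sign at \<open>t\<close> constrains its signs at the
  ends of the cell. \<open>v\<close> shares these end signs, and the intermediate value theorem or
  an approach to an end provides \<open>s\<close>.\<close>

lemma same_cell_total:
  assumes tS: "t \<in> S1"
  shows "\<exists>s\<in>S2. same_cell S1 S2 W T t s \<and> sg (poly u t) = sg (poly v s)"
proof -
  obtain s where s: "s \<in> S2" "T t s" using matchingD(1)[OF mat tS] by blast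
  show ?thesis
  proof (cases "t \<in> zeros (fst ` W)")
    case True
    then show ?thesis using s matching_same_cell agree by blast
  next
    case False
    define e where "e = sg (poly (pderiv u) t)"
    have dt: "poly (pderiv u) t \<noteq> 0" using False pderiv_zero by blast
    then have e: "e = 1 \<or> e = - 1" using sg_cases[of "poly (pderiv u) t"] by (auto simp: e_def)
    have uS: "poly u a \<in> signed C" if "a \<in> S1" for a
      using poly_in_S[OF rc(1) uv(1) that] real_closed_subD(3)[OF rc(1)] by blast
    have inc: "sg (poly u a - poly u t) = d * e"
      if d: "d = 1 \<or> d = - 1" and a: "a \<in> S1" "sg (a - t) = d"
        "\<forall>r\<in>S1. r \<in> zeros (fst ` W) \<longrightarrow> sg (r - t) = d \<longrightarrow> sg (a - r) \<noteq> d" for a d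
    proof -
      have "t \<noteq> a" using d a(2) by auto
      have "sg (poly u a - poly u t) = sg (a - t) * sg (poly (pderiv u) t)"
        by (rule sg_increment[OF rc(1) uv(1) tS a(1) \<open>t \<noteq> a\<close> _ tS dt])
          (use a pderiv_zero in auto)
      then show ?thesis using a(2) by (simp add: e_def)
    qed
    show ?thesis
    proof (cases "poly u t = 0")
      case True
      obtain a a' where a: "a \<in> S1" "a' \<in> S2" "sg (a - t) = 1" "sg (a' - s) = 1" "sg (poly u a) = sg (poly v a')"
        "\<forall>r\<in>S1. r \<in> zeros (fst ` W) \<longrightarrow> sg (r - t) = 1 \<longrightarrow> sg (a - r) \<noteq> 1"
        "\<And>r r'. T r r' \<Longrightarrow> r \<in> zeros (fst ` W) \<Longrightarrow> sg (r' - s) = 1 \<Longrightarrow> sg (a' - r') \<noteq> 1"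
        using probe[OF False s(2), of 1] by blast
      obtain b b' where b: "b \<in> S1" "b' \<in> S2" "sg (b - t) = - 1" "sg (b' - s) = - 1" "sg (poly u b) = sg (poly v b')"
        "\<forall>r\<in>S1. r \<in> zeros (fst ` W) \<longrightarrow> sg (r - t) = - 1 \<longrightarrow> sg (b - r) \<noteq> - 1"
        "\<And>r r'. T r r' \<Longrightarrow> r \<in> zeros (fst ` W) \<Longrightarrow> sg (r' - s) = - 1 \<Longrightarrow> sg (b' - r') \<noteq> - 1"
        using probe[OF False s(2), of "- 1"] by blast
      \<comment> \<open>A zero of the monotone \<open>u\<close> forces opposite signs at the two
        ends, and \<open>v\<close> inherits them.\<close>
      have "sg (poly v b') * sg (poly v a') = - 1"
        using inc[OF _ a(1,3,6)] inc[OF _ b(1,3,6)] True a(5) b(5) e by auto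
      then obtain c where c: "c \<in> S2" "poly v c = 0" "sg (c - b') = sg (a' - b')" "sg (a' - c) = sg (a' - b')"
        using ivt[OF rc(2) uv(2) b(2) a(2)] by blast
      have "sg (s - b') = 1" using b(4) sgS(2)[OF rc(2) s(1) b(2)] by simp
      then have "sg (a' - b') = 1" using sg_transS(1)[OF rc(2) b(2) s(1) a(2)] a(4) by blast
      then have c': "sg (a' - c) = 1" "sg (b' - c) = - 1" using c sgS(2)[OF rc(2) b(2) c(1)] by auto
      have "same_cell S1 S2 W T t c"
      proof -
        consider "c = s" | "sg (c - s) = 1" | "sg (c - s) = - 1" using sg_cases[of "c - s"] by auto
        then show ?thesis
        proof cases
          case 1
          then show ?thesis using matching_same_cell s by simp
        next
          case 2
          show ?thesis by (rule same_cell_between[OF False s(2) _ a(2) a(7) c(1) 2 c'(1)]) auto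
        next
          case 3
          show ?thesis by (rule same_cell_between[OF False s(2) _ b(2) b(7) c(1) 3 c'(2)]) auto
        qed
      qed
      then show ?thesis using c True by auto
    next
      case ut: False
      \<comment> \<open>The direction in which \<open>u\<close> moves away from zero, so that its
        sign at \<open>t\<close> persists up to the end \<open>a\<close>.\<close>
      define d where "d = e * sg (poly u t)"
      have d: "d = 1 \<or> d = - 1" using e ut sg_cases[of "poly u t"] by (auto simp: d_def)
      obtain a a' where a: "a \<in> S1" "a' \<in> S2" "sg (a - t) = d" "sg (a' - s) = d" "sg (poly u a) = sg (poly v a')"
        "\<forall>r\<in>S1. r \<in> zeros (fst ` W) \<longrightarrow> sg (r - t) = d \<longrightarrow> sg (a - r) \<noteq> d"
        "\<And>r r'. T r r' \<Longrightarrow> r \<in> zeros (fst ` W) \<Longrightarrow> sg (r' - s) = d \<Longrightarrow> sg (a' - r') \<noteq> d"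
        using probe[OF False s(2) d] by blast
      have "sg (poly u a - poly u t) = sg (poly u t)"
        using inc[OF d a(1,3,6)] e by (auto simp: d_def)
      then have "sg (poly u t + (poly u a - poly u t)) = sg (poly u t)"
        using uS[OF a(1)] uS[OF tS] subring_setD(6)[OF subring_signed] by (intro sg_add) auto
      then have va: "sg (poly v a') = sg (poly u t)" using a(5) by simp
      then have "poly v a' \<noteq> 0" using ut by (metis sg_eq_0_iff)
      \<comment> \<open>The end \<open>a'\<close> may be a matched root and hence outside the cell,
        so a point before it is taken.\<close>
      then obtain w where w: "w \<in> S2" "sg (w - s) = d" "sg (a' - w) = d" "sg (poly v w) = sg (poly v a')"
        using approach_keeping_sign[OF rc(2) uv(2) s(1) a(2,4)] d by auto
      have "same_cell S1 S2 W T t w"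
        by (rule same_cell_between[OF False s(2) d a(2) _ w(1-3)]) (rule a(7))
      then show ?thesis using w va by auto
    qed
  qed
qed

end

end

text \<open>Totality is \<open>same_cell_total\<close> in both directions. For the order relative to
  a new root \<open>t\<close>: either an old root separates \<open>t\<close> from \<open>t'\<close>
  and settles the order on both lines, or \<open>u\<close> is monotone between them and the sign of
  \<open>u(t')\<close> tells on which side of \<open>t\<close> the point \<open>t'\<close>
  lies.\<close>

lemma matching_insert:
  assumes rc: "real_closed_sub S1" "real_closed_sub S2"
    and sim: "similar S1 S2 (insert (u, v) W)" and mat: "matching S1 S2 W T" and finW: "finite W"
    and du: "(pderiv u, pderiv v) \<in> W" and deg: "degree u > 0"
    and agree: "\<And>t s. T t s \<Longrightarrow> t \<in> zeros (fst ` W) \<Longrightarrow> sg (poly u t) = sg (poly v s)"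
  shows "matching S1 S2 (insert (u, v) W) (\<lambda>t s. same_cell S1 S2 W T t s \<and> sg (poly u t) = sg (poly v s))"
    (is "matching _ _ _ ?T'")
proof -
  have simW: "similar S1 S2 W" and simuv: "similar S1 S2 {(u, v)}"
    using similar_mono[OF sim] by auto
  have sim': "similar S2 S1 (W\<inverse>)" "similar S2 S1 {(v, u)}"
    using similar_converse[OF simW] simuv by (auto simp: similar_def)
  have mat': "matching S2 S1 (W\<inverse>) (\<lambda>s t. T t s)" by (rule matching_converse[OF simW mat])
  note uv = uv[OF rc simW mat finW simuv du deg agree]
  have dv: "pderiv u \<noteq> 0" "pderiv v \<noteq> 0"
    using pderiv_neq_0[OF rc simW mat finW simuv du deg] agree by auto
  then have pderiv_zero: "r \<in> zeros (fst ` W)" if "poly (pderiv u) r = 0" for r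
    using du that by (force simp: zeros_def)
  have total: "\<exists>s\<in>S2. ?T' t s" if "t \<in> S1" for t
    using same_cell_total[OF rc simW mat finW simuv du deg agree that] by simp
  have total': "\<exists>t\<in>S1. ?T' t s" if "s \<in> S2" for s
  proof -
    have "fst ` (W\<inverse>) = snd ` W" by force
    then have "\<exists>t\<in>S1. same_cell S2 S1 (W\<inverse>) (\<lambda>s t. T t s) s t \<and> sg (poly v s) = sg (poly u t)"
      using du deg uv(5) finW agree matching_zeros[OF simW mat] that
      by (intro same_cell_total[OF rc(2,1) sim'(1) mat' _ sim'(2)]) auto
    then show ?thesis using same_cell_converse[OF simW mat] by auto
  qed
  note cell_sg = same_cell_sg[OF rc simW mat finW]
  have order: "sg (t' - t) = sg (s' - s)"
    if ts: "?T' t s" and ts': "?T' t' s'" and t: "t \<in> zeros (fst ` insert (u, v) W)" for t s t' s'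
  proof (cases "t \<in> zeros (fst ` W)")
    case True
    then show ?thesis using same_cell_zero[OF rc simW mat finW _ True] ts ts' unfolding same_cell_def by blast
  next
    case False
    have S: "t \<in> S1" "s \<in> S2" "t' \<in> S1" "s' \<in> S2" using ts ts' unfolding same_cell_def by auto
    have ut: "poly u t = 0" using t False by (auto simp: zeros_def)
    then have vs: "poly v s = 0" using ts by (metis sg_eq_0_iff)
    show ?thesis
    proof (cases "\<exists>r r'. T r r' \<and> r \<in> zeros (fst ` W) \<and> sg (t - r) \<noteq> sg (t' - r)")
      case True
      then obtain r r' where r: "T r r'" "r \<in> zeros (fst ` W)" "sg (t - r) \<noteq> sg (t' - r)" by blast
      define d where "d = sg (r - t)"
      have rS: "r \<in> S1" "r' \<in> S2" using matchingD(3,4)[OF mat r(1)] by auto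
      have eq: "sg (t - r) = sg (s - r')" "sg (t' - r) = sg (s' - r')"
        using ts ts' r unfolding same_cell_def by blast+
      have "t \<noteq> r" using False r by auto
      then have d: "d = 1 \<or> d = - 1" using sg_cases[of "r - t"] by (auto simp: d_def)
      have tr: "sg (t - r) = - d" using sgS(2)[OF rc(1) S(1) rS(1)] by (simp add: d_def)
      then have "sg (t' - r) = d \<or> sg (t' - r) = 0" using r(3) d sg_cases[of "t' - r"] by auto
      then have a: "sg (t' - r) = d \<or> t' = r" "sg (s' - r') = d \<or> s' = r'" using eq by auto
      have "sg (r' - s) = d" using tr eq(1) sgS(2)[OF rc(2) rS(2) S(2)] by simp
      then have "sg (s' - s) = d" using sg_transS(1)[OF rc(2) S(2) rS(2) S(4)] a(2) by blast
      moreover have "sg (t' - t) = d"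
        by (rule sg_transS(1)[OF rc(1) S(1) rS(1) S(3) d_def[symmetric] a(1)])
      ultimately show ?thesis by simp
    next
      \<comment> \<open>No old root, hence no root of the derivative, lies between the two
        points.\<close>
      case same: False
      define e where "e = sg (poly (pderiv u) t)"
      have dt: "poly (pderiv u) t \<noteq> 0" using False pderiv_zero by blast
      then have e: "e \<noteq> 0" by (simp add: e_def)
      have e': "e = sg (poly (pderiv v) s)" using cell_sg[OF _ du] ts unfolding e_def by blast
      have ds: "poly (pderiv v) s \<noteq> 0" using e e' by auto
      have 1: "sg (poly u t') = sg (t' - t) * e"
      proof (cases "t' = t")
        case F: False
        have "sg (poly u t' - poly u t) = sg (t' - t) * sg (poly (pderiv u) t)"
        proof (rule sg_increment[OF rc(1) uv(1) S(1,3) _ _ S(1) dt])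
          fix r assume r: "r \<in> S1" "sg (r - t) = sg (t' - t)" "sg (t' - r) = sg (t' - t)"
          show "poly (pderiv u) r \<noteq> 0"
          proof
            assume "poly (pderiv u) r = 0"
            then have "r \<in> zeros (fst ` W)" by (rule pderiv_zero)
            moreover obtain r' where "T r r'" using matchingD(1)[OF mat r(1)] by blast
            ultimately have "sg (t - r) = sg (t' - r)" using same by blast
            then have "sg (t' - t) = 0" using r sgS(2)[OF rc(1) S(1) r(1)] by simp
            then show False using F by simp
          qed
        qed (use F in auto)
        then show ?thesis using ut by (simp add: e_def)
      qed (use ut in auto)
      have 2: "sg (poly v s') = sg (s' - s) * e"
      proof (cases "s' = s")
        case F: False
        have "sg (poly v s' - poly v s) = sg (s' - s) * sg (poly (pderiv v) s)"
        proof (rule sg_increment[OF rc(2) uv(2) S(2,4) _ _ S(2) ds])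
          fix r' assume r': "r' \<in> S2" "sg (r' - s) = sg (s' - s)" "sg (s' - r') = sg (s' - s)"
          show "poly (pderiv v) r' \<noteq> 0"
          proof
            assume "poly (pderiv v) r' = 0"
            then obtain r where r: "T r r'" "r \<in> zeros (fst ` W)"
              using partner_of_zero[OF rc simW mat finW du dv(2) r'(1)] by blast
            then have "sg (t - r) = sg (t' - r)" using same by blast
            then have "sg (s - r') = sg (s' - r')" using r ts ts' unfolding same_cell_def by metis
            then have "sg (s' - s) = 0" using r' sgS(2)[OF rc(2) S(2) r'(1)] by simp
            then show False using F by simp
          qed
        qed (use F in auto)
        then show ?thesis using vs e' by simp
      qed (use vs in auto)
      have "sg (poly u t') = sg (poly v s')" using ts' by blast
      then show ?thesis using 1 2 e by simp
    qed
  qed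
  show ?thesis
    unfolding matching_def
  proof (intro conjI allI impI ballI)
    show "\<exists>s\<in>S2. ?T' t s" if "t \<in> S1" for t using total[OF that] .
    show "\<exists>t\<in>S1. ?T' t s" if "s \<in> S2" for s using total'[OF that] .
    show "t \<in> S1" "s \<in> S2" if "?T' t s" for t s using that by (auto simp: same_cell_def)
    show "case w of (u', v') \<Rightarrow> sg (poly u' t) = sg (poly v' s)"
      if "?T' t s" "w \<in> insert (u, v) W" for t s w
      using that cell_sg by fastforce
    show "sg (t' - t) = sg (s' - s)"
      if "?T' t s" "?T' t' s'" "t \<in> zeros (fst ` insert (u, v) W)" for t s t' s'
      using order[OF that] .
  qed
qed

end

section \<open>Elimination of a variable\<close>

definition ring_homo :: "('c::comm_ring_1 \<Rightarrow> 'b::comm_ring_1) \<Rightarrow> bool" where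
  "ring_homo \<phi> \<longleftrightarrow> \<phi> 0 = 0 \<and> \<phi> 1 = 1 \<and> (\<forall>x y. \<phi> (x + y) = \<phi> x + \<phi> y) \<and> (\<forall>x y. \<phi> (x * y) = \<phi> x * \<phi> y)"

lemma ring_homoD:
  assumes "ring_homo \<phi>"
  shows "\<phi> 0 = 0" "\<phi> 1 = 1" "\<phi> (x + y) = \<phi> x + \<phi> y" "\<phi> (x * y) = \<phi> x * \<phi> y"
  using assms by (simp_all add: ring_homo_def)

lemma ring_homo_sum: "ring_homo \<phi> \<Longrightarrow> \<phi> (sum f A) = (\<Sum>i\<in>A. \<phi> (f i))"
  by (induction A rule: infinite_finite_induct) (auto simp: ring_homoD)

lemma ring_homo_power: "ring_homo \<phi> \<Longrightarrow> \<phi> (x ^ n) = \<phi> x ^ n"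
  by (induction n) (auto simp: ring_homoD)

lemma ring_homo_of_nat: "ring_homo \<phi> \<Longrightarrow> \<phi> (of_nat n) = of_nat n"
  by (induction n) (auto simp: ring_homoD)

lemma coeff_map_poly_homo: "ring_homo \<phi> \<Longrightarrow> coeff (map_poly \<phi> p) i = \<phi> (coeff p i)"
  by (rule coeff_map_poly) (rule ring_homoD)

lemma map_poly_homo_add: "ring_homo \<phi> \<Longrightarrow> map_poly \<phi> (p + q) = map_poly \<phi> p + map_poly \<phi> q"
  by (rule poly_eqI) (simp add: coeff_map_poly_homo ring_homoD)

lemma map_poly_homo_mult: "ring_homo \<phi> \<Longrightarrow> map_poly \<phi> (p * q) = map_poly \<phi> p * map_poly \<phi> q"
  by (rule poly_eqI) (simp add: coeff_map_poly_homo ring_homoD coeff_mult ring_homo_sum)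

lemma map_poly_homo_smult: "ring_homo \<phi> \<Longrightarrow> map_poly \<phi> (smult c p) = smult (\<phi> c) (map_poly \<phi> p)"
  by (rule poly_eqI) (simp add: coeff_map_poly_homo ring_homoD)

text \<open>The library's \<open>pderiv\<close> requires the coefficient ring to have no zero divisors.\<close>

definition formal_deriv :: "'c::comm_ring_1 poly \<Rightarrow> 'c poly" where
  "formal_deriv p = Poly (map (\<lambda>i. of_nat (Suc i) * coeff p (Suc i)) [0..<degree p])"

lemma coeff_formal_deriv: "coeff (formal_deriv p) i = of_nat (Suc i) * coeff p (Suc i)"
  by (cases "i < degree p") (auto simp: formal_deriv_def nth_default_def coeff_eq_0)

lemma degree_formal_deriv: "degree p \<le> Suc n \<Longrightarrow> degree (formal_deriv p) \<le> n"
  by (rule degree_le) (auto simp: coeff_formal_deriv coeff_eq_0 simp del: of_nat_Suc)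

lemma map_poly_formal_deriv:
  fixes \<phi> :: "'c::comm_ring_1 \<Rightarrow> 'b::field"
  shows "ring_homo \<phi> \<Longrightarrow> map_poly \<phi> (formal_deriv p) = pderiv (map_poly \<phi> p)"
  by (rule poly_eqI)
    (simp add: coeff_map_poly_homo coeff_formal_deriv coeff_pderiv ring_homoD ring_homo_of_nat del: of_nat_Suc)

lemma formal_deriv_polys_over:
  "subring_set S \<Longrightarrow> p \<in> polys_over S \<Longrightarrow> formal_deriv p \<in> polys_over S"
  unfolding polys_over_def
  by (auto simp: coeff_formal_deriv simp del: of_nat_Suc intro: subring_setD(4) subring_set_of_nat)

lemma poly_cutoff_polys_over:
  "subring_set S \<Longrightarrow> p \<in> polys_over S \<Longrightarrow> poly_cutoff n p \<in> polys_over S"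
  by (auto simp: polys_over_def coeff_poly_cutoff subring_setD)

text \<open>Multiplying by \<open>coeff g k\<close> before each subtraction avoids inverses. The
  number \<open>k\<close> merely bounds the degree of \<open>g\<close>; the coefficient there may
  even be zero.\<close>

lemma pseudo_division:
  fixes S :: "'c::comm_ring_1 set"
  assumes S: "subring_set S" and g: "g \<in> polys_over S" "degree g \<le> k" "k > 0" and p: "p \<in> polys_over S"
  shows "\<exists>N. \<exists>q\<in>polys_over S. \<exists>r\<in>polys_over S. smult (coeff g k ^ N) p = g * q + r \<and> degree r < k"
  using p
proof (induction "degree p" arbitrary: p rule: less_induct)
  case less
  show ?case
  proof (cases "degree p < k")
    case True
    then have "smult (coeff g k ^ 0) p = g * 0 + p" by simp
    then show ?thesis using True less.prems polys_over_0[OF S] by blast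
  next
    case False
    define n where "n = degree p"
    define m where "m = monom (coeff p n) (n - k)"
    define p1 where "p1 = smult (coeff g k) p - m * g"
    have mS: "m \<in> polys_over S" unfolding m_def
      using less.prems by (intro polys_over_monom[OF S] polys_overD)
    have p1S: "p1 \<in> polys_over S" unfolding p1_def
      using less.prems g mS by (intro polys_over_diff[OF S] polys_over_smult[OF S] polys_over_mult[OF S] polys_overD)
    have c: "coeff p1 i = 0" if "i \<ge> n" for i
    proof -
      have "coeff p1 i = coeff g k * coeff p i - coeff p n * coeff g (i - (n - k))"
        using that False unfolding p1_def m_def n_def by (simp add: coeff_monom_mult)
      also have "\<dots> = 0"
      proof (cases "i = n")
        case True
        then have "i - (n - k) = k" using False by (simp add: n_def)
        then show ?thesis using True by simp
      next
        case F: False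
        then have "coeff p i = 0" "coeff g (i - (n - k)) = 0"
          using that g(2) False by (auto simp: n_def intro!: coeff_eq_0)
        then show ?thesis by simp
      qed
      finally show ?thesis .
    qed
    have n0: "n > 0" using False g by (simp add: n_def)
    have "degree p1 \<le> n - 1" by (rule degree_le) (use c n0 in auto)
    then have "degree p1 < degree p" using n0 by (simp add: n_def)
    then obtain N q r where qr: "q \<in> polys_over S" "r \<in> polys_over S"
      "smult (coeff g k ^ N) p1 = g * q + r" "degree r < k"
      using less.hyps[OF _ p1S] by blast
    have "smult (coeff g k ^ Suc N) p = smult (coeff g k ^ N) (p1 + m * g)"
      by (simp add: p1_def mult.commute)
    also have "\<dots> = g * (q + smult (coeff g k ^ N) m) + r"
      using qr(3) by (simp add: smult_add_right algebra_simps)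
    finally show ?thesis
      using qr mS g polys_over_add[OF S] polys_over_smult[OF S] subring_set_power[OF S] polys_overD by meson
  qed
qed

text \<open>The multiplier is a power times itself, hence nonnegative under every homomorphism to an
  ordered field, so that passing to the remainder does not reverse signs.\<close>

definition pseudo_rem :: "'c::comm_ring_1 set \<Rightarrow> 'c poly \<Rightarrow> 'c poly \<Rightarrow> nat \<Rightarrow> 'c poly" where
  "pseudo_rem S p g k = (SOME r. r \<in> polys_over S \<and> degree r < k \<and>
     (\<exists>N q. smult (coeff g k ^ N * coeff g k ^ N) p = poly_cutoff (Suc k) g * q + r))"

lemma pseudo_rem:
  assumes S: "subring_set S" and g: "g \<in> polys_over S" "k > 0" and p: "p \<in> polys_over S"
  shows "pseudo_rem S p g k \<in> polys_over S" "degree (pseudo_rem S p g k) < k"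
    "\<exists>N q. smult (coeff g k ^ N * coeff g k ^ N) p = poly_cutoff (Suc k) g * q + pseudo_rem S p g k"
proof -
  define h where "h = poly_cutoff (Suc k) g"
  have h: "h \<in> polys_over S" "degree h \<le> k" "coeff h k = coeff g k"
    using poly_cutoff_polys_over[OF S g(1)] by (auto simp: h_def coeff_poly_cutoff intro!: degree_le)
  obtain N q r where qr: "r \<in> polys_over S" "smult (coeff g k ^ N) p = h * q + r" "degree r < k"
    using pseudo_division[OF S h(1,2) g(2) p] h(3) by auto
  \<comment> \<open>Multiplying once more by the same power makes the multiplier a square.\<close>
  have "smult (coeff g k ^ N * coeff g k ^ N) p = h * smult (coeff g k ^ N) q + smult (coeff g k ^ N) r"
    using arg_cong[OF qr(2), of "smult (coeff g k ^ N)"] by (simp add: smult_add_right)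
  moreover have "smult (coeff g k ^ N) r \<in> polys_over S"
    using qr g polys_over_smult[OF S] subring_set_power[OF S] polys_overD by meson
  moreover have "degree (smult (coeff g k ^ N) r) < k"
    using qr(3) degree_smult_le le_less_trans by blast
  ultimately have "\<exists>r. r \<in> polys_over S \<and> degree r < k \<and>
     (\<exists>N q. smult (coeff g k ^ N * coeff g k ^ N) p = poly_cutoff (Suc k) g * q + r)"
    unfolding h_def by blast
  from someI_ex[OF this, folded pseudo_rem_def]
  show "pseudo_rem S p g k \<in> polys_over S" "degree (pseudo_rem S p g k) < k"
    "\<exists>N q. smult (coeff g k ^ N * coeff g k ^ N) p = poly_cutoff (Suc k) g * q + pseudo_rem S p g k"
    by blast+
qed

section \<open>Sign diagrams determined by finitely many ring elements\<close>

context ordered_cone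
begin

definition poly_pairs :: "('c::comm_ring_1 \<Rightarrow> 'b) \<Rightarrow> ('c \<Rightarrow> 'b) \<Rightarrow> 'c poly set \<Rightarrow> ('b poly \<times> 'b poly) set" where
  "poly_pairs \<phi> \<psi> P = (\<lambda>p. (map_poly \<phi> p, map_poly \<psi> p)) ` P"

text \<open>\<open>Q\<close> comes before the homomorphisms: finitely many sign conditions work for
  all pairs at once. This uniformity takes the place of a quantifier-free formula equivalent to the
  existence of a point with given signs.\<close>

definition sign_determined :: "'b set \<Rightarrow> 'b set \<Rightarrow> 'c::comm_ring_1 set \<Rightarrow> 'c poly set \<Rightarrow> bool" where
  "sign_determined S1 S2 S P \<longleftrightarrow> (\<exists>Q. finite Q \<and> Q \<subseteq> S \<and>
     (\<forall>\<phi> \<psi>. ring_homo \<phi> \<longrightarrow> ring_homo \<psi> \<longrightarrow> \<phi> ` S \<subseteq> S1 \<longrightarrow> \<psi> ` S \<subseteq> S2 \<longrightarrow>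
        (\<forall>q\<in>Q. sg (\<phi> q) = sg (\<psi> q)) \<longrightarrow> (\<exists>T. matching S1 S2 (poly_pairs \<phi> \<psi> P) T)))"

lemma map_poly_polys_over:
  "ring_homo \<phi> \<Longrightarrow> \<phi> ` S \<subseteq> S1 \<Longrightarrow> p \<in> polys_over S \<Longrightarrow> map_poly \<phi> p \<in> polys_over S1"
  by (auto simp: polys_over_def coeff_map_poly_homo)

text \<open>Coefficients vanish at the same places under \<open>\<phi>\<close> and
  \<open>\<psi>\<close>, so the degree drops equally on both sides.\<close>

lemma similar_poly_pairs:
  assumes h: "ring_homo \<phi>" "ring_homo \<psi>" "\<phi> ` S \<subseteq> S1" "\<psi> ` S \<subseteq> S2"
    and P: "P \<subseteq> polys_over S" and eq: "\<And>p i. p \<in> P \<Longrightarrow> sg (\<phi> (coeff p i)) = sg (\<psi> (coeff p i))"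
  shows "similar S1 S2 (poly_pairs \<phi> \<psi> P)"
proof -
  have "degree (map_poly \<phi> p) = degree (map_poly \<psi> p) \<and>
    sg (lead_coeff (map_poly \<phi> p)) = sg (lead_coeff (map_poly \<psi> p))" if "p \<in> P" for p
  proof -
    have "\<phi> (coeff p i) = 0 \<longleftrightarrow> \<psi> (coeff p i) = 0" for i
      using eq[OF that] by (metis sg_eq_0_iff)
    then have "degree (map_poly \<phi> p) = degree (map_poly \<psi> p)"
      unfolding degree_def by (simp add: coeff_map_poly_homo h)
    then show ?thesis using eq[OF that] by (simp add: coeff_map_poly_homo h)
  qed
  moreover have "map_poly \<phi> p \<in> polys_over S1 \<and> map_poly \<psi> p \<in> polys_over S2" if "p \<in> P" for p
    using map_poly_polys_over[OF h(1,3)] map_poly_polys_over[OF h(2,4)] P that by blast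
  ultimately show ?thesis
    unfolding similar_def poly_pairs_def by blast
qed

lemma sg_even_power:
  assumes "x \<in> signed C" "x \<noteq> 0" shows "sg (x ^ N * x ^ N) = 1"
  using sg_mult[of "x ^ N" "x ^ N"] subring_set_power[OF subring_signed assms(1)]
    sg_mult_self[of "x ^ N"] assms(2) by simp

text \<open>At a root \<open>t\<close> of the image of \<open>g\<close> the division identity reads
  \<open>c^(2N) * p(t) = r(t)\<close>, and \<open>c\<close> is nonzero because that image has degree
  exactly \<open>k\<close>.\<close>

lemma sg_pseudo_rem:
  assumes S: "subring_set S" and g: "g \<in> polys_over S" "k > 0" and p: "p \<in> polys_over S"
    and h: "ring_homo \<phi>" "\<phi> ` S \<subseteq> S1" and rc: "real_closed_sub S1"
    and k: "degree (map_poly \<phi> g) = k" and t: "t \<in> S1" "poly (map_poly \<phi> g) t = 0"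
  shows "sg (poly (map_poly \<phi> p) t) = sg (poly (map_poly \<phi> (pseudo_rem S p g k)) t)"
proof -
  obtain N q where N: "smult (coeff g k ^ N * coeff g k ^ N) p = poly_cutoff (Suc k) g * q + pseudo_rem S p g k"
    using pseudo_rem(3)[OF S g p] by blast
  define c where "c = \<phi> (coeff g k)"
  have c: "c = lead_coeff (map_poly \<phi> g)" using k by (simp add: coeff_map_poly_homo h c_def)
  have "map_poly \<phi> (poly_cutoff (Suc k) g) = map_poly \<phi> g"
  proof (rule poly_eqI)
    fix i
    have "\<phi> (coeff g i) = 0" if "i > k" for i
      using coeff_eq_0[of "map_poly \<phi> g" i] that k by (simp add: coeff_map_poly_homo h)
    then show "coeff (map_poly \<phi> (poly_cutoff (Suc k) g)) i = coeff (map_poly \<phi> g) i"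
      using ring_homoD(1)[OF h(1)] by (auto simp: coeff_map_poly_homo[OF h(1)] coeff_poly_cutoff)
  qed
  then have "smult (c ^ N * c ^ N) (map_poly \<phi> p)
      = map_poly \<phi> g * map_poly \<phi> q + map_poly \<phi> (pseudo_rem S p g k)"
    using arg_cong[OF N, of "map_poly \<phi>"]
    by (simp add: map_poly_homo_add map_poly_homo_mult map_poly_homo_smult ring_homoD ring_homo_power h c_def)
  then have eq: "c ^ N * c ^ N * poly (map_poly \<phi> p) t = poly (map_poly \<phi> (pseudo_rem S p g k)) t"
    using t(2) by (metis add_0 mult_zero_left poly_add poly_mult poly_smult)
  have R: "S1 \<subseteq> signed C" using rc by (simp add: real_closed_sub_def)
  have "coeff g k \<in> S" using g by (auto dest: polys_overD)
  then have cR: "c \<in> signed C" unfolding c_def using h R by blast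
  have "map_poly \<phi> g \<noteq> 0" using k g by auto
  then have "c \<noteq> 0" using c by simp
  moreover have "poly (map_poly \<phi> p) t \<in> signed C"
    using poly_in_S[OF rc map_poly_polys_over[OF h p] t(1)] R by blast
  ultimately show ?thesis
    using sg_mult[of "c ^ N * c ^ N" "poly (map_poly \<phi> p) t"] sg_even_power[OF cR] eq
      subring_set_power[OF subring_signed cR] subring_setD(4)[OF subring_signed] by simp
qed

context
  fixes S1 S2 and S :: "'c::comm_ring_1 set"
  assumes rc: "real_closed_sub S1" "real_closed_sub S2" and S: "subring_set S"
begin

lemma sign_determined_const:
  assumes P: "finite P" "P \<subseteq> polys_over S" "\<And>p. p \<in> P \<Longrightarrow> degree p = 0"
  shows "sign_determined S1 S2 S P"
  unfolding sign_determined_def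
proof (intro exI[of _ "(\<lambda>p. coeff p 0) ` P"] conjI allI impI)
  show "finite ((\<lambda>p. coeff p 0) ` P)" using P by simp
  show "(\<lambda>p. coeff p 0) ` P \<subseteq> S" using P(2) unfolding polys_over_def by auto
  fix \<phi> \<psi> :: "'c \<Rightarrow> 'b"
  assume h: "ring_homo \<phi>" "ring_homo \<psi>" "\<phi> ` S \<subseteq> S1" "\<psi> ` S \<subseteq> S2"
    and eq: "\<forall>q\<in>(\<lambda>p. coeff p 0) ` P. sg (\<phi> q) = sg (\<psi> q)"
  have c: "map_poly \<phi> p = [:\<phi> (coeff p 0):]" "map_poly \<psi> p = [:\<psi> (coeff p 0):]" if "p \<in> P" for p
    using P(3)[OF that] h by (auto elim!: degree_eq_zeroE simp: map_poly_pCons ring_homoD)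
  \<comment> \<open>Nonzero constants have no roots, so each line is a single cell and any two
    points may be matched.\<close>
  have "zeros (fst ` poly_pairs \<phi> \<psi> P) = {}"
    using c by (auto simp: zeros_def poly_pairs_def)
  moreover have "sg (poly (map_poly \<phi> p) t) = sg (poly (map_poly \<psi> p) s)" if "p \<in> P" for p t s
    using c[OF that] eq that by simp
  ultimately have "matching S1 S2 (poly_pairs \<phi> \<psi> P) (\<lambda>t s. t \<in> S1 \<and> s \<in> S2)"
    using real_closed_subD(2)[OF rc(1)] real_closed_subD(2)[OF rc(2)]
    unfolding matching_def poly_pairs_def by (auto dest: subring_setD(1))
  then show "\<exists>T. matching S1 S2 (poly_pairs \<phi> \<psi> P) T" by blast
qed

text \<open>At a root of \<open>q\<close> the polynomial \<open>p\<close> has the sign of its pseudo-remainder by \<open>q\<close>. As the images of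
  the leading coefficients may vanish, \<open>q\<close> has to be truncated at every possible degree \<open>k\<close>.\<close>

definition reducts :: "'c poly \<Rightarrow> 'c poly set \<Rightarrow> 'c poly set" where
  "reducts p P = {formal_deriv p, poly_cutoff (degree p) p} \<union>
     (\<Union>q\<in>insert (formal_deriv p) P. (\<lambda>k. pseudo_rem S p q k) ` {1..degree q})"

text \<open>Adding all coefficients to \<open>Q\<close> makes the images similar and decides whether
  the leading coefficient of \<open>p\<close> vanishes. If it does, \<open>p\<close> acts like its
  truncation; otherwise the derivative and the pseudo-remainders supply the hypotheses of
  \<open>matching_insert\<close>.\<close>

lemma sign_determined_insert:
  assumes P: "finite P" "P \<subseteq> polys_over S" and p: "p \<in> polys_over S" "degree p > 0"
    and D: "sign_determined S1 S2 S (P \<union> reducts p P)"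
  shows "sign_determined S1 S2 S (insert p P)"
proof -
  define dp where "dp = formal_deriv p"
  define coefs where "coefs = (\<Union>q\<in>insert p (insert dp P). coeff q ` {..degree q})"
  have dpS: "dp \<in> polys_over S" unfolding dp_def by (rule formal_deriv_polys_over[OF S p(1)])
  have coefs: "finite coefs" "coefs \<subseteq> S"
    using P p dpS polys_overD unfolding coefs_def by auto
  obtain Q where Q: "finite Q" "Q \<subseteq> S" and Qm: "\<And>\<phi> \<psi>. ring_homo \<phi> \<Longrightarrow> ring_homo \<psi> \<Longrightarrow>
      \<phi> ` S \<subseteq> S1 \<Longrightarrow> \<psi> ` S \<subseteq> S2 \<Longrightarrow> (\<forall>q\<in>Q. sg (\<phi> q) = sg (\<psi> q)) \<Longrightarrow>
      (\<exists>T. matching S1 S2 (poly_pairs \<phi> \<psi> (P \<union> reducts p P)) T)"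
    using D unfolding sign_determined_def by blast
  show ?thesis
    unfolding sign_determined_def
  proof (intro exI[of _ "Q \<union> coefs"] conjI allI impI)
    show "finite (Q \<union> coefs)" "Q \<union> coefs \<subseteq> S" using Q coefs by auto
    fix \<phi> \<psi> :: "'c \<Rightarrow> 'b"
    assume h: "ring_homo \<phi>" "ring_homo \<psi>" "\<phi> ` S \<subseteq> S1" "\<psi> ` S \<subseteq> S2"
      and eq: "\<forall>q\<in>Q \<union> coefs. sg (\<phi> q) = sg (\<psi> q)"
    obtain T where T: "matching S1 S2 (poly_pairs \<phi> \<psi> (P \<union> reducts p P)) T"
      using Qm[OF h] eq by blast
    have eqc: "sg (\<phi> (coeff q i)) = sg (\<psi> (coeff q i))" if "q \<in> insert p (insert dp P)" for q i
    proof (cases "i \<le> degree q")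
      case True
      then show ?thesis using eq that unfolding coefs_def by blast
    next
      case False
      then show ?thesis by (simp add: coeff_eq_0 ring_homoD h)
    qed
    show "\<exists>T. matching S1 S2 (poly_pairs \<phi> \<psi> (insert p P)) T"
    proof (cases "\<phi> (lead_coeff p) = 0")
      case True
      then have True': "\<psi> (lead_coeff p) = 0" using eqc[of p "degree p"] by (simp del: sg_eq_0_iff flip: sg_eq_0_iff)
      have "map_poly \<chi> (poly_cutoff (degree p) p) = map_poly \<chi> p"
        if "ring_homo \<chi>" "\<chi> (lead_coeff p) = 0" for \<chi> :: "'c \<Rightarrow> 'b"
      proof (rule poly_eqI)
        fix i
        show "coeff (map_poly \<chi> (poly_cutoff (degree p) p)) i = coeff (map_poly \<chi> p) i"
          using that ring_homoD(1)[OF that(1)] coeff_eq_0[of p i]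
          by (cases "i = degree p") (auto simp: coeff_map_poly_homo[OF that(1)] coeff_poly_cutoff)
      qed
      then have "poly_pairs \<phi> \<psi> (insert p P) \<subseteq> poly_pairs \<phi> \<psi> (P \<union> reducts p P)"
        using h True True' unfolding poly_pairs_def reducts_def by auto
      then show ?thesis using matching_mono[OF T] by blast
    next
      case False
      let ?W = "poly_pairs \<phi> \<psi> (insert dp P)"
      let ?u = "map_poly \<phi> p" and ?v = "map_poly \<psi> p"
      have TW: "matching S1 S2 ?W T"
        by (rule matching_mono[OF T]) (auto simp: poly_pairs_def reducts_def dp_def)
      have sim: "similar S1 S2 (poly_pairs \<phi> \<psi> (insert p (insert dp P)))"
        using P p dpS eqc by (intro similar_poly_pairs[OF h]) auto
      then have simi: "similar S1 S2 (insert (?u, ?v) ?W)" by (simp add: poly_pairs_def)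
      have "coeff ?u (degree p) \<noteq> 0" using False by (simp add: coeff_map_poly_homo h)
      then have deg: "degree ?u > 0" using p(2) le_degree by (metis less_le_trans)
      have du: "(pderiv ?u, pderiv ?v) \<in> ?W"
        by (simp add: poly_pairs_def dp_def map_poly_formal_deriv h)
      have agree: "sg (poly ?u t) = sg (poly ?v s)" if ts: "T t s" and z: "t \<in> zeros (fst ` ?W)" for t s
      proof -
        obtain q where q: "q \<in> insert dp P" "map_poly \<phi> q \<noteq> 0" "poly (map_poly \<phi> q) t = 0"
          using z by (auto simp: zeros_def poly_pairs_def)
        have qS: "q \<in> polys_over S" using q P dpS by auto
        \<comment> \<open>The actual degree of the image of \<open>q\<close> selects the truncation
          by which to divide.\<close>
        define k where "k = degree (map_poly \<phi> q)"
        have pair: "(map_poly \<phi> q, map_poly \<psi> q) \<in> ?W" using q by (auto simp: poly_pairs_def)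
        then have k': "degree (map_poly \<psi> q) = k"
          using similarD(3)[OF simi insertI2[OF pair]] by (simp add: k_def)
        have k0: "k > 0"
          using q(2,3) unfolding k_def by (metis degree_eq_zeroE gr0I mult_zero_right pCons_0_0 poly_const_conv)
        moreover have "k \<le> degree q" unfolding k_def
          by (rule degree_le) (simp add: coeff_map_poly_homo coeff_eq_0 ring_homoD h)
        ultimately have "k \<in> {1..degree q}" by simp
        then have "pseudo_rem S p q k \<in> reducts p P"
          using q(1) unfolding reducts_def dp_def by blast
        then have r: "sg (poly (map_poly \<phi> (pseudo_rem S p q k)) t) = sg (poly (map_poly \<psi> (pseudo_rem S p q k)) s)"
          using matchingD(5)[OF T ts] by (auto simp: poly_pairs_def)
        have tS: "t \<in> S1" "s \<in> S2" using matchingD(3,4)[OF T ts] by auto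
        have "poly (map_poly \<psi> q) s = 0" using matchingD(5)[OF TW ts pair] q(3) by (metis sg_eq_0_iff)
        then show ?thesis
          using sg_pseudo_rem[OF S qS k0 p(1) h(1,3) rc(1) k_def[symmetric] tS(1) q(3)]
            sg_pseudo_rem[OF S qS k0 p(1) h(2,4) rc(2) k' tS(2)] r by simp
      qed
      have fin: "finite ?W" using P by (simp add: poly_pairs_def)
      show ?thesis
      proof (rule exI, rule matching_mono)
        show "matching S1 S2 (insert (?u, ?v) ?W) (\<lambda>t s. same_cell S1 S2 ?W T t s \<and> sg (poly ?u t) = sg (poly ?v s))"
          by (rule matching_insert[OF rc simi TW fin du deg agree])
        show "poly_pairs \<phi> \<psi> (insert p P) \<subseteq> insert (?u, ?v) ?W" by (auto simp: poly_pairs_def)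
      qed
    qed
  qed
qed

lemma reducts_finite: "finite P \<Longrightarrow> finite (reducts p P)"
  by (simp add: reducts_def)

lemma reducts_polys_over:
  assumes "P \<subseteq> polys_over S" "p \<in> polys_over S"
  shows "reducts p P \<subseteq> polys_over S"
  using assms formal_deriv_polys_over[OF S assms(2)] poly_cutoff_polys_over[OF S assms(2)]
    pseudo_rem(1)[OF S _ _ assms(2)]
  unfolding reducts_def by auto

text \<open>Makes the elimination terminate: one polynomial of top degree is traded for finitely
  many of lower degree.\<close>

lemma reducts_degree:
  assumes "P \<subseteq> polys_over S" "p \<in> polys_over S" "degree p = Suc n" "\<And>q. q \<in> P \<Longrightarrow> degree q \<le> Suc n"
    "r \<in> reducts p P"
  shows "degree r \<le> n"
proof -
  consider "r = formal_deriv p" | "r = poly_cutoff (degree p) p"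
    | q k where "q \<in> insert (formal_deriv p) P" "k \<in> {1..degree q}" "r = pseudo_rem S p q k"
    using assms(5) unfolding reducts_def by blast
  then show ?thesis
  proof cases
    case 1
    then show ?thesis using degree_formal_deriv[of p n] assms(3) by simp
  next
    case 2
    then show ?thesis using assms(3) by (auto simp: coeff_poly_cutoff intro!: degree_le)
  next
    case 3
    have "q \<in> polys_over S" using 3 assms(1) formal_deriv_polys_over[OF S assms(2)] by auto
    then have "degree r < k" using pseudo_rem(2)[OF S _ _ assms(2)] 3 by auto
    moreover have "degree q \<le> Suc n" using 3 assms(4) degree_formal_deriv[of p n] assms(3) by auto
    ultimately show ?thesis using 3 by simp
  qed
qed

text \<open>Nested induction on a bound for the degrees and on the number of polynomials that attain
  it. The lower part \<open>P1\<close> is arbitrary in the inner induction, since each removal of a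
  top polynomial enlarges it.\<close>

theorem sign_determined_finite:
  assumes "finite P" "P \<subseteq> polys_over S"
  shows "sign_determined S1 S2 S P"
proof -
  have "sign_determined S1 S2 S P" if "finite P" "P \<subseteq> polys_over S" "\<forall>p\<in>P. degree p \<le> n" for P n
    using that
  proof (induction n arbitrary: P)
    case 0
    then show ?case using sign_determined_const by auto
  next
    case (Suc n)
    have "sign_determined S1 S2 S (P1 \<union> P2)"
      if "finite P2" "P2 \<subseteq> polys_over S" "\<forall>p\<in>P2. degree p = Suc n"
        "finite P1" "P1 \<subseteq> polys_over S" "\<forall>p\<in>P1. degree p \<le> n" for P1 P2
      using that
    proof (induction P2 arbitrary: P1 rule: finite_induct)
      case empty
      then show ?case using Suc.IH by simp
    next
      case (insert p P2)
      let ?R = "reducts p (P1 \<union> P2)"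
      have p: "p \<in> polys_over S" "degree p = Suc n" using insert.prems by auto
      have sub: "P1 \<union> P2 \<subseteq> polys_over S" using insert.prems by auto
      have deg: "degree q \<le> Suc n" if "q \<in> P1 \<union> P2" for q using insert.prems that by force
      have "sign_determined S1 S2 S ((P1 \<union> ?R) \<union> P2)"
      proof (rule insert.IH)
        show "finite (P1 \<union> ?R)" using insert.prems insert.hyps reducts_finite by simp
        show "P1 \<union> ?R \<subseteq> polys_over S" using insert.prems reducts_polys_over[OF sub p(1)] by simp
        show "\<forall>q\<in>P1 \<union> ?R. degree q \<le> n"
          using insert.prems reducts_degree[OF sub p(1,2) deg] by auto
      qed (use insert.prems in auto)
      moreover have "(P1 \<union> ?R) \<union> P2 = (P1 \<union> P2) \<union> ?R" by blast
      ultimately have D: "sign_determined S1 S2 S ((P1 \<union> P2) \<union> ?R)" by simp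
      have fin: "finite (P1 \<union> P2)" using insert.prems insert.hyps by blast
      have "sign_determined S1 S2 S (insert p (P1 \<union> P2))"
        by (rule sign_determined_insert[OF fin sub p(1) _ D]) (simp add: p(2))
      then show ?case by simp
    qed
    note step = this
    have "sign_determined S1 S2 S ({p \<in> P. degree p \<le> n} \<union> {p \<in> P. degree p = Suc n})"
      by (rule step) (use Suc.prems in \<open>simp_all add: subset_iff\<close>)
    moreover have "{p \<in> P. degree p \<le> n} \<union> {p \<in> P. degree p = Suc n} = P"
      using Suc.prems(3) by (auto simp: le_Suc_eq)
    ultimately show ?case by simp
  qed
  moreover have "\<forall>p\<in>P. degree p \<le> Max (degree ` P)" using assms by auto
  ultimately show ?thesis using assms by blast
qed

end

end

section \<open>Transfer of signs\<close>

text \<open>Polynomials are taken as functions of the point, so that evaluation at a point is a ring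
  homomorphism by the pointwise definition of the operations.\<close>

inductive_set poly_funs :: "'b::comm_ring_1 set \<Rightarrow> nat \<Rightarrow> ((nat \<Rightarrow> 'b) \<Rightarrow> 'b) set" for K k where
  const: "c \<in> K \<Longrightarrow> (\<lambda>y. c) \<in> poly_funs K k"
| proj: "i < k \<Longrightarrow> (\<lambda>y. y i) \<in> poly_funs K k"
| add: "f \<in> poly_funs K k \<Longrightarrow> g \<in> poly_funs K k \<Longrightarrow> (\<lambda>y. f y + g y) \<in> poly_funs K k"
| mult: "f \<in> poly_funs K k \<Longrightarrow> g \<in> poly_funs K k \<Longrightarrow> (\<lambda>y. f y * g y) \<in> poly_funs K k"

lemma poly_funs_sum:
  assumes "0 \<in> K" "\<And>a. a \<in> A \<Longrightarrow> (\<lambda>y. F a y) \<in> poly_funs K k"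
  shows "(\<lambda>y. \<Sum>a\<in>A. F a y) \<in> poly_funs K k"
  using assms(2)
  by (induction A rule: infinite_finite_induct) (auto intro: poly_funs.intros assms(1))

lemma poly_funs_prod:
  assumes "1 \<in> K" "\<And>a. a \<in> A \<Longrightarrow> (\<lambda>y. F a y) \<in> poly_funs K k"
  shows "(\<lambda>y. \<Prod>a\<in>A. F a y) \<in> poly_funs K k"
  using assms(2)
  by (induction A rule: infinite_finite_induct) (auto intro: poly_funs.intros assms(1))

lemma poly_funs_power:
  assumes "1 \<in> K" "f \<in> poly_funs K k"
  shows "(\<lambda>y. f y ^ n) \<in> poly_funs K k"
  by (induction n) (auto intro: poly_funs.intros assms)

lemma subring_poly_funs: assumes "subring_set K" shows "subring_set (poly_funs K k)"
  unfolding subring_set_def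
proof (intro conjI ballI)
  note K = subring_setD[OF assms]
  show "0 \<in> poly_funs K k" "1 \<in> poly_funs K k"
    using poly_funs.const[OF K(1), of k] poly_funs.const[OF K(2), of k]
    by (simp_all add: zero_fun_def one_fun_def)
  show "f + g \<in> poly_funs K k" "f * g \<in> poly_funs K k" if "f \<in> poly_funs K k" "g \<in> poly_funs K k" for f g
    using poly_funs.add[OF that] poly_funs.mult[OF that] by (simp_all add: plus_fun_def times_fun_def)
  show "- f \<in> poly_funs K k" if "f \<in> poly_funs K k" for f
    using poly_funs.mult[OF poly_funs.const[OF K(5)[OF K(2)]] that] by (simp add: fun_Compl_def)
qed

lemma poly_funs_cong:
  "f \<in> poly_funs K k \<Longrightarrow> (\<And>i. i < k \<Longrightarrow> y i = z i) \<Longrightarrow> f y = f z"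
  by (induction rule: poly_funs.induct) auto

lemma poly_funs_value:
  assumes "f \<in> poly_funs K k" "subring_set S" "K \<subseteq> S" "\<And>i. i < k \<Longrightarrow> y i \<in> S"
  shows "f y \<in> S"
  using assms(1) by (induction rule: poly_funs.induct) (use assms(2-4) in \<open>auto intro: subring_setD\<close>)

lemma ring_homo_apply: "ring_homo (\<lambda>f. f y)"
  by (simp add: ring_homo_def)

text \<open>Turns the last coordinate into the variable to be eliminated, with coefficients that see
  the other coordinates only.\<close>

lemma poly_funs_Suc:
  assumes K: "subring_set K" and f: "f \<in> poly_funs K (Suc k)"
  shows "\<exists>q\<in>polys_over (poly_funs K k). \<forall>y. f y = poly (map_poly (\<lambda>c. c y) q) (y k)"
  using f
proof (induction rule: poly_funs.induct)
  note sr = subring_poly_funs[OF K, of k]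
  have homo: "ring_homo (\<lambda>f :: (nat \<Rightarrow> 'a) \<Rightarrow> 'a. f y)" for y by (rule ring_homo_apply)
  {
    case (const c)
    then have "[:\<lambda>y. c:] \<in> polys_over (poly_funs K k)"
      by (intro polys_over_const[OF sr] poly_funs.const)
    moreover have "poly (map_poly (\<lambda>c. c y) [:\<lambda>y. c:]) (y k) = c" for y :: "nat \<Rightarrow> 'a"
      by (simp add: map_poly_pCons)
    ultimately show ?case by metis
  next
    case (proj i)
    show ?case
    proof (cases "i = k")
      case True
      have "[:0, 1:] \<in> polys_over (poly_funs K k)"
        by (intro polys_over_linear[OF sr] subring_setD(1,2)[OF sr])
      moreover have "poly (map_poly (\<lambda>c. c y) [:0, 1:]) (y k) = y i" for y :: "nat \<Rightarrow> 'a"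
        using True by (simp add: map_poly_pCons)
      ultimately show ?thesis by metis
    next
      case False
      then have "[:\<lambda>y. y i:] \<in> polys_over (poly_funs K k)"
        using proj by (intro polys_over_const[OF sr] poly_funs.proj) auto
      moreover have "poly (map_poly (\<lambda>c. c y) [:\<lambda>y. y i:]) (y k) = y i" for y :: "nat \<Rightarrow> 'a"
        by (simp add: map_poly_pCons)
      ultimately show ?thesis by metis
    qed
  next
    case (add f g)
    then obtain p q where pq: "p \<in> polys_over (poly_funs K k)" "q \<in> polys_over (poly_funs K k)"
      "\<And>y. f y = poly (map_poly (\<lambda>c. c y) p) (y k)" "\<And>y. g y = poly (map_poly (\<lambda>c. c y) q) (y k)" by blast
    then show ?case
      by (intro bexI[of _ "p + q"] polys_over_add[OF sr]) (simp_all add: map_poly_homo_add[OF homo])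
  next
    case (mult f g)
    then obtain p q where pq: "p \<in> polys_over (poly_funs K k)" "q \<in> polys_over (poly_funs K k)"
      "\<And>y. f y = poly (map_poly (\<lambda>c. c y) p) (y k)" "\<And>y. g y = poly (map_poly (\<lambda>c. c y) q) (y k)" by blast
    then show ?case
      by (intro bexI[of _ "p * q"] polys_over_mult[OF sr]) (simp_all add: map_poly_homo_mult[OF homo])
  }
qed

text \<open>The induction hypothesis transfers the first \<open>k\<close> coordinates while
  preserving the signs of the functions in \<open>Q\<close>, which determine the diagrams for
  \<open>G\<close>. Evaluation at \<open>y\<close> and at \<open>z\<close> then gives matching
  diagrams, and a partner of \<open>y k\<close> becomes the last coordinate.\<close>

theorem (in ordered_cone) sign_transfer:
  assumes rc: "real_closed_sub S1" "real_closed_sub S2" and K: "subring_set K" "K \<subseteq> S1" "K \<subseteq> S2"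
    and G: "finite G" "G \<subseteq> poly_funs K k" and y: "\<And>i. i < k \<Longrightarrow> y i \<in> S1"
  shows "\<exists>z. (\<forall>i<k. z i \<in> S2) \<and> (\<forall>g\<in>G. sg (g y) = sg (g z))"
  using G y
proof (induction k arbitrary: G)
  case 0
  then show ?case using poly_funs_cong[of _ K 0 y] by (metis not_less_zero subsetD)
next
  case (Suc k)
  have "\<forall>g\<in>G. \<exists>q\<in>polys_over (poly_funs K k). \<forall>y. g y = poly (map_poly (\<lambda>c. c y) q) (y k)"
    using poly_funs_Suc[OF K(1)] Suc.prems(2) by blast
  then obtain q where q: "\<And>g. g \<in> G \<Longrightarrow> q g \<in> polys_over (poly_funs K k)"
    "\<And>g y. g \<in> G \<Longrightarrow> g y = poly (map_poly (\<lambda>c. c y) (q g)) (y k)" by metis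
  have sr: "subring_set (poly_funs K k)" by (rule subring_poly_funs[OF K(1)])
  have "sign_determined S1 S2 (poly_funs K k) (q ` G)"
    using Suc.prems(1) q(1) by (intro sign_determined_finite[OF rc sr]) auto
  then obtain Q where Q: "finite Q" "Q \<subseteq> poly_funs K k" and Qm: "\<And>\<phi> \<psi>. ring_homo \<phi> \<Longrightarrow> ring_homo \<psi> \<Longrightarrow>
      \<phi> ` poly_funs K k \<subseteq> S1 \<Longrightarrow> \<psi> ` poly_funs K k \<subseteq> S2 \<Longrightarrow> (\<forall>q\<in>Q. sg (\<phi> q) = sg (\<psi> q)) \<Longrightarrow>
      (\<exists>T. matching S1 S2 (poly_pairs \<phi> \<psi> (q ` G)) T)"
    unfolding sign_determined_def by blast
  obtain z where z: "\<forall>i<k. z i \<in> S2" "\<forall>g\<in>Q. sg (g y) = sg (g z)"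
    using Suc.IH[OF Q] Suc.prems(3) by auto
  have val: "(\<lambda>f. f y) ` poly_funs K k \<subseteq> S1" "(\<lambda>f. f z) ` poly_funs K k \<subseteq> S2"
    using poly_funs_value[OF _ real_closed_subD(2)[OF rc(1)] K(2), of _ k y]
      poly_funs_value[OF _ real_closed_subD(2)[OF rc(2)] K(3), of _ k z] Suc.prems(3) z(1) by auto
  obtain T where T: "matching S1 S2 (poly_pairs (\<lambda>f. f y) (\<lambda>f. f z) (q ` G)) T"
    using Qm[OF ring_homo_apply ring_homo_apply val] z(2) by auto
  obtain s where s: "s \<in> S2" "T (y k) s" using matchingD(1)[OF T] Suc.prems(3) by blast
  define z' where "z' = z(k := s)"
  have "sg (g y) = sg (g z')" if g: "g \<in> G" for g
  proof -
    have "map_poly (\<lambda>c. c z') (q g) = map_poly (\<lambda>c. c z) (q g)"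
    proof (rule poly_eqI)
      fix i
      have "coeff (q g) i \<in> poly_funs K k" using q(1)[OF g] by (rule polys_overD)
      then have "coeff (q g) i z' = coeff (q g) i z"
        by (rule poly_funs_cong) (simp add: z'_def)
      then show "coeff (map_poly (\<lambda>c. c z') (q g)) i = coeff (map_poly (\<lambda>c. c z) (q g)) i"
        by (simp add: coeff_map_poly_homo[OF ring_homo_apply])
    qed
    then have "g z' = poly (map_poly (\<lambda>c. c z) (q g)) s" using q(2)[OF g, of z'] by (simp add: z'_def)
    moreover have "sg (poly (map_poly (\<lambda>c. c y) (q g)) (y k)) = sg (poly (map_poly (\<lambda>c. c z) (q g)) s)"
      by (rule matchingD(5)[OF T s(2)]) (use g in \<open>auto simp: poly_pairs_def\<close>)
    ultimately show ?thesis using q(2)[OF g, of y] by simp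
  qed
  moreover have "\<forall>i<Suc k. z' i \<in> S2" using z s by (auto simp: z'_def less_Suc_eq)
  ultimately show ?case by blast
qed

section \<open>The ordering of a real closed field\<close>

inductive_set sums_of_squares :: "'b::field set \<Rightarrow> 'b set" for L where
  zero: "0 \<in> sums_of_squares L"
| step: "y \<in> L \<Longrightarrow> s \<in> sums_of_squares L \<Longrightarrow> s + y * y \<in> sums_of_squares L"

lemma sums_of_squares_iff:
  "x \<in> sums_of_squares L \<longleftrightarrow> (\<exists>(m::nat) y. (\<forall>i<m. y i \<in> L) \<and> x = (\<Sum>i<m. y i * y i))"
proof
  assume "x \<in> sums_of_squares L"
  then show "\<exists>(m::nat) y. (\<forall>i<m. y i \<in> L) \<and> x = (\<Sum>i<m. y i * y i)"
  proof (induction rule: sums_of_squares.induct)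
    case zero
    show ?case by (rule exI[of _ 0]) simp
  next
    case (step y s)
    then obtain m z where z: "\<forall>i<(m::nat). z i \<in> L" "s = (\<Sum>i<m. z i * z i)" by blast
    have "\<forall>i<Suc m. (z(m := y)) i \<in> L" using z step by (auto simp: less_Suc_eq)
    moreover have "s + y * y = (\<Sum>i<Suc m. (z(m := y)) i * (z(m := y)) i)"
      using z(2) by simp
    ultimately show ?case by blast
  qed
next
  assume "\<exists>(m::nat) y. (\<forall>i<m. y i \<in> L) \<and> x = (\<Sum>i<m. y i * y i)"
  then obtain m :: nat and y where "\<forall>i<m. y i \<in> L" "x = (\<Sum>i<m. y i * y i)" by blast
  then show "x \<in> sums_of_squares L"
    by (induction m arbitrary: x) (auto intro: sums_of_squares.intros)
qed

lemma sums_of_squares_square: "y \<in> L \<Longrightarrow> y * y \<in> sums_of_squares L"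
  using sums_of_squares.step[OF _ sums_of_squares.zero] by simp

lemma sums_of_squares_add:
  "x \<in> sums_of_squares L \<Longrightarrow> y \<in> sums_of_squares L \<Longrightarrow> x + y \<in> sums_of_squares L"
  by (induction rule: sums_of_squares.induct)
    (auto simp: add.assoc add.commute[of _ y] simp flip: add.assoc intro: sums_of_squares.intros)

lemma sums_of_squares_mult:
  assumes L: "subring_set L" and "x \<in> sums_of_squares L" "y \<in> sums_of_squares L"
  shows "x * y \<in> sums_of_squares L"
proof -
  have *: "a * a * y \<in> sums_of_squares L" if "a \<in> L" for a
    using assms(3)
  proof (induction rule: sums_of_squares.induct)
    case (step z s)
    have "a * a * (s + z * z) = a * a * s + (a * z) * (a * z)" by (simp add: algebra_simps)
    then show ?case
      using sums_of_squares.step[OF subring_setD(4)[OF L that step.hyps(1)] step.IH] by (simp only:)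
  qed (simp add: sums_of_squares.zero)
  show ?thesis
    using assms(2)
    by (induction rule: sums_of_squares.induct)
      (auto simp: distrib_right intro: sums_of_squares.zero sums_of_squares_add *)
qed

lemma sums_of_squares_subset:
  assumes "subring_set L" shows "sums_of_squares L \<subseteq> L"
proof
  fix x assume "x \<in> sums_of_squares L"
  then show "x \<in> L"
    by (induction rule: sums_of_squares.induct) (auto intro: subring_setD[OF assms])
qed

lemma preorder_cone_sums_of_squares:
  assumes "subring_set L" "- 1 \<notin> sums_of_squares L"
  shows "preorder_cone L (sums_of_squares L)"
  using assms(2) sums_of_squares_subset[OF assms(1)]
  unfolding preorder_cone_def
  by (auto intro: sums_of_squares_square sums_of_squares_add sums_of_squares_mult[OF assms(1)])

lemma (in ordered_cone) sums_of_squares_in_cone: "x \<in> sums_of_squares (signed C) \<Longrightarrow> x \<in> C"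
  by (induction rule: sums_of_squares.induct) (auto intro: C_0 C_add C_square)

lemma (in ordered_cone) m1_notin_C: "- 1 \<notin> C"
  using C_antisym[OF C_1] by auto

text \<open>Links the type class operations on a subfield \<open>M\<close> with a record
  \<open>R\<close>. It is used with \<open>id\<close> for the base field and the rational function
  field, and with an encoding by lists for the extensions in
  \<open>real_closed_field\<close>.\<close>

definition ring_copy :: "('b::field \<Rightarrow> 'c) \<Rightarrow> 'b set \<Rightarrow> 'c ring \<Rightarrow> bool" where
  "ring_copy h M R \<longleftrightarrow> inj_on h M \<and> carrier R = h ` M \<and> \<one>\<^bsub>R\<^esub> = h 1 \<and> \<zero>\<^bsub>R\<^esub> = h 0 \<and>
     (\<forall>x\<in>M. \<forall>y\<in>M. h x \<otimes>\<^bsub>R\<^esub> h y = h (x * y) \<and> h x \<oplus>\<^bsub>R\<^esub> h y = h (x + y))"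

lemma ring_copyD:
  assumes "ring_copy h M R"
  shows "inj_on h M" "carrier R = h ` M" "\<one>\<^bsub>R\<^esub> = h 1" "\<zero>\<^bsub>R\<^esub> = h 0"
    "x \<in> M \<Longrightarrow> y \<in> M \<Longrightarrow> h x \<otimes>\<^bsub>R\<^esub> h y = h (x * y)"
    "x \<in> M \<Longrightarrow> y \<in> M \<Longrightarrow> h x \<oplus>\<^bsub>R\<^esub> h y = h (x + y)"
  using assms unfolding ring_copy_def by auto

lemma ring_copy_subset: "ring_copy id M (ring_of_type_algebra\<lparr>carrier := M\<rparr>)"
  by (simp add: ring_copy_def ring_of_type_algebra_def)

lemma ring_copy_transport:
  assumes "inj_on h M"
  shows "ring_copy h M \<lparr>carrier = h ` M, monoid.mult = (\<lambda>a b. h (inv_into M h a * inv_into M h b)),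
    one = h 1, ring.zero = h 0, add = (\<lambda>a b. h (inv_into M h a + inv_into M h b))\<rparr>"
  using assms by (simp add: ring_copy_def)

section \<open>Sums of squares and evaluation in a copy of a subfield\<close>

context
  fixes h :: "'b::field \<Rightarrow> 'c" and M R
  assumes M: "subfield_set M" and R: "ring_copy h M R"
begin

lemma field_ring_copy: "field R"
proof -
  note c = ring_copyD[OF R] and m = subring_setD[OF subfield_setD(1)[OF M]]
  have "abelian_group R"
  proof (rule abelian_groupI)
    fix x assume "x \<in> carrier R"
    then obtain a where "a \<in> M" "x = h a" using c by auto
    then show "\<exists>y\<in>carrier R. y \<oplus>\<^bsub>R\<^esub> x = \<zero>\<^bsub>R\<^esub>"
      using c m by (intro bexI[of _ "h (- a)"]) auto
  qed (use c m in \<open>auto simp: algebra_simps\<close>)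
  moreover have "comm_monoid R"
    by (rule comm_monoidI) (use c m in \<open>auto simp: algebra_simps\<close>)
  ultimately have "cring R"
    by (rule cringI) (use c m in \<open>auto simp: algebra_simps\<close>)
  then interpret cring R .
  show ?thesis
  proof (rule cring_fieldI2)
    show "\<zero>\<^bsub>R\<^esub> \<noteq> \<one>\<^bsub>R\<^esub>" using c(1,3,4) m(1,2) by (auto dest: inj_onD)
    fix x assume "x \<in> carrier R" "x \<noteq> \<zero>\<^bsub>R\<^esub>"
    then obtain a where a: "a \<in> M" "x = h a" "a \<noteq> 0" using c by auto
    then show "\<exists>y\<in>carrier R. x \<otimes>\<^bsub>R\<^esub> y = \<one>\<^bsub>R\<^esub>"
      using c subfield_setD(2)[OF M a(1)] by (intro bexI[of _ "h (inverse a)"]) auto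
  qed
qed

lemma finsum_ring_copy:
  fixes m :: nat
  assumes "\<And>i. i < m \<Longrightarrow> z i \<in> M" "\<And>i. i < m \<Longrightarrow> F i = h (z i)"
  shows "(\<Oplus>\<^bsub>R\<^esub>i\<in>{..<m}. F i) = h (\<Sum>i<m. z i) \<and> (\<Sum>i<m. z i) \<in> M"
  using assms
proof (induction m)
  case 0
  interpret field R by (rule field_ring_copy)
  show ?case using ring_copyD[OF R] subring_setD(1)[OF subfield_setD(1)[OF M]] by simp
next
  case (Suc m)
  interpret field R by (rule field_ring_copy)
  have IH: "(\<Oplus>\<^bsub>R\<^esub>i\<in>{..<m}. F i) = h (\<Sum>i<m. z i)" "(\<Sum>i<m. z i) \<in> M" using Suc by auto
  have "F \<in> {..<Suc m} \<rightarrow> carrier R" using Suc.prems ring_copyD(2)[OF R] by auto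
  then have "(\<Oplus>\<^bsub>R\<^esub>i\<in>{..<Suc m}. F i) = F m \<oplus>\<^bsub>R\<^esub> (\<Oplus>\<^bsub>R\<^esub>i\<in>{..<m}. F i)"
    unfolding lessThan_Suc by (intro finsum_insert) auto
  also have "\<dots> = h (z m + (\<Sum>i<m. z i))" using IH Suc.prems ring_copyD(6)[OF R] by simp
  finally show ?case
    using IH Suc.prems subring_setD(3)[OF subfield_setD(1)[OF M]] by (simp add: add.commute)
qed

lemma sum_of_squares_ring_copy:
  assumes x: "x \<in> M"
  shows "sum_of_squares R (h x) \<longleftrightarrow> x \<in> sums_of_squares M"
proof -
  note c = ring_copyD[OF R] and m = subring_setD[OF subfield_setD(1)[OF M]]
  show ?thesis
  proof
    assume "sum_of_squares R (h x)"
    then obtain m :: nat and y where y: "y \<in> {..<m} \<rightarrow> carrier R"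
      "h x = (\<Oplus>\<^bsub>R\<^esub>i\<in>{..<m}. y i \<otimes>\<^bsub>R\<^esub> y i)" unfolding sum_of_squares_def by blast
    have "\<forall>i\<in>{..<m}. \<exists>w\<in>M. y i = h w" using y(1) c(2) by auto
    then obtain z where z: "\<forall>i\<in>{..<m}. z i \<in> M \<and> y i = h (z i)" by metis
    have f: "(\<Oplus>\<^bsub>R\<^esub>i\<in>{..<m}. y i \<otimes>\<^bsub>R\<^esub> y i) = h (\<Sum>i<m. z i * z i) \<and> (\<Sum>i<m. z i * z i) \<in> M"
      by (rule finsum_ring_copy) (use z c(5) m(4) in auto)
    then have "x = (\<Sum>i<m. z i * z i)" using y(2) c(1) x by (auto dest: inj_onD)
    then show "x \<in> sums_of_squares M" using z unfolding sums_of_squares_iff by blast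
  next
    assume "x \<in> sums_of_squares M"
    then obtain m :: nat and z where z: "\<forall>i<m. z i \<in> M" "x = (\<Sum>i<m. z i * z i)"
      unfolding sums_of_squares_iff by blast
    have f: "(\<Oplus>\<^bsub>R\<^esub>i\<in>{..<m}. h (z i) \<otimes>\<^bsub>R\<^esub> h (z i)) = h (\<Sum>i<m. z i * z i) \<and> (\<Sum>i<m. z i * z i) \<in> M"
      by (rule finsum_ring_copy) (use z c(5) m(4) in auto)
    have "(\<lambda>i. h (z i)) \<in> {..<m} \<rightarrow> carrier R" using z(1) c(2) by auto
    then show "sum_of_squares R (h x)"
      unfolding sum_of_squares_def using f z(2) by metis
  qed
qed

lemma real_field_ring_copy: "real_field R \<longleftrightarrow> - 1 \<notin> sums_of_squares M"
proof -
  interpret field R by (rule field_ring_copy)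
  note c = ring_copyD[OF R] and m = subring_setD[OF subfield_setD(1)[OF M]]
  have "h (- 1) \<oplus>\<^bsub>R\<^esub> \<one>\<^bsub>R\<^esub> = \<zero>\<^bsub>R\<^esub>" using c m by simp
  then have "\<ominus>\<^bsub>R\<^esub> \<one>\<^bsub>R\<^esub> = h (- 1)" using c(2) m by (intro minus_equality) auto
  then show ?thesis
    unfolding real_field_def using field_ring_copy sum_of_squares_ring_copy m(2,5) by simp
qed

text \<open>Lists for \<open>ring.eval\<close> start with the leading coefficient, those for
  \<open>Poly\<close> with the constant one, whence \<open>rev\<close>.\<close>

lemma eval_ring_copy:
  assumes k: "ring_homo \<kappa>" "range \<kappa> \<subseteq> M" and w: "w \<in> M"
  shows "ring.eval R (map (\<lambda>c. h (\<kappa> c)) xs) (h w) = h (poly (map_poly \<kappa> (Poly (rev xs))) w)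
    \<and> poly (map_poly \<kappa> (Poly (rev xs))) w \<in> M"
proof (induction xs)
  case Nil
  interpret field R by (rule field_ring_copy)
  show ?case using ring_copyD[OF R] subring_setD(1)[OF subfield_setD(1)[OF M]] by simp
next
  case (Cons x xs)
  interpret field R by (rule field_ring_copy)
  note c = ring_copyD[OF R] and sr = subfield_setD(1)[OF M]
  have pow: "h w [^]\<^bsub>R\<^esub> n = h (w ^ n)" for n :: nat
    by (induction n) (use c w subring_set_power[OF sr w] in \<open>auto simp: mult.commute\<close>)
  have "Poly (rev (x # xs)) = Poly (rev xs) + Polynomial.monom x (length xs)"
    by (simp add: Poly_append Polynomial.smult_monom)
  then have "poly (map_poly \<kappa> (Poly (rev (x # xs)))) w
      = \<kappa> x * w ^ length xs + poly (map_poly \<kappa> (Poly (rev xs))) w"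
    using k by (simp add: map_poly_homo_add map_poly_monom ring_homoD poly_monom)
  moreover have "\<kappa> x \<in> M" "w ^ length xs \<in> M" using k subring_set_power[OF sr w] by auto
  ultimately show ?case
    using Cons.IH c pow subring_setD(3,4)[OF sr] by simp
qed

end

text \<open>The ordered field generated by \<open>x\<close> is real and algebraic over the base
  field, so it must equal the base field. As \<open>real_closed_field\<close> speaks of fields of
  lists, the extension is first encoded by lists.\<close>

lemma real_closed_field_no_ordered_extension:
  assumes K: "real_closed_field (ring_of_type_algebra :: 'a::field ring)"
    and D: "ordered_cone D" "signed D = adjoin (range to_ac) x"
  shows "(x :: 'a alg_closure) \<in> range to_ac"
proof -
  interpret D: ordered_cone D by fact
  let ?M = "adjoin (range (to_ac :: 'a \<Rightarrow> _)) x"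
  let ?K = "ring_of_type_algebra :: 'a ring"
  have M: "subfield_set ?M" using D.subfield_signed D(2) by simp
  have homo: "ring_homo (to_ac :: 'a \<Rightarrow> _)" by (simp add: ring_homo_def)
  have sr: "subring_set (range (to_ac :: 'a \<Rightarrow> _))"
    unfolding subring_set_def
    by (safe; (rule range_eqI, rule to_ac_0[symmetric] to_ac_1[symmetric] to_ac_add[symmetric]
      to_ac_mult[symmetric] to_ac_minus[symmetric]))
  have sub: "range to_ac \<subseteq> ?M" by (rule subset_adjoin[OF sr])
  then have sub': "to_ac c \<in> ?M" for c :: 'a by blast
  \<comment> \<open>Each element is a value at \<open>x\<close> of some polynomial over the base
    field. The coefficient list of a chosen one is an injective code, because evaluation recovers
    the element.\<close>
  define g where "g y = (SOME q :: 'a poly. poly (map_poly to_ac q) x = y)" for y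
  define h where "h y = coeffs (g y)" for y
  have ex: "\<exists>q :: 'a poly. poly (map_poly to_ac q) x = y" if "y \<in> ?M" for y
  proof -
    obtain q where q: "q \<in> polys_over (range (to_ac :: 'a \<Rightarrow> _))" "y = poly q x"
      using \<open>y \<in> ?M\<close> unfolding adjoin_def by blast
    have "q = map_poly to_ac (map_poly of_ac q)"
      using q(1) unfolding polys_over_def
      by (intro poly_eqI) (simp add: coeff_map_poly to_ac_of_ac)
    then show ?thesis using q(2) by metis
  qed
  have ev: "poly (map_poly to_ac (g y)) x = y" if "y \<in> ?M" for y
    unfolding g_def by (rule someI_ex[OF ex[OF that]])
  have inj: "inj_on h ?M"
  proof (rule inj_onI)
    fix y z assume *: "y \<in> ?M" "z \<in> ?M" "h y = h z"
    then have "g y = g z" unfolding h_def by (simp add: coeffs_eq_iff)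
    then show "y = z" using ev[OF *(1)] ev[OF *(2)] by metis
  qed
  define L where "L = \<lparr>carrier = h ` ?M, monoid.mult = (\<lambda>a b. h (inv_into ?M h a * inv_into ?M h b)),
    one = h 1, ring.zero = h 0, add = (\<lambda>a b. h (inv_into ?M h a + inv_into ?M h b))\<rparr>"
  have L: "ring_copy h ?M L" unfolding L_def by (rule ring_copy_transport[OF inj])
  note c = ring_copyD[OF L]
  interpret L: field L by (rule field_ring_copy[OF M L])
  let ?h = "\<lambda>c :: 'a. h (to_ac c)"
  have car: "carrier ?K = UNIV" by (simp add: ring_of_type_algebra_def)
  have hom: "?h \<in> ring_hom ?K L"
    by (rule ring_hom_memI) (use sub' c in \<open>auto simp: ring_of_type_algebra_def\<close>)
  have alg: "ring.algebraic L (?h ` carrier ?K) y" if "y \<in> carrier L" for y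
  proof -
    obtain w where w: "w \<in> ?M" "y = h w" using \<open>y \<in> carrier L\<close> c(2) by auto
    obtain p :: "'a poly" where p: "p \<noteq> 0" "poly (map_poly to_ac p) w = 0" by (rule alg_closure_algebraic)
    define xs where "xs = map ?h (rev (coeffs p))"
    have ne: "coeffs p \<noteq> []" using p by simp
    have "hd xs = ?h (lead_coeff p)"
      using ne by (simp add: xs_def hd_map hd_rev last_coeffs_eq_coeff_degree p(1))
    moreover have "?h (lead_coeff p) \<noteq> h 0"
    proof
      assume "?h (lead_coeff p) = h 0"
      then have "to_ac (lead_coeff p) = 0"
        by (rule inj_onD[OF inj _ sub' subring_setD(1)[OF subfield_setD(1)[OF M]]])
      then show False using p(1) by simp
    qed
    ultimately have "xs \<in> carrier (univ_poly L (?h ` carrier ?K))"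
      using c(4) by (auto simp: univ_poly_def polynomial_def car xs_def)
    moreover have "xs \<noteq> []" using ne by (simp add: xs_def)
    moreover have "L.eval xs y = \<zero>\<^bsub>L\<^esub>"
      using eval_ring_copy[OF M L homo sub w(1), of "rev (coeffs p)"] p(2) c(4) w(2)
      by (simp add: xs_def)
    ultimately have "(L.algebraic over (?h ` carrier ?K)) y" by (rule L.algebraicI)
    then show ?thesis by (simp add: over_def)
  qed
  have "- 1 \<notin> sums_of_squares ?M"
    using D.sums_of_squares_in_cone[of "- 1"] D.m1_notin_C D(2) by auto
  then have "real_field L" using real_field_ring_copy[OF M L] by simp
  moreover have "algebraic_extension ?K L ?h"
    unfolding algebraic_extension_def using hom alg L.field_axioms field_from_type_algebra by blast
  ultimately have "?h ` carrier ?K = carrier L"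
    using K unfolding real_closed_field_def by blast
  moreover have "h x \<in> carrier L" using mem_adjoin[OF sr] c(2) by blast
  ultimately obtain a where "h (to_ac a) = h x" by (metis imageE)
  then have "to_ac a = x" by (rule inj_onD[OF inj _ sub' mem_adjoin[OF sr]])
  then show ?thesis by blast
qed

section \<open>Images of ordered subfields under field homomorphisms\<close>

context
  fixes \<kappa> :: "'a::field \<Rightarrow> 'b::field"
  assumes homo: "ring_homo \<kappa>"
begin

lemma field_homo: "\<kappa> (- x) = - \<kappa> x" "\<kappa> (x - y) = \<kappa> x - \<kappa> y" "\<kappa> x = 0 \<longleftrightarrow> x = 0" "inj \<kappa>"
  "\<kappa> (inverse x) = inverse (\<kappa> x)"
proof -
  have m: "\<kappa> (- x) = - \<kappa> x" for x
    using ring_homoD(3)[OF homo, of x "- x"] ring_homoD(1)[OF homo] by (simp add: add_eq_0_iff)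
  show "\<kappa> (- x) = - \<kappa> x" by (rule m)
  have d: "\<kappa> (x - y) = \<kappa> x - \<kappa> y" for x y
    using ring_homoD(3)[OF homo, of x "- y"] m[of y] by simp
  show "\<kappa> (x - y) = \<kappa> x - \<kappa> y" by (rule d)
  have z: "\<kappa> x = 0 \<longleftrightarrow> x = 0" for x
  proof
    assume "\<kappa> x = 0"
    then have "\<kappa> (x * inverse x) = 0" by (simp add: ring_homoD(4)[OF homo])
    then show "x = 0" using ring_homoD(2)[OF homo] by (metis right_inverse zero_neq_one)
  qed (simp add: ring_homoD(1)[OF homo])
  show "\<kappa> x = 0 \<longleftrightarrow> x = 0" by (rule z)
  show "inj \<kappa>" using d z by (metis injI right_minus_eq)
  show "\<kappa> (inverse x) = inverse (\<kappa> x)"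
  proof (cases "x = 0")
    case False
    then have "\<kappa> x * \<kappa> (inverse x) = 1"
      using ring_homoD(2,4)[OF homo] by (metis right_inverse)
    then show ?thesis by (metis inverse_unique)
  qed (simp add: ring_homoD(1)[OF homo])
qed

lemma subring_image: assumes "subring_set L" shows "subring_set (\<kappa> ` L)"
  unfolding subring_set_def
proof (intro conjI ballI)
  note L = subring_setD[OF assms]
  show "0 \<in> \<kappa> ` L" "1 \<in> \<kappa> ` L"
    using imageI[OF L(1), of \<kappa>] imageI[OF L(2), of \<kappa>] ring_homoD(1,2)[OF homo] by auto
  show "x + y \<in> \<kappa> ` L" "x * y \<in> \<kappa> ` L" if "x \<in> \<kappa> ` L" "y \<in> \<kappa> ` L" for x y
    using that L(3,4) by (auto simp flip: ring_homoD(3,4)[OF homo])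
  show "- x \<in> \<kappa> ` L" if "x \<in> \<kappa> ` L" for x
    using that L(5) by (auto simp flip: field_homo(1))
qed

lemma subfield_image: assumes "subfield_set L" shows "subfield_set (\<kappa> ` L)"
  using subring_image[OF subfield_setD(1)[OF assms]] subfield_setD(2)[OF assms]
  unfolding subfield_set_def by (auto simp flip: field_homo(5))

lemma signed_image: "signed (\<kappa> ` C) = \<kappa> ` signed C"
proof -
  have "- x \<in> \<kappa> ` C \<longleftrightarrow> (\<exists>y. - y \<in> C \<and> x = \<kappa> y)" for x
  proof
    assume "- x \<in> \<kappa> ` C"
    then obtain z where "z \<in> C" "- x = \<kappa> z" by blast
    then show "\<exists>y. - y \<in> C \<and> x = \<kappa> y"
      using field_homo(1)[of z] by (intro exI[of _ "- z"]) (metis minus_minus)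
  qed (auto simp flip: field_homo(1))
  then show ?thesis by (auto simp: signed_def)
qed

lemma ordered_cone_image:
  assumes "ordered_cone C" shows "ordered_cone (\<kappa> ` C)"
proof -
  interpret ordered_cone C by fact
  show ?thesis
  proof
    show "x + y \<in> \<kappa> ` C" "x * y \<in> \<kappa> ` C" if "x \<in> \<kappa> ` C" "y \<in> \<kappa> ` C" for x y
      using that C_add C_mult by (auto simp flip: ring_homoD(3,4)[OF homo])
    show "1 \<in> \<kappa> ` C" using imageI[OF C_1, of \<kappa>] ring_homoD(2)[OF homo] by simp
    show "subfield_set (signed (\<kappa> ` C))" unfolding signed_image by (rule subfield_image[OF subfield_signed])
    show "x = 0" if "x \<in> \<kappa> ` C" "- x \<in> \<kappa> ` C" for x
    proof -
      obtain y z where "y \<in> C" "x = \<kappa> y" "z \<in> C" "- x = \<kappa> z" using \<open>x \<in> _\<close> \<open>- x \<in> _\<close> by blast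
      moreover from this have "z = - y" using field_homo(1,4) by (metis injD)
      ultimately show ?thesis using C_antisym field_homo(3) by blast
    qed
  qed
qed

lemma poly_map_poly_homo: "poly (map_poly \<kappa> p) (\<kappa> x) = \<kappa> (poly p x)"
  by (induction p) (simp_all add: map_poly_pCons ring_homoD[OF homo])

lemma poly_ivt_range:
  assumes "\<And>x. \<kappa> x \<in> C \<longleftrightarrow> x \<in> P"
  shows "poly_ivt C (range \<kappa>) \<longleftrightarrow> poly_ivt P UNIV"
proof -
  have polys: "polys_over (range \<kappa>) = range (map_poly \<kappa>)"
  proof (intro equalityI subsetI)
    fix p assume "p \<in> polys_over (range \<kappa>)"
    then have "p = map_poly \<kappa> (map_poly (inv_into UNIV \<kappa>) p)"
      using field_homo(3)[of 0] field_homo(4) unfolding polys_over_def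
      by (intro poly_eqI) (auto simp: coeff_map_poly_homo[OF homo] coeff_map_poly f_inv_into_f
        inv_f_eq[OF field_homo(4)])
    then show "p \<in> range (map_poly \<kappa>)" by blast
  qed (auto simp: polys_over_def coeff_map_poly_homo[OF homo])
  have eq: "\<kappa> x - \<kappa> y = \<kappa> (x - y)" "- (\<kappa> x * \<kappa> y) = \<kappa> (- (x * y))" for x y
    by (simp_all add: field_homo ring_homoD[OF homo])
  have U: "polys_over UNIV = (UNIV :: 'a poly set)" by (simp add: polys_over_def)
  show ?thesis
    unfolding poly_ivt_def polys U by (simp add: poly_map_poly_homo eq assms field_homo(3))
qed

end

text \<open>The intermediate value theorem is obtained for the image in the algebraic closure, where
  roots exist, and pulled back along \<open>to_ac\<close>.\<close>

theorem real_closed_field_cone: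
  assumes K: "real_closed_field (ring_of_type_algebra :: 'a::field ring)"
  obtains P :: "'a::field set" where "ordered_cone P" "signed P = UNIV" "poly_ivt P UNIV"
proof -
  let ?K = "ring_of_type_algebra :: 'a ring"
  have UNIV: "subfield_set (UNIV :: 'a set)" by (simp add: subfield_set_def subring_set_def)
  have copy: "ring_copy id UNIV ?K"
    using ring_copy_subset[of "UNIV :: 'a set"] by (simp add: ring_of_type_algebra_def)
  have "- 1 \<notin> sums_of_squares (UNIV :: 'a set)"
    using real_field_ring_copy[OF UNIV copy] K by (simp add: real_closed_field_def)
  then have "preorder_cone UNIV (sums_of_squares (UNIV :: 'a set))"
    by (rule preorder_cone_sums_of_squares[OF subfield_setD(1)[OF UNIV]])
  then obtain P :: "'a set" where P: "ordered_cone P" "signed P = UNIV"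
    using preorder_cone_extends_to_ordering[OF UNIV] by metis
  have homo: "ring_homo (to_ac :: 'a \<Rightarrow> _)" by (simp add: ring_homo_def)
  have sP: "signed (to_ac ` P) = range to_ac" using signed_image[OF homo] P(2) by metis
  have "poly_ivt (to_ac ` P) (signed (to_ac ` P))"
  proof (rule poly_ivt_if_no_ordered_extension[OF ordered_cone_image[OF homo P(1)]])
    fix x D assume "ordered_cone D" "signed D = adjoin (signed (to_ac ` P)) x"
    then show "x \<in> signed (to_ac ` P)"
      unfolding sP by (rule real_closed_field_no_ordered_extension[OF K])
  qed
  then have "poly_ivt P UNIV"
    unfolding sP by (subst (asm) poly_ivt_range[OF homo]) auto
  then show ?thesis using that P by blast
qed

text \<open>The intermediate value theorem for \<open>X\<^sup>2 - x\<close> on the interval from \<open>0\<close> to \<open>1 + x\<close>.\<close>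

lemma cone_eq_squares:
  assumes P: "ordered_cone P" "signed P = UNIV" "poly_ivt P (UNIV :: 'a::field set)"
  shows "x \<in> P \<longleftrightarrow> (\<exists>y. x = y * y)"
proof
  interpret ordered_cone P by fact
  show "x \<in> P" if "\<exists>y. x = y * y" using that C_square P(2) by auto
  assume x: "x \<in> P"
  let ?p = "[:- x, 0, 1:]"
  \<comment> \<open>The value at the right end is
    \<open>(1 + x)^2 - x = 1 + x + x^2\<close>.\<close>
  have "- (poly ?p 0 * poly ?p (1 + x)) = x * (1 + x + x * x)" by (simp add: algebra_simps)
  then have "- (poly ?p 0 * poly ?p (1 + x)) \<in> P" using x C_add C_mult C_1 by metis
  moreover have "1 + x - 0 \<in> P" using x C_add C_1 by simp
  moreover have "?p \<in> polys_over UNIV" by (simp add: polys_over_def)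
  ultimately obtain c where "poly ?p c = 0" using P(3) unfolding poly_ivt_def by blast
  then have "x = c * c" by (simp add: algebra_simps)
  then show "\<exists>y. x = y * y" by blast
qed

text \<open>In any field order squares are nonnegative, and \<open>P\<close> consists of squares. An
  element outside \<open>P\<close> has its negative in \<open>P\<close>, so it cannot be
  nonnegative.\<close>

lemma the_field_order_iff:
  assumes P: "ordered_cone P" "signed P = UNIV" "poly_ivt P (UNIV :: 'a::field set)"
  shows "the_field_order x y \<longleftrightarrow> y - x \<in> P"
proof -
  interpret ordered_cone P by fact
  let ?le = "\<lambda>x y. y - x \<in> P"
  have "field_order ?le"
    unfolding field_order_def
  proof (intro conjI allI impI)
    show "class.linorder ?le (\<lambda>x y. ?le x y \<and> \<not> ?le y x)"
    proof unfold_locales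
      fix x y z :: 'a
      show "x - x \<in> P" using C_0 by simp
      show "z - x \<in> P" if "y - x \<in> P" "z - y \<in> P" using C_add[OF that] by simp
      show "x = y" if "y - x \<in> P" "x - y \<in> P" using C_antisym[of "y - x"] that by simp
      have "y - x \<in> signed P" using P(2) by simp
      then show "y - x \<in> P \<or> x - y \<in> P" by (simp add: signed_def)
    qed simp
  qed (auto intro: C_mult)
  moreover have "le = ?le" if le: "field_order le" for le
  proof -
    interpret le: linorder le "\<lambda>x y. le x y \<and> \<not> le y x" using le by (simp add: field_order_def)
    have add: "le (x + z) (y + z)" if "le x y" for x y z using le that by (simp add: field_order_def)
    have mult: "le 0 (x * y)" if "le 0 x" "le 0 y" for x y using le that by (simp add: field_order_def)
    have sq: "le 0 (y * y)" for y
    proof (cases "le 0 y")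
      case False
      then have "le 0 (- y)" using add[of y 0 "- y"] le.linear[of 0 y] by simp
      then show ?thesis using mult[of "- y" "- y"] by simp
    qed (rule mult)
    have in_P: "le 0 x \<longleftrightarrow> x \<in> P" for x
    proof
      show "le 0 x" if "x \<in> P" using that sq unfolding cone_eq_squares[OF P] by blast
      assume x: "le 0 x"
      show "x \<in> P"
      proof (rule ccontr)
        assume "x \<notin> P"
        moreover have "x \<in> signed P" using P(2) by simp
        ultimately have "- x \<in> P" by (simp add: signed_def)
        then have "le 0 (- x)" using sq unfolding cone_eq_squares[OF P] by auto
        then have "le x 0" using add[of 0 "- x" x] by simp
        then have "x = 0" using x by (rule le.order.antisym)
        then show False using \<open>x \<notin> P\<close> C_0 by simp
      qed
    qed
    have "le x y \<longleftrightarrow> le 0 (y - x)" for x y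
      using add[of x y "- x"] add[of 0 "y - x" x] by auto
    then show ?thesis using in_P by (intro ext) simp
  qed
  ultimately have "the_field_order = ?le" unfolding the_field_order_def by (rule the_equality)
  then show ?thesis by (metis (no_types))
qed

section \<open>Multivariate polynomials and rational functions\<close>

lemma sum_single_lookup:
  "(\<Sum>k\<in>Poly_Mapping.keys p. Poly_Mapping.single k (Poly_Mapping.lookup p k)) = p"
proof (rule poly_mapping_eqI)
  fix k
  have "Poly_Mapping.lookup (\<Sum>k\<in>Poly_Mapping.keys p. Poly_Mapping.single k (Poly_Mapping.lookup p k)) k
      = (\<Sum>j\<in>Poly_Mapping.keys p. if j = k then Poly_Mapping.lookup p k else 0)"
    unfolding lookup_sum by (rule sum.cong) (auto simp: lookup_single)
  also have "\<dots> = Poly_Mapping.lookup p k"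
    by (simp add: in_keys_iff)
  finally show "Poly_Mapping.lookup (\<Sum>k\<in>Poly_Mapping.keys p. Poly_Mapping.single k (Poly_Mapping.lookup p k)) k
      = Poly_Mapping.lookup p k" .
qed

definition mvar :: "nat \<Rightarrow> 'a::comm_ring_1 mpoly" where
  "mvar i = Poly_Mapping.single (Poly_Mapping.single i 1) 1"

definition mconst :: "'a::comm_ring_1 \<Rightarrow> 'a mpoly" where
  "mconst c = Poly_Mapping.single 0 c"

lemma mvar_power: "mvar i ^ e = Poly_Mapping.single (Poly_Mapping.single i e) 1"
  by (induction e) (simp_all add: mvar_def mult_single flip: single_add)

lemma prod_mvar:
  "finite A \<Longrightarrow> (\<Prod>i\<in>A. mvar i ^ e i) = Poly_Mapping.single (\<Sum>i\<in>A. Poly_Mapping.single i (e i)) 1"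
  by (induction A rule: finite_induct) (simp_all add: mvar_power mult_single)

lemma mpoly_expansion:
  "(\<Sum>m\<in>Poly_Mapping.keys p. mconst (Poly_Mapping.lookup p m) *
     (\<Prod>i\<in>Poly_Mapping.keys m. mvar i ^ Poly_Mapping.lookup m i)) = p"
  by (simp add: prod_mvar sum_single_lookup mconst_def mult_single)

lemma subring_mpolys: "subring_set (mpolys n :: 'a::field mpoly set)"
  unfolding subring_set_def
proof (intro conjI ballI)
  show "0 \<in> mpolys n" "1 \<in> mpolys n" by (auto simp: mpolys_def)
  fix p q :: "'a mpoly" assume p: "p \<in> mpolys n"
  show "- p \<in> mpolys n" using p by (auto simp: mpolys_def in_keys_iff)
  assume q: "q \<in> mpolys n"
  show "p + q \<in> mpolys n" using p q keys_add[of p q] unfolding mpolys_def by blast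
  have "Poly_Mapping.keys m \<subseteq> {..<n}" if m: "m \<in> Poly_Mapping.keys (p * q)" for m
  proof -
    obtain a b where "a \<in> Poly_Mapping.keys p" "b \<in> Poly_Mapping.keys q" "m = a + b"
      using m keys_mult[of p q] by blast
    then show ?thesis using p q keys_add[of a b] unfolding mpolys_def by blast
  qed
  then show "p * q \<in> mpolys n" by (simp add: mpolys_def)
qed

lemma mvar_in_mpolys: "i < n \<Longrightarrow> mvar i \<in> mpolys n"
  by (auto simp: mpolys_def mvar_def)

lemma mconst_in_mpolys: "mconst c \<in> mpolys n"
  by (auto simp: mpolys_def mconst_def)

text \<open>Evaluation at points of a larger field, into which \<open>\<kappa>\<close> carries the
  coefficients. The point comes last so that \<open>mpoly_eval_homo \<kappa> f\<close> is itself an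
  element of \<open>poly_funs\<close>.\<close>

definition mpoly_eval_homo :: "('a::field \<Rightarrow> 'b::field) \<Rightarrow> 'a mpoly \<Rightarrow> (nat \<Rightarrow> 'b) \<Rightarrow> 'b" where
  "mpoly_eval_homo \<kappa> f y = (\<Sum>m\<in>Poly_Mapping.keys f. \<kappa> (Poly_Mapping.lookup f m) *
     (\<Prod>i\<in>Poly_Mapping.keys m. y i ^ Poly_Mapping.lookup m i))"

lemma ring_homo_prod: "ring_homo \<phi> \<Longrightarrow> \<phi> (prod f A) = (\<Prod>i\<in>A. \<phi> (f i))"
  by (induction A rule: infinite_finite_induct) (auto simp: ring_homoD)

lemma mpoly_eval_homo_poly_funs:
  assumes "ring_homo \<kappa>" "f \<in> mpolys n"
  shows "mpoly_eval_homo \<kappa> f \<in> poly_funs (range \<kappa>) n"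
proof -
  have K: "0 \<in> range \<kappa>" "1 \<in> range \<kappa>" using ring_homoD(1,2)[OF assms(1)] by (metis rangeI)+
  have "(\<lambda>y. mpoly_eval_homo \<kappa> f y) \<in> poly_funs (range \<kappa>) n"
    unfolding mpoly_eval_homo_def using assms(2)
    by (intro poly_funs_sum poly_funs.mult poly_funs.const poly_funs_prod poly_funs_power poly_funs.proj K rangeI)
      (auto simp: mpolys_def)
  then show ?thesis by simp
qed

lemma mpoly_eval_homo_image:
  assumes "ring_homo \<kappa>"
  shows "mpoly_eval_homo \<kappa> f (\<lambda>i. \<kappa> (a i)) = \<kappa> (mpoly_eval a f)"
  unfolding mpoly_eval_homo_def mpoly_eval_def
  using assms by (simp add: ring_homo_sum ring_homo_prod ring_homo_power ring_homoD)

text \<open>At the generic point a polynomial takes itself as value, so its sign in \<open>R\<close>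
  is a sign of a polynomial function at a point.\<close>

lemma mpoly_eval_homo_generic:
  assumes "ring_homo \<phi>"
  shows "mpoly_eval_homo (\<lambda>c. \<phi> (mconst c)) f (\<lambda>i. \<phi> (mvar i)) = \<phi> f"
proof -
  have "mpoly_eval_homo (\<lambda>c. \<phi> (mconst c)) f (\<lambda>i. \<phi> (mvar i))
      = \<phi> (\<Sum>m\<in>Poly_Mapping.keys f. mconst (Poly_Mapping.lookup f m) *
          (\<Prod>i\<in>Poly_Mapping.keys m. mvar i ^ Poly_Mapping.lookup m i))"
    unfolding mpoly_eval_homo_def
    using assms by (simp add: ring_homo_sum ring_homo_prod ring_homo_power ring_homoD)
  then show ?thesis by (simp add: mpoly_expansion)
qed

text \<open>Mediates between arbitrary points and the extensional tuples over which
  \<open>positive_semidefinite\<close> ranges.\<close>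

lemma mpoly_eval_restrict:
  assumes "f \<in> mpolys n"
  shows "mpoly_eval (restrict a {..<n}) f = mpoly_eval a f"
  using assms unfolding mpoly_eval_def mpolys_def
  by (intro sum.cong prod.cong arg_cong2[of _ _ _ _ "(*)"]) auto

lemma ring_homo_mconst: "ring_homo mconst"
  by (simp add: ring_homo_def mconst_def mult_single flip: single_add)

lemma ring_homo_Fract: "ring_homo (\<lambda>p :: 'a::idom. Fraction_Field.Fract p 1)"
  by (simp add: ring_homo_def Zero_fract_def One_fract_def)

lemma ring_homo_comp: "ring_homo \<phi> \<Longrightarrow> ring_homo \<psi> \<Longrightarrow> ring_homo (\<lambda>x. \<psi> (\<phi> x))"
  by (simp add: ring_homo_def)

definition fractions_over :: "'a::idom set \<Rightarrow> 'a fract set" where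
  "fractions_over S = {Fraction_Field.Fract p q | p q. p \<in> S \<and> q \<in> S \<and> q \<noteq> 0}"

lemma subfield_fractions_over:
  assumes "subring_set S" shows "subfield_set (fractions_over S)"
proof -
  note S = subring_setD[OF assms]
  have I: "Fraction_Field.Fract p q \<in> fractions_over S" if "p \<in> S" "q \<in> S" "q \<noteq> 0" for p q
    using that unfolding fractions_over_def by blast
  have E: "\<exists>p q. x = Fraction_Field.Fract p q \<and> p \<in> S \<and> q \<in> S \<and> q \<noteq> 0" if "x \<in> fractions_over S" for x
    using that unfolding fractions_over_def by blast
  show ?thesis
    unfolding subfield_set_def subring_set_def
  proof (intro conjI ballI)
    show "0 \<in> fractions_over S" "1 \<in> fractions_over S"
      using S(1,2) by (auto simp: Zero_fract_def One_fract_def intro!: I)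
    show "x + y \<in> fractions_over S" "x * y \<in> fractions_over S"
      if "x \<in> fractions_over S" "y \<in> fractions_over S" for x y
      using E[OF that(1)] E[OF that(2)] S by (auto intro!: I)
    show "- x \<in> fractions_over S" "inverse x \<in> fractions_over S" if x: "x \<in> fractions_over S" for x
    proof -
      obtain p q where pq: "x = Fraction_Field.Fract p q" "p \<in> S" "q \<in> S" "q \<noteq> 0" using E[OF x] by blast
      then show "- x \<in> fractions_over S" using S by (auto intro!: I)
      show "inverse x \<in> fractions_over S"
      proof (cases "p = 0")
        case True
        then have "x = 0" using pq(1) by (simp add: fract_collapse)
        then show ?thesis using x by simp
      qed (use pq in \<open>auto intro!: I\<close>)
    qed
  qed
qed

text \<open>If \<open>- 1\<close> is a sum of squares, this identity makes every element one. So a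
  single element that is not a sum of squares shows the field to be real.\<close>

lemma difference_of_squares:
  fixes x :: "'b::field"
  assumes "(2::'b) \<noteq> 0"
  shows "x = ((x + 1) / 2) * ((x + 1) / 2) + - 1 * (((x - 1) / 2) * ((x - 1) / 2))"
proof -
  have "a / 2 * (a / 2) - b / 2 * (b / 2) = (a * a - b * b) / (2 * 2)" for a b :: 'b
    by (simp only: times_divide_times_eq diff_divide_distrib)
  from this[of "x + 1" "x - 1"]
  have "((x + 1) / 2) * ((x + 1) / 2) - ((x - 1) / 2) * ((x - 1) / 2)
      = ((x + 1) * (x + 1) - (x - 1) * (x - 1)) / (2 * 2)" .
  also have "(x + 1) * (x + 1) - (x - 1) * (x - 1) = x * (2 * 2)" by (simp add: algebra_simps)
  also have "x * (2 * 2) / (2 * 2) = x"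
    using assms by (intro nonzero_mult_div_cancel_right) (metis mult_eq_0_iff)
  finally show ?thesis by simp
qed

theorem mainTheorem5:
  fixes f :: "'a::field mpoly" and n :: nat
  assumes "real_closed_field (ring_of_type_algebra :: 'a ring)"
    and "f \<in> mpolys n"
    and "positive_semidefinite n f"
  shows "sum_of_squares (rational_function_field n) (Fraction_Field.Fract f 1)"
proof -
  obtain P :: "'a set" where P: "ordered_cone P" "signed P = UNIV" "poly_ivt P UNIV"
    using real_closed_field_cone[OF assms(1)] by blast
  interpret P: ordered_cone P by fact
  define F where "F = fractions_over (mpolys n :: 'a mpoly set)"
  \<comment> \<open>The ambient field is an algebraic closure of the fraction field in countably
    many variables, of which \<open>F\<close> involves the first \<open>n\<close>.\<close>
  define \<phi> where "\<phi> = (\<lambda>p :: 'a mpoly. to_ac (Fraction_Field.Fract p 1))"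
  define \<kappa> where "\<kappa> = (\<lambda>c :: 'a. \<phi> (mconst c))"
  let ?f = "Fraction_Field.Fract f 1"
  have F: "subfield_set F" unfolding F_def by (rule subfield_fractions_over[OF subring_mpolys])
  have FI: "Fraction_Field.Fract p 1 \<in> F" if "p \<in> mpolys n" for p
    using that subring_setD(2)[OF subring_mpolys, of n] unfolding F_def fractions_over_def
    by (intro CollectI exI[of _ p] exI[of _ 1]) simp
  have ac: "ring_homo (to_ac :: 'a mpoly fract \<Rightarrow> _)" by (simp add: ring_homo_def)
  have \<phi>: "ring_homo \<phi>" unfolding \<phi>_def by (rule ring_homo_comp[OF ring_homo_Fract ac])
  have \<kappa>: "ring_homo \<kappa>" unfolding \<kappa>_def by (rule ring_homo_comp[OF ring_homo_mconst \<phi>])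
  have "?f \<in> sums_of_squares F"
  proof (rule ccontr)
    assume nf: "?f \<notin> sums_of_squares F"
    \<comment> \<open>Inherited from \<open>K\<close>, where 2 is positive.\<close>
    have two: "(2 :: 'a mpoly fract) \<noteq> 0"
    proof
      assume "(2 :: 'a mpoly fract) = 0"
      then have "to_ac (1 + 1 :: 'a mpoly fract) = 0" by simp
      then have "\<kappa> (1 + 1) = 0"
        using ring_homoD(2)[OF \<kappa>] ring_homoD(3)[OF \<kappa>, of 1 1] by simp
      then show False using field_homo(3)[OF \<kappa>] P.two_neq_0 by simp
    qed
    have "- 1 \<notin> sums_of_squares F"
    proof
      assume m1: "- 1 \<in> sums_of_squares F"
      have two_F: "2 \<in> F" using subring_set_of_nat[OF subfield_setD(1)[OF F], of 2] by simp
      note R = subring_setD[OF subfield_setD(1)[OF F]]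
      have sq: "(?f + 1) / 2 \<in> F" "(?f - 1) / 2 \<in> F"
        using FI[OF assms(2)] two_F R(2,3,6) subfield_setD(3)[OF F] by auto
      have "?f = ((?f + 1) / 2) * ((?f + 1) / 2) + - 1 * (((?f - 1) / 2) * ((?f - 1) / 2))"
        by (rule difference_of_squares[OF two])
      also have "\<dots> \<in> sums_of_squares F"
        by (intro sums_of_squares_add sums_of_squares_mult[OF subfield_setD(1)[OF F]] m1 sums_of_squares_square sq)
      finally show False using nf by simp
    qed
    then have "preorder_cone F (sums_of_squares F)"
      by (rule preorder_cone_sums_of_squares[OF subfield_setD(1)[OF F]])
    then obtain T where T: "preorder_cone F T" "- ?f \<in> T"
      using preorder_cone_insert[OF F _ FI[OF assms(2)] nf] by blast
    obtain C1 where C1: "ordered_cone C1" "T \<subseteq> C1" "signed C1 = F"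
      using preorder_cone_extends_to_ordering[OF F T(1)] by blast
    \<comment> \<open>\<open>R\<close> is \<open>signed C\<close>. It is maximal among the ordered
      subfields of the whole ambient field, so it may involve further variables; the intermediate
      value theorem holds for it all the same.\<close>
    obtain C where C: "ordered_cone C" "to_ac ` C1 \<subseteq> C" "\<forall>D. ordered_cone D \<longrightarrow> C \<subseteq> D \<longrightarrow> D = C"
      using ordered_cone_maximal[OF ordered_cone_image[OF ac C1(1)]] by blast
    interpret ordered_cone C by fact
    have sub: "to_ac ` F \<subseteq> signed C"
      using C(2) signed_image[OF ac, of C1] C1(3) by (auto simp: signed_def)
    have R: "real_closed_sub (signed C)"
      unfolding real_closed_sub_def using subfield_signed poly_ivt_maximal_cone[OF C(1,3)] by simp
    have KS: "range \<kappa> \<subseteq> signed C"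
      using sub FI[OF mconst_in_mpolys] unfolding \<kappa>_def \<phi>_def by blast
    \<comment> \<open>Elements of \<open>P\<close> are squares in \<open>K\<close>, hence
      nonnegative in \<open>R\<close>; since \<open>P\<close> contains each element or its negative,
      the converse follows.\<close>
    have KC: "\<kappa> x \<in> C \<longleftrightarrow> x \<in> P" for x
    proof
      have pos: "\<kappa> x \<in> C" if x: "x \<in> P" for x
      proof -
        obtain y where y: "x = y * y" using cone_eq_squares[OF P] x by blast
        have "\<kappa> y * \<kappa> y \<in> C" using C_square KS by blast
        then show ?thesis unfolding y ring_homoD(4)[OF \<kappa>] .
      qed
      then show "x \<in> P \<Longrightarrow> \<kappa> x \<in> C" .
      assume x: "\<kappa> x \<in> C"
      show "x \<in> P"
      proof (rule ccontr)
        assume "x \<notin> P"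
        moreover have "x \<in> signed P" using P(2) by simp
        ultimately have "- x \<in> P" by (simp add: signed_def)
        then have "- \<kappa> x \<in> C" using pos[of "- x"] field_homo(1)[OF \<kappa>] by simp
        then have "x = 0" using C_antisym[OF x] field_homo(3)[OF \<kappa>] by blast
        then show False using \<open>x \<notin> P\<close> P.C_0 by simp
      qed
    qed
    have "subfield_set (range \<kappa>)"
      by (rule subfield_image[OF \<kappa>]) (simp add: subfield_set_def subring_set_def)
    moreover have "poly_ivt C (range \<kappa>)" using poly_ivt_range[OF \<kappa> KC] P(3) by blast
    ultimately have K: "real_closed_sub (range \<kappa>)" unfolding real_closed_sub_def using KS by blast
    have vars: "\<phi> (mvar i) \<in> signed C" if "i < n" for i
      using sub FI[OF mvar_in_mpolys[OF that]] unfolding \<phi>_def by blast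
    have "{mpoly_eval_homo \<kappa> f} \<subseteq> poly_funs (range \<kappa>) n"
      using mpoly_eval_homo_poly_funs[OF \<kappa> assms(2)] by simp
    \<comment> \<open>The transfer goes from \<open>R\<close> to the copy of \<open>K\<close>,
      starting at the point given by the variables.\<close>
    from sign_transfer[OF R K real_closed_subD(2)[OF K] KS order_refl _ this, of "\<lambda>i. \<phi> (mvar i)", OF _ vars]
    obtain z where z: "\<forall>i<n. z i \<in> range \<kappa>"
      "sg (mpoly_eval_homo \<kappa> f (\<lambda>i. \<phi> (mvar i))) = sg (mpoly_eval_homo \<kappa> f z)" by blast
    have "\<forall>i. \<exists>c. i < n \<longrightarrow> z i = \<kappa> c" using z(1) by blast
    then obtain a where a: "\<And>i. i < n \<Longrightarrow> z i = \<kappa> (a i)" by metis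
    have "mpoly_eval_homo \<kappa> f z = mpoly_eval_homo \<kappa> f (\<lambda>i. \<kappa> (a i))"
      by (rule poly_funs_cong[OF mpoly_eval_homo_poly_funs[OF \<kappa> assms(2)]]) (rule a)
    also have "\<dots> = \<kappa> (mpoly_eval (restrict a {..<n}) f)"
      by (simp add: mpoly_eval_homo_image[OF \<kappa>] mpoly_eval_restrict[OF assms(2)])
    also have "\<dots> \<in> C"
      using assms(3) unfolding KC positive_semidefinite_def the_field_order_iff[OF P] by force
    finally have "mpoly_eval_homo \<kappa> f z \<in> C" .
    moreover have "mpoly_eval_homo \<kappa> f (\<lambda>i. \<phi> (mvar i)) = \<phi> f"
      unfolding \<kappa>_def by (rule mpoly_eval_homo_generic[OF \<phi>])
    then have "sg (\<phi> f) = sg (mpoly_eval_homo \<kappa> f z)" using z(2) by simp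
    moreover have "- \<phi> f \<in> C"
      using T(2) C1(2) C(2) unfolding \<phi>_def by (metis image_eqI subsetD to_ac_minus)
    moreover have "\<phi> f \<noteq> 0"
    proof
      assume "\<phi> f = 0"
      then have "?f = 0" by (simp add: \<phi>_def)
      then show False using nf sums_of_squares.zero[of F] by simp
    qed
    \<comment> \<open>\<open>f\<close> is negative at the generic point, yet has the same sign at a
      point over \<open>K\<close>, where it is nonnegative.\<close>
    ultimately show False using C_antisym[of "\<phi> f"] by (auto simp: sg_def split: if_splits)
  qed
  moreover have "rational_function_field n = ring_of_type_algebra\<lparr>carrier := F\<rparr>"
    unfolding rational_function_field_def F_def fractions_over_def by simp
  ultimately show ?thesis
    using sum_of_squares_ring_copy[OF F ring_copy_subset FI[OF assms(2)]] by simp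
qed

end
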